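(* Let $\mathcal K$ be a subspace of $H^2(\partial\mathbb B)$. Then $\mathcal K$ is a closed invariant subspace (i.e. $\mathcal K$ is closed and $M_q\mathcal K\subseteq\mathcal K$) if and only if $\mathcal K=\varphi*H^2(\partial\mathbb B):=\{\varphi*f: f\in H^2(\partial\mathbb B)\}$ for some inner function $\varphi\in H^\infty(\partial\mathbb B)$. Moreover, such a function is unique up to a unitary constant in the following sense: if $\mathcal K=\varphi_1*H^2(\partial\mathbb B)=\varphi_2*H^2(\partial\mathbb B)$, with $\varphi_1,\varphi_2$ such functions, then $\varphi_2=\varphi_1*u$ for some $u\in\mathbb H$ such that $|u|=1$.
   Context: $\mathbb H$ is the skew field of quaternions, $\mathbb B=\{q\in\mathbb H:|q|<1\}$, $\mathbb S=\{q\in\mathbb H: q^2=-1\}$, and $\partial\mathbb B=\{e^{tI}: t\in\mathbb R, I\in\mathbb S\}$, where $e^{tI}=\cos t+I\sin t$. It carries the measure $d\Sigma(e^{tI})=d\sigma(I)\,dt$, with $dt$ Lebesgue measure and $\sigma$ the area measure on $\mathbb S$, normalized so that $\sigma(\mathbb S)=\Sigma(\partial\mathbb B)=1$. A function $f:\partial\mathbb B\to\mathbb H$ is a slice function if for all $J\ne K$ in $\mathbb S$ and all $x+yI\in\partial\mathbb B$ ($x,y\in\mathbb R$, $I\in\mathbb S$), $f(x+yI)=\big((J-K)^{-1}J+I(J-K)^{-1}\big)f(x+yJ)-\big((J-K)^{-1}K+I(J-K)^{-1}\big)f(x+yK)$. $L^2_s(\partial\mathbb B)$ is the space of slice functions $f$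 with $\int_{\partial\mathbb B}|f|^2\,d\Sigma<\infty$, functions equal $\Sigma$-a.e. being identified. It consists exactly of the functions $f(q)=\sum_{n\in\mathbb Z}q^na_n$ ($\Sigma$-a.e.) with $\{a_n\}\in\ell^2(\mathbb Z,\mathbb H)$, and it is a quaternionic right Hilbert space (so subspaces are right $\mathbb H$-linear) with inner product $\langle\sum q^na_n,\sum q^nb_n\rangle=\sum_n\overline{b_n}a_n$. $H^2(\partial\mathbb B)$ is the closed subspace of those $f$ with $a_n=0$ for all $n<0$; such $f$ is the boundary value of the slice regular function $\sum_{n\ge0}q^na_n$ on $\mathbb B$, also denoted $f$. A function $f:\mathbb B\to\mathbb H$ is slice regular if for each $I\in\mathbb S$ its restriction to $\mathbb B\cap(\mathbb R+\mathbb RI)$ has continuous partial derivatives and satisfies $\frac12\left(\frac{\partial}{\partial x}+I\frac{\partial}{\partial y}\right)f(x+yI)=0$. $H^\infty(\partial\mathbb B)$ is the space of boundary values on $\partial\mathbb B$ of bounded slice regular functions on $\mathbb B$; the slice regular extension to $\mathbb B$ is denoted by the same symbol. A function $\varphi\in H^\infty(\partial\mathbb B)$ is inner if $|\varphi(q)|\le1$ for $q\in\mathbb B$ and $|\varphi(q)|=1$ for $\Sigma$-a.e. $q\in\partial\mathbb B$. For $f(q)=\sum_n q^na_n$ and $g(q)=\sum_n q^nb_n$ the $*$-product is $f*g(q)=\sum_{n}q^n\sum_{k}a_kb_{n-k}$. The operator $M_q$ is $M_qf=q*f=qf$.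
   Formalization: The equivalence is stated for nonzero closed invariant subspaces: K = {0} is closed and invariant, but it is not of the form φ*H² for an inner φ, since φ*H² contains φ*1 = φ, which is nonzero. *)

theory Defs
  imports "HOL-Analysis.Analysis"
begin

section \<open>The skew field of quaternions\<close>

datatype quat = Quat (qRe: real) (qI: real) (qJ: real) (qK: real)

lemma quat_eq_iff: "p = q \<longleftrightarrow> qRe p = qRe q \<and> qI p = qI q \<and> qJ p = qJ q \<and> qK p = qK q"
  by (cases p; cases q) auto

instantiation quat :: ab_group_add
begin

definition "0 = Quat 0 0 0 0"
definition "p + q = Quat (qRe p + qRe q) (qI p + qI q) (qJ p + qJ q) (qK p + qK q)"
definition "- q = Quat (- qRe q) (- qI q) (- qJ q) (- qK q)"
definition "p - q = Quat (qRe p - qRe q) (qI p - qI q) (qJ p - qJ q) (qK p - qK q)"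

instance
  by standard
    (simp_all add: quat_eq_iff zero_quat_def plus_quat_def uminus_quat_def minus_quat_def)

end

lemma quat_add_sel [simp]:
  "qRe (p + q) = qRe p + qRe q" "qI (p + q) = qI p + qI q"
  "qJ (p + q) = qJ p + qJ q" "qK (p + q) = qK p + qK q"
  "qRe (p - q) = qRe p - qRe q" "qI (p - q) = qI p - qI q"
  "qJ (p - q) = qJ p - qJ q" "qK (p - q) = qK p - qK q"
  "qRe (- q) = - qRe q" "qI (- q) = - qI q" "qJ (- q) = - qJ q" "qK (- q) = - qK q"
  "qRe 0 = 0" "qI 0 = 0" "qJ 0 = 0" "qK 0 = 0"
  by (simp_all add: zero_quat_def plus_quat_def uminus_quat_def minus_quat_def)

instantiation quat :: ring_1
begin

definition "1 = Quat 1 0 0 0"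
definition "p * q = Quat
  (qRe p * qRe q - qI p * qI q - qJ p * qJ q - qK p * qK q)
  (qRe p * qI q + qI p * qRe q + qJ p * qK q - qK p * qJ q)
  (qRe p * qJ q - qI p * qK q + qJ p * qRe q + qK p * qI q)
  (qRe p * qK q + qI p * qJ q - qJ p * qI q + qK p * qRe q)"

instance
  by standard (simp_all add: quat_eq_iff one_quat_def times_quat_def algebra_simps)

end

lemma quat_mult_sel [simp]:
  "qRe (p * q) = qRe p * qRe q - qI p * qI q - qJ p * qJ q - qK p * qK q"
  "qI (p * q) = qRe p * qI q + qI p * qRe q + qJ p * qK q - qK p * qJ q"
  "qJ (p * q) = qRe p * qJ q - qI p * qK q + qJ p * qRe q + qK p * qI q"
  "qK (p * q) = qRe p * qK q + qI p * qJ q - qJ p * qI q + qK p * qRe q"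
  "qRe 1 = 1" "qI 1 = 0" "qJ 1 = 0" "qK 1 = 0"
  by (simp_all add: one_quat_def times_quat_def)

definition qcnj :: "quat \<Rightarrow> quat"
  where "qcnj q = Quat (qRe q) (- qI q) (- qJ q) (- qK q)"

instantiation quat :: real_algebra_1
begin

definition "r *\<^sub>R q = Quat (r * qRe q) (r * qI q) (r * qJ q) (r * qK q)"

instance
  by standard (simp_all add: quat_eq_iff scaleR_quat_def algebra_simps)

end

lemma quat_scaleR_sel [simp]:
  "qRe (r *\<^sub>R q) = r * qRe q" "qI (r *\<^sub>R q) = r * qI q"
  "qJ (r *\<^sub>R q) = r * qJ q" "qK (r *\<^sub>R q) = r * qK q"
  by (simp_all add: scaleR_quat_def)

instantiation quat :: real_inner
begin

definition "inner p q = qRe p * qRe q + qI p * qI q + qJ p * qJ q + qK p * qK q"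
definition "norm (q::quat) = sqrt (inner q q)"
definition "dist (p::quat) q = norm (p - q)"
definition "sgn (q::quat) = q /\<^sub>R norm q"
definition "uniformity = (INF e\<in>{0<..}. principal {(p::quat, q). dist p q < e})"
definition "open (U::quat set) \<longleftrightarrow>
  (\<forall>p\<in>U. eventually (\<lambda>(p', q). p' = p \<longrightarrow> q \<in> U) uniformity)"

instance
proof
  fix p q r :: quat and a :: real
  show "inner p q = inner q p" by (simp add: inner_quat_def mult.commute)
  show "inner (p + q) r = inner p r + inner q r" by (simp add: inner_quat_def algebra_simps)
  show "inner (a *\<^sub>R p) q = a * inner p q" by (simp add: inner_quat_def algebra_simps)
  show "0 \<le> inner p p" by (simp add: inner_quat_def)
  show "inner p p = 0 \<longleftrightarrow> p = 0"
    by (simp add: inner_quat_def quat_eq_iff add_nonneg_eq_0_iff)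
qed (simp_all add: norm_quat_def dist_quat_def sgn_quat_def uniformity_quat_def open_quat_def)

end

instantiation quat :: real_normed_div_algebra
begin

definition "inverse q = qcnj q /\<^sub>R inner q q"
definition "p div q = p * inverse (q::quat)"

instance
proof
  fix p q :: quat
  have "inner (p * q) (p * q) = inner p p * inner q q"
    unfolding inner_quat_def quat_mult_sel by algebra
  then show "norm (p * q) = norm p * norm q"
    by (simp add: norm_quat_def real_sqrt_mult)
  show "p div q = p * inverse q" by (simp add: divide_quat_def)
  show "inverse (0::quat) = 0" by (simp add: inverse_quat_def quat_eq_iff qcnj_def)
  assume "p \<noteq> 0"
  then have nz: "inner p p \<noteq> 0" by simp
  have "qcnj p * p = inner p p *\<^sub>R 1" "p * qcnj p = inner p p *\<^sub>R 1"
    by (simp_all add: quat_eq_iff qcnj_def inner_quat_def)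
  with nz show "inverse p * p = 1" "p * inverse p = 1"
    by (simp_all add: inverse_quat_def)
qed

end

instantiation quat :: euclidean_space
begin

definition "Basis = {Quat 1 0 0 0, Quat 0 1 0 0, Quat 0 0 1 0, Quat 0 0 0 1}"

instance
proof
  fix u v x :: quat
  show "(Basis :: quat set) \<noteq> {}" "finite (Basis :: quat set)"
    by (simp_all add: Basis_quat_def)
  show "(\<forall>u\<in>Basis. inner x u = 0) \<longleftrightarrow> x = 0"
    by (simp add: Basis_quat_def inner_quat_def quat_eq_iff [of x 0])
  assume "u \<in> Basis" "v \<in> Basis"
  then show "inner u v = (if u = v then 1 else 0)"
    unfolding Basis_quat_def inner_quat_def by (elim insertE emptyE) simp_all
qed

end


section \<open>The unit ball, its boundary and the measure on the boundary\<close>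

definition imag_units :: "quat set"
  where "imag_units = {q. q\<^sup>2 = -1}"

abbreviation slice_pt :: "real \<Rightarrow> real \<Rightarrow> quat \<Rightarrow> quat"
  where "slice_pt x y I \<equiv> of_real x + of_real y * I"

definition qexp :: "real \<Rightarrow> quat \<Rightarrow> quat"
  where "qexp t I = slice_pt (cos t) (sin t) I"

abbreviation qball :: "quat set"
  where "qball \<equiv> ball 0 1"

definition bdB :: "quat set"
  where "bdB = {qexp t I | t I. I \<in> imag_units}"

definition imag_quat :: "real ^ 3 \<Rightarrow> quat"
  where "imag_quat v = Quat 0 (v $ 1) (v $ 2) (v $ 3)"

text \<open>Normalized area measure on the 2-sphere of imaginary units. The area of a Borel subset A
  of the unit sphere of \<open>\<real>\<^sup>3\<close> is 3 times the volume of the cone \<open>{r v | 0 < r < 1, v \<in> A}\<close>;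
  normalized to total mass 1 this is the image of the uniform distribution on the unit ball under
  radial projection (the center is a null set).\<close>

definition sigma_sph :: "quat measure"
  where "sigma_sph = restrict_space
    (distr (uniform_measure lborel (ball (0 :: real ^ 3) 1)) borel (\<lambda>v. imag_quat (v /\<^sub>R norm v)))
    imag_units"

text \<open>One full period in t covers every non-real boundary point exactly twice, as (t, I) and as
  (2 pi - t, -I). Since the area measure is invariant under the antipodal map, normalizing gives
  the same measure as the parametrization by t in (0, pi).\<close>

definition Sigma_bd :: "quat measure"
  where "Sigma_bd = restrict_space
    (distr (sigma_sph \<Otimes>\<^sub>M uniform_measure lborel {0..2 * pi}) borel (\<lambda>(I, t). qexp t I))
    bdB"


section \<open>Function spaces on the boundary\<close>

text \<open>A function on the boundary is represented by a function on all quaternions whose values off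
  the boundary are irrelevant: only values on the space of \<open>Sigma_bd\<close> enter below.\<close>

definition slice_function :: "(quat \<Rightarrow> quat) \<Rightarrow> bool"
  where "slice_function f \<longleftrightarrow>
    (\<forall>J\<in>imag_units. \<forall>K\<in>imag_units. \<forall>I\<in>imag_units. \<forall>x y :: real.
      J \<noteq> K \<longrightarrow> slice_pt x y I \<in> bdB \<longrightarrow>
      f (slice_pt x y I) =
        (inverse (J - K) * J + I * inverse (J - K)) * f (slice_pt x y J)
        - (inverse (J - K) * K + I * inverse (J - K)) * f (slice_pt x y K))"

definition eq_ae :: "(quat \<Rightarrow> quat) \<Rightarrow> (quat \<Rightarrow> quat) \<Rightarrow> bool"
  where "eq_ae f g \<longleftrightarrow> (AE q in Sigma_bd. f q = g q)"

definition L2s :: "(quat \<Rightarrow> quat) set"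
  where "L2s = {f. slice_function f \<and> f \<in> borel_measurable Sigma_bd \<and>
    (\<integral>\<^sup>+ q. ennreal ((norm (f q))\<^sup>2) \<partial>Sigma_bd) < \<infinity>}"

text \<open>The expansion of f as the sum of \<open>q\<^sup>n a\<^sub>n\<close> over all integers n, with square summable
  coefficients; the series is summed in the space of square integrable functions, so that f is
  almost everywhere equal to its sum there.\<close>

definition has_coeffs :: "(quat \<Rightarrow> quat) \<Rightarrow> (int \<Rightarrow> quat) \<Rightarrow> bool"
  where "has_coeffs f a \<longleftrightarrow> f \<in> L2s \<and> (\<lambda>n. (norm (a n))\<^sup>2) summable_on UNIV \<and>
    (\<lambda>N. \<integral>\<^sup>+ q. ennreal ((norm (f q - (\<Sum>n = - int N..int N. q powi n * a n)))\<^sup>2) \<partial>Sigma_bd)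
      \<longlonglongrightarrow> 0"

definition coeff_bd :: "(quat \<Rightarrow> quat) \<Rightarrow> int \<Rightarrow> quat"
  where "coeff_bd f = (THE a. has_coeffs f a)"

definition inner_bd :: "(quat \<Rightarrow> quat) \<Rightarrow> (quat \<Rightarrow> quat) \<Rightarrow> quat"
  where "inner_bd f g = (\<Sum>\<^sub>\<infinity>n. qcnj (coeff_bd g n) * coeff_bd f n)"

definition norm_bd :: "(quat \<Rightarrow> quat) \<Rightarrow> real"
  where "norm_bd f = sqrt (qRe (inner_bd f f))"

definition H2 :: "(quat \<Rightarrow> quat) set"
  where "H2 = {f. \<exists>a. has_coeffs f a \<and> (\<forall>n<0. a n = 0)}"

text \<open>Subspaces of the quotient of \<open>H2\<close> by equality almost everywhere correspond to sets of
  representatives that are closed under this equality.\<close>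

definition subspace_H2 :: "(quat \<Rightarrow> quat) set \<Rightarrow> bool"
  where "subspace_H2 K \<longleftrightarrow> K \<subseteq> H2 \<and>
    (\<forall>f\<in>K. \<forall>g\<in>H2. eq_ae f g \<longrightarrow> g \<in> K) \<and>
    (\<lambda>q. 0) \<in> K \<and>
    (\<forall>f\<in>K. \<forall>g\<in>K. (\<lambda>q. f q + g q) \<in> K) \<and>
    (\<forall>f\<in>K. \<forall>c. (\<lambda>q. f q * c) \<in> K)"

definition closed_H2 :: "(quat \<Rightarrow> quat) set \<Rightarrow> bool"
  where "closed_H2 K \<longleftrightarrow>
    (\<forall>F. \<forall>f\<in>H2. (\<forall>k::nat. F k \<in> K) \<and> (\<lambda>k. norm_bd (\<lambda>q. F k q - f q)) \<longlonglongrightarrow> 0 \<longrightarrow> f \<in> K)"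

definition Mq :: "(quat \<Rightarrow> quat) \<Rightarrow> quat \<Rightarrow> quat"
  where "Mq f = (\<lambda>q. q * f q)"


section \<open>Slice regular functions and inner functions\<close>

definition slice_regular :: "(quat \<Rightarrow> quat) \<Rightarrow> bool"
  where "slice_regular F \<longleftrightarrow>
    (\<forall>I\<in>imag_units. \<exists>Fx Fy :: real \<times> real \<Rightarrow> quat.
      continuous_on {(x, y). slice_pt x y I \<in> qball} Fx \<and>
      continuous_on {(x, y). slice_pt x y I \<in> qball} Fy \<and>
      (\<forall>x y. slice_pt x y I \<in> qball \<longrightarrow>
        ((\<lambda>s. F (slice_pt s y I)) has_vector_derivative Fx (x, y)) (at x) \<and>
        ((\<lambda>s. F (slice_pt x s I)) has_vector_derivative Fy (x, y)) (at y) \<and>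
        (1 / 2) *\<^sub>R (Fx (x, y) + I * Fy (x, y)) = 0))"

text \<open>The boundary value of a power series in the ball with square summable coefficients is the
  element of \<open>H2\<close> with the same coefficients.\<close>

definition boundary_value :: "(quat \<Rightarrow> quat) \<Rightarrow> (quat \<Rightarrow> quat) \<Rightarrow> bool"
  where "boundary_value F f \<longleftrightarrow>
    (\<exists>a. has_coeffs f a \<and> (\<forall>n<0. a n = 0) \<and>
      (\<forall>q\<in>qball. (\<lambda>n. q ^ n * a (int n)) sums F q))"

definition Hinf :: "(quat \<Rightarrow> quat) set"
  where "Hinf = {f. \<exists>F. slice_regular F \<and> bounded (F ` qball) \<and> boundary_value F f}"

definition inner_function :: "(quat \<Rightarrow> quat) \<Rightarrow> bool"
  where "inner_function f \<longleftrightarrow> f \<in> Hinf \<and>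
    (\<exists>F. slice_regular F \<and> boundary_value F f \<and> (\<forall>q\<in>qball. norm (F q) \<le> 1)) \<and>
    (AE q in Sigma_bd. norm (f q) = 1)"

text \<open>\<open>is_star f g h\<close>: the function h represents the star product of f and g, which is determined
  by its coefficients and hence only up to equality almost everywhere.\<close>

definition is_star :: "(quat \<Rightarrow> quat) \<Rightarrow> (quat \<Rightarrow> quat) \<Rightarrow> (quat \<Rightarrow> quat) \<Rightarrow> bool"
  where "is_star f g h \<longleftrightarrow>
    (\<exists>a b. has_coeffs f a \<and> has_coeffs g b \<and>
      has_coeffs h (\<lambda>n. \<Sum>\<^sub>\<infinity>k. a k * b (n - k)))"

definition star_H2 :: "(quat \<Rightarrow> quat) \<Rightarrow> (quat \<Rightarrow> quat) set"
  where "star_H2 f = {h. \<exists>g\<in>H2. is_star f g h}"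

end

theory Submission
  imports Defs
begin

text \<open>Everything is read off the coefficient sequences in \<open>\<ell>\<^sup>2(\<int>)\<close>. Call a unit vector \<open>a\<close>
  wandering if it is orthogonal to all \<open>q\<^sup>k a p\<close> with \<open>k \<noteq> 0\<close>. Then \<open>f \<mapsto> a * f\<close> is isometric. Let
  \<open>a~\<close> have the coefficients \<open>qcnj (a (- n))\<close>. Since \<open>a * a~\<close> has norm 1 and its coefficient at 0 is
  already 1, it is the constant 1, so that \<open>a\<close> acts unitarily with inverse \<open>a~\<close>. In a closed
  invariant \<open>K \<noteq> {0}\<close> pick a unit vector \<open>a\<close> orthogonal to \<open>q K\<close>; it is wandering, and for \<open>g \<in> K\<close>
  the sequence \<open>a~ * g\<close> has no negative coefficients, hence \<open>g = a * (a~ * g)\<close> lies in \<open>a * H\<^sup>2\<close>.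

  A function with coefficients supported in \<open>\<nat>\<close> is inner iff its coefficient sequence is wandering.
  If \<open>a\<close> is wandering, the isometry \<open>a~ *\<close> applied to the kernel of a point gives the bound 1 on the
  ball; letting the radius tend to 1, the boundary function is bounded by 1, and its \<open>L\<^sup>2\<close> norm 1
  forces modulus 1. Conversely, multiplication by a unimodular \<open>\<phi>\<close> preserves the norm of
  \<open>1 + q\<^sup>k u\<close> on almost every slice \<open>I\<close>, for \<open>u = 1\<close> and \<open>u = I\<close>; as no great circle has full
  measure, this makes \<open>a~\<close> wandering, hence \<open>a\<close>.\<close>

section \<open>Conjugation of quaternions\<close>

text \<open>Noncommutativity is the obstacle. Being wandering makes the sums of
  \<open>qcnj (a (n - k)) * a n\<close> vanish, whereas the norm on a slice sees products in the
  other order, \<open>a n * qcnj (a (n - k))\<close>. A single slice \<open>I\<close> admits only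
  left factors commuting with \<open>I\<close>, hence shows only the components of that sum along 1
  and \<open>I\<close>; varying \<open>I\<close> recovers the others. Passing between the two orders
  is the step between \<open>a\<close> and \<open>a~\<close>, that is, from a one-sided to a
  two-sided inverse. The convolution of two square summable sequences need not be square summable,
  so multiplication is set up for wandering vectors only, as an orthogonal series. All star products
  are taken on coefficients; the pointwise formula, in which the argument of the second factor is
  conjugated by the value of the first, never enters. Pointwise products occur only within one
  slice, with the factor \<open>1 + q^k u\<close> on the left.\<close>

lemma qcnj_sel [simp]:
  "qRe (qcnj q) = qRe q" "qI (qcnj q) = - qI q" "qJ (qcnj q) = - qJ q" "qK (qcnj q) = - qK q"
  by (simp_all add: qcnj_def)

lemma qcnj_simps [simp]:
  "qcnj (qcnj p) = p" "qcnj 0 = 0" "qcnj 1 = 1" "qcnj (p + q) = qcnj p + qcnj q"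
  "qcnj (p - q) = qcnj p - qcnj q" "qcnj (r *\<^sub>R p) = r *\<^sub>R qcnj p"
  by (simp_all add: quat_eq_iff)

lemma qcnj_mult: "qcnj (p * q) = qcnj q * qcnj p"
  by (simp add: quat_eq_iff)

lemma qcnj_power: "qcnj (q ^ n) = qcnj q ^ n"
  by (induction n) (simp_all add: qcnj_mult power_commutes)

lemma inner_qcnj [simp]: "inner (qcnj p) (qcnj q) = inner p q"
  by (simp add: inner_quat_def)

lemma norm_qcnj [simp]: "norm (qcnj q) = norm q"
  by (simp add: norm_quat_def)

lemma inner_mult_left_quat: "inner (p * x) y = inner x (qcnj p * y)"
  by (simp add: inner_quat_def algebra_simps)

lemma inner_mult_right_quat: "inner (x * p) y = inner x (y * qcnj p)"
  by (simp add: inner_quat_def algebra_simps)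

lemma mult_qcnj_self: "q * qcnj q = of_real ((norm q)\<^sup>2)" "qcnj q * q = of_real ((norm q)\<^sup>2)"
  by (simp_all add: quat_eq_iff of_real_def norm_quat_def inner_quat_def)

lemma bounded_linear_qcnj: "bounded_linear qcnj"
  by (rule bounded_linear_intro[of _ 1]) simp_all

section \<open>The Hilbert space of square summable quaternionic sequences\<close>

lemma square_summable_product:
  fixes a b :: "'i \<Rightarrow> 'a::real_normed_vector"
  assumes "(\<lambda>n. (norm (a n))\<^sup>2) summable_on A" "(\<lambda>n. (norm (b n))\<^sup>2) summable_on A"
  shows "(\<lambda>n. norm (a n) * norm (b n)) summable_on A"
proof (rule summable_on_comparison_test)
  show "(\<lambda>n. (norm (a n))\<^sup>2 + (norm (b n))\<^sup>2) summable_on A"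
    by (rule summable_on_add assms)+
  show "norm (a n) * norm (b n) \<le> (norm (a n))\<^sup>2 + (norm (b n))\<^sup>2" for n
    using sum_squares_bound[of "norm (a n)" "norm (b n)"]
      mult_nonneg_nonneg[OF norm_ge_zero[of "a n"] norm_ge_zero[of "b n"]] by linarith
qed auto

lemma square_summable_add:
  fixes a b :: "'i \<Rightarrow> 'a::real_normed_vector"
  assumes "(\<lambda>n. (norm (a n))\<^sup>2) summable_on A" "(\<lambda>n. (norm (b n))\<^sup>2) summable_on A"
  shows "(\<lambda>n. (norm (a n + b n))\<^sup>2) summable_on A"
proof (rule summable_on_comparison_test)
  show "(\<lambda>n. 2 * (norm (a n))\<^sup>2 + 2 * (norm (b n))\<^sup>2) summable_on A"
    by (intro summable_on_add summable_on_cmult_right assms)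
  fix n
  have "(norm (a n + b n))\<^sup>2 \<le> (norm (a n) + norm (b n))\<^sup>2"
    by (simp add: norm_triangle_ineq)
  also have "\<dots> \<le> 2 * (norm (a n))\<^sup>2 + 2 * (norm (b n))\<^sup>2"
    using sum_squares_bound[of "norm (a n)" "norm (b n)"] by (simp add: power2_sum)
  finally show "(norm (a n + b n))\<^sup>2 \<le> 2 * (norm (a n))\<^sup>2 + 2 * (norm (b n))\<^sup>2" .
qed auto

typedef ell2 = "{a :: int \<Rightarrow> quat. (\<lambda>n. (norm (a n))\<^sup>2) summable_on UNIV}"
  morphisms seq Ell2
  by (rule exI[of _ "\<lambda>_. 0"]) simp

setup_lifting type_definition_ell2

lemma seq_eqI: "(\<And>n. seq a n = seq b n) \<Longrightarrow> a = b"
  by (simp add: seq_inject[symmetric] ext)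

lemma square_summable_seq: "(\<lambda>n. (norm (seq a n))\<^sup>2) summable_on UNIV"
  using seq[of a] by simp

lemma inner_abs_summable_seq: "(\<lambda>n. norm (inner (seq a n) (seq b n))) summable_on UNIV"
proof (rule summable_on_comparison_test)
  show "(\<lambda>n. norm (seq a n) * norm (seq b n)) summable_on UNIV"
    by (rule square_summable_product) (rule square_summable_seq)+
qed (auto simp: Cauchy_Schwarz_ineq2)

lemmas inner_summable_seq = abs_summable_summable[OF inner_abs_summable_seq]

instantiation ell2 :: real_vector
begin

lift_definition zero_ell2 :: ell2 is "\<lambda>n. 0" by simp

lift_definition plus_ell2 :: "ell2 \<Rightarrow> ell2 \<Rightarrow> ell2" is "\<lambda>a b n. a n + b n"
  by (rule square_summable_add)

lift_definition uminus_ell2 :: "ell2 \<Rightarrow> ell2" is "\<lambda>a n. - a n" by simp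

lift_definition minus_ell2 :: "ell2 \<Rightarrow> ell2 \<Rightarrow> ell2" is "\<lambda>a b n. a n - b n"
  using square_summable_add[of _ UNIV "\<lambda>n. - _ n"] by simp

lift_definition scaleR_ell2 :: "real \<Rightarrow> ell2 \<Rightarrow> ell2" is "\<lambda>r a n. r *\<^sub>R a n"
  by (simp add: power_mult_distrib summable_on_cmult_right)

instance
  by standard (transfer; simp add: fun_eq_iff algebra_simps)+

end

lemma seq_simps [simp]:
  "seq 0 n = 0" "seq (a + b) n = seq a n + seq b n" "seq (- a) n = - seq a n"
  "seq (a - b) n = seq a n - seq b n" "seq (r *\<^sub>R a) n = r *\<^sub>R seq a n"
  by (transfer; simp)+

instantiation ell2 :: real_inner
begin

definition "inner a b = (\<Sum>\<^sub>\<infinity>n. inner (seq a n) (seq b n))"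
definition "norm (a::ell2) = sqrt (inner a a)"
definition "dist (a::ell2) b = norm (a - b)"
definition "sgn (a::ell2) = a /\<^sub>R norm a"
definition "uniformity = (INF e\<in>{0<..}. principal {(a::ell2, b). dist a b < e})"
definition "open (U::ell2 set) \<longleftrightarrow>
  (\<forall>a\<in>U. eventually (\<lambda>(a', b). a' = a \<longrightarrow> b \<in> U) uniformity)"

instance
proof
  fix a b c :: ell2 and r :: real
  show "inner a b = inner b a" by (simp add: inner_ell2_def inner_commute)
  show "inner (a + b) c = inner a c + inner b c"
    by (simp add: inner_ell2_def inner_add_left infsum_add inner_summable_seq)
  show "inner (r *\<^sub>R a) b = r * inner a b"
    by (simp add: inner_ell2_def infsum_cmult_right')
  show "0 \<le> inner a a"
    by (simp add: inner_ell2_def infsum_nonneg)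
  show "inner a a = 0 \<longleftrightarrow> a = 0"
  proof
    assume "inner a a = 0"
    then have "inner (seq a n) (seq a n) = 0" for n
      by (intro nonneg_infsum_le_0D[where A = UNIV and f = "\<lambda>n. inner (seq a n) (seq a n)"])
        (auto simp: inner_ell2_def inner_summable_seq)
    then show "a = 0" by (intro seq_eqI) simp
  qed (simp add: inner_ell2_def)
qed (simp_all add: norm_ell2_def dist_ell2_def sgn_ell2_def uniformity_ell2_def open_ell2_def)

end

lemma norm_ell2_has_sum: "((\<lambda>n. (norm (seq a n))\<^sup>2) has_sum (norm a)\<^sup>2) UNIV"
  using has_sum_infsum[OF square_summable_seq[of a]]
  by (simp add: power2_norm_eq_inner inner_ell2_def)

lemma norm_ell2_sum_le: "finite F \<Longrightarrow> (\<Sum>n\<in>F. (norm (seq a n))\<^sup>2) \<le> (norm a)\<^sup>2"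
  by (rule finite_sum_le_has_sum[OF norm_ell2_has_sum]) auto

lemma norm_seq_le: "norm (seq a n) \<le> norm a"
  using norm_ell2_sum_le[of "{n}" a] by (simp add: power2_le_iff_abs_le)

lemma bounded_linear_seq: "bounded_linear (\<lambda>a. seq a n)"
  by (rule bounded_linear_intro[of _ 1]) (simp_all add: norm_seq_le)

text \<open>Bounds on finite partial sums survive coordinatewise limits, which is how the
  completeness proof uses them: one such bound gives both square summability and the norm
  estimate.\<close>

lemma Ell2_normI:
  assumes "\<And>F. finite F \<Longrightarrow> (\<Sum>n\<in>F. (norm (a n))\<^sup>2) \<le> r\<^sup>2" "0 \<le> r"
  shows "(\<lambda>n. (norm (a n))\<^sup>2) summable_on UNIV" "norm (Ell2 a) \<le> r"
proof -
  show *: "(\<lambda>n. (norm (a n))\<^sup>2) summable_on UNIV"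
    by (rule nonneg_bdd_above_summable_on) (use assms in \<open>auto intro!: bdd_aboveI2\<close>)
  have "(norm (Ell2 a))\<^sup>2 = (\<Sum>\<^sub>\<infinity>n. (norm (a n))\<^sup>2)"
    using norm_ell2_has_sum[of "Ell2 a"] * by (simp add: Ell2_inverse infsumI)
  also have "\<dots> \<le> r\<^sup>2"
    by (rule infsum_le_finite_sums) (use assms * in auto)
  finally show "norm (Ell2 a) \<le> r"
    using assms(2) by (rule power2_le_imp_le)
qed

instance ell2 :: complete_space
proof
  fix X :: "nat \<Rightarrow> ell2"
  assume X: "Cauchy X"
  have "\<exists>l. (\<lambda>k. seq (X k) n) \<longlonglongrightarrow> l" for n
    using bounded_linear.Cauchy[OF bounded_linear_seq X]
    by (simp add: Cauchy_convergent_iff convergent_def)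
  then obtain l where l: "\<And>n. (\<lambda>k. seq (X k) n) \<longlonglongrightarrow> l n" by metis
  have tail: "\<exists>M. \<forall>k\<ge>M. (\<lambda>n. (norm (seq (X k) n - l n))\<^sup>2) summable_on UNIV
      \<and> norm (Ell2 (\<lambda>n. seq (X k) n - l n)) \<le> e" if "0 < e" for e
  proof -
    obtain M where M: "\<And>k m. k \<ge> M \<Longrightarrow> m \<ge> M \<Longrightarrow> norm (X k - X m) < e"
      using CauchyD[OF X \<open>0 < e\<close>] by blast
    \<comment> \<open>Coordinatewise convergence controls finitely many indices at a time, so the
      limit in \<open>m\<close> is taken on a fixed finite set \<open>F\<close>; the bound is
      uniform in \<open>F\<close>.\<close>
    have "(\<Sum>n\<in>F. (norm (seq (X k) n - l n))\<^sup>2) \<le> e\<^sup>2" if "finite F" "k \<ge> M" for F k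
    proof (rule LIMSEQ_le_const2)
      show "(\<lambda>m. \<Sum>n\<in>F. (norm (seq (X k) n - seq (X m) n))\<^sup>2)
          \<longlonglongrightarrow> (\<Sum>n\<in>F. (norm (seq (X k) n - l n))\<^sup>2)"
        by (intro tendsto_intros l)
      have "(\<Sum>n\<in>F. (norm (seq (X k) n - seq (X m) n))\<^sup>2) \<le> e\<^sup>2" if "m \<ge> M" for m
      proof -
        have "(\<Sum>n\<in>F. (norm (seq (X k) n - seq (X m) n))\<^sup>2) \<le> (norm (X k - X m))\<^sup>2"
          using norm_ell2_sum_le[OF \<open>finite F\<close>, of "X k - X m"] by simp
        also have "\<dots> \<le> e\<^sup>2"
          using M[OF \<open>k \<ge> M\<close> that] by (intro power_mono) auto
        finally show ?thesis .
      qed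
      then show "\<exists>N. \<forall>m\<ge>N. (\<Sum>n\<in>F. (norm (seq (X k) n - seq (X m) n))\<^sup>2) \<le> e\<^sup>2" by blast
    qed
    then show ?thesis
      using Ell2_normI[of "\<lambda>n. seq (X _) n - l n" e] \<open>0 < e\<close> by (intro exI[of _ M]) auto
  qed
  obtain M where M: "(\<lambda>n. (norm (seq (X M) n - l n))\<^sup>2) summable_on UNIV"
    using tail[of 1] by auto
  have "(\<lambda>n. (norm (l n))\<^sup>2) summable_on UNIV"
    using square_summable_add[OF square_summable_seq[of "X M"],
        of "\<lambda>n. l n - seq (X M) n"] M by (simp add: norm_minus_commute)
  then have L: "seq (Ell2 l) = l" by (simp add: Ell2_inverse)
  have diff: "Ell2 (\<lambda>n. seq (X k) n - l n) = X k - Ell2 l" for k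
  proof -
    have "seq (X k - Ell2 l) = (\<lambda>n. seq (X k) n - l n)" by (simp add: L fun_eq_iff)
    then show ?thesis by (metis seq_inverse)
  qed
  have "X \<longlonglongrightarrow> Ell2 l"
  proof (rule LIMSEQ_I)
    fix e :: real assume "0 < e"
    then obtain M where "\<forall>k\<ge>M. norm (X k - Ell2 l) \<le> e / 2"
      using tail[of "e / 2"] unfolding diff by auto
    then show "\<exists>M. \<forall>k\<ge>M. norm (X k - Ell2 l) < e"
      using \<open>0 < e\<close> by (intro exI[of _ M]) force
  qed
  then show "convergent X" by (auto simp: convergent_def)
qed

instance ell2 :: banach ..

text \<open>\<open>has_sum\<close> runs along the net of finite index sets,
  \<open>has_coeffs\<close> along symmetric intervals; cofinality of the intervals lets the first
  kind of convergence imply the second.\<close>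

lemma filterlim_symmetric_intervals:
  "filterlim (\<lambda>N. {- int N..int N}) (finite_subsets_at_top UNIV) sequentially"
  unfolding filterlim_finite_subsets_at_top
proof safe
  fix F :: "int set" assume "finite F"
  have "F \<subseteq> {- int N..int N}" if "nat (Max (insert 0 (abs ` F))) \<le> N" for N
  proof
    fix i assume "i \<in> F"
    then have "\<bar>i\<bar> \<le> Max (insert 0 (abs ` F))" using \<open>finite F\<close> by (intro Max_ge) auto
    then show "i \<in> {- int N..int N}" using that by auto
  qed
  then show "eventually (\<lambda>N. finite {- int N..int N} \<and> F \<subseteq> {- int N..int N} \<and> {- int N..int N} \<subseteq> UNIV) sequentially"
    by (intro eventually_sequentiallyI) auto
qed

lemma has_sum_imp_symmetric_limit:
  "(f has_sum s) UNIV \<Longrightarrow> (\<lambda>N. \<Sum>n = - int N..int N. f n) \<longlonglongrightarrow> s"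
  unfolding has_sum_def by (rule filterlim_compose[OF _ filterlim_symmetric_intervals])

text \<open>By Pythagoras, partial sums over nested finite sets differ in square norm by exactly the
  difference of their square sums, so they are Cauchy along the intervals \<open>W N\<close>. The
  limit then satisfies an exact error identity for every finite set, which upgrades convergence from
  intervals to the whole net.\<close>

lemma orthogonal_series:
  fixes v :: "int \<Rightarrow> 'a::{real_inner, banach}"
  assumes orth: "\<And>i j. i \<noteq> j \<Longrightarrow> orthogonal (v i) (v j)"
    and S: "((\<lambda>i. (norm (v i))\<^sup>2) has_sum S) UNIV"
  shows "\<exists>s. (v has_sum s) UNIV \<and> (norm s)\<^sup>2 = S"
proof -
  define W where "W N = {- int N..int N}" for N
  define p where "p F = (\<Sum>i\<in>F. (norm (v i))\<^sup>2)" for F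
  have W: "finite (W N)" "M \<le> N \<Longrightarrow> W M \<subseteq> W N" for M N
    by (auto simp: W_def)
  have W_lim: "filterlim W (finite_subsets_at_top UNIV) sequentially"
    using filterlim_symmetric_intervals by (simp add: W_def[abs_def])
  have pyth: "(norm (sum v F))\<^sup>2 = p F" if "finite F" for F
    unfolding p_def using that by (intro norm_sum_Pythagorean) (auto simp: pairwise_def orth)
  have diff: "(norm (sum v F - sum v G))\<^sup>2 = p F - p G" if "finite F" "G \<subseteq> F" for F G
    using pyth[of "F - G"] that by (simp add: sum_diff p_def)
  have pW: "(\<lambda>N. p (W N)) \<longlonglongrightarrow> S"
    using has_sum_imp_symmetric_limit[OF S] by (simp add: p_def W_def)
  have "Cauchy (\<lambda>N. sum v (W N))"
  proof (rule CauchyI)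
    fix e :: real assume "0 < e"
    then obtain M where M: "\<And>m n. m \<ge> M \<Longrightarrow> n \<ge> M \<Longrightarrow> norm (p (W m) - p (W n)) < e\<^sup>2"
      using CauchyD[OF LIMSEQ_imp_Cauchy[OF pW], of "e\<^sup>2"] by (auto simp del: real_norm_def)
    have "norm (sum v (W m) - sum v (W n)) < e" if "m \<ge> M" "n \<ge> M" "n \<le> m" for m n
    proof -
      have "(norm (sum v (W m) - sum v (W n)))\<^sup>2 = p (W m) - p (W n)"
        by (rule diff[OF W(1) W(2)[OF that(3)]])
      also have "\<dots> < e\<^sup>2" using M[OF that(1,2)] by simp
      finally show ?thesis using \<open>0 < e\<close> by (simp add: power2_less_imp_less)
    qed
    then show "\<exists>M. \<forall>m\<ge>M. \<forall>n\<ge>M. norm (sum v (W m) - sum v (W n)) < e"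
      by (metis nle_le norm_minus_commute)
  qed
  then obtain s where s: "(\<lambda>N. sum v (W N)) \<longlonglongrightarrow> s"
    using Cauchy_convergent convergent_def by blast
  \<comment> \<open>Every finite \<open>F\<close> is eventually contained in \<open>W N\<close>,
    where \<open>diff\<close> applies; \<open>N\<close> then tends to infinity.\<close>
  have tail: "(norm (s - sum v F))\<^sup>2 = S - p F" if F: "finite F" for F
  proof (rule LIMSEQ_unique)
    show "(\<lambda>N. (norm (sum v (W N) - sum v F))\<^sup>2) \<longlonglongrightarrow> (norm (s - sum v F))\<^sup>2"
      by (intro tendsto_intros s)
    have "\<forall>\<^sub>F n in sequentially. finite (W n) \<and> F \<subseteq> W n \<and> W n \<subseteq> UNIV"
      using W_lim F unfolding filterlim_finite_subsets_at_top by blast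
    then have "\<forall>\<^sub>F n in sequentially. p (W n) - p F = (norm (sum v (W n) - sum v F))\<^sup>2"
      by eventually_elim (simp add: diff W(1))
    moreover have "(\<lambda>n. p (W n) - p F) \<longlonglongrightarrow> S - p F"
      by (intro tendsto_intros pW)
    ultimately show "(\<lambda>N. (norm (sum v (W N) - sum v F))\<^sup>2) \<longlonglongrightarrow> S - p F"
      by (rule Lim_transform_eventually[rotated])
  qed
  have "((\<lambda>F. S - p F) \<longlongrightarrow> S - S) (finite_subsets_at_top UNIV)"
    using S unfolding has_sum_def p_def by (intro tendsto_intros)
  then have "((\<lambda>F. sqrt (S - p F)) \<longlongrightarrow> sqrt 0) (finite_subsets_at_top UNIV)"
    by (intro tendsto_real_sqrt) simp
  moreover have "\<forall>\<^sub>F F in finite_subsets_at_top UNIV. sqrt (S - p F) = norm (sum v F - s)"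
    by (rule eventually_finite_subsets_at_top_weakI) (simp add: tail[symmetric] norm_minus_commute)
  ultimately have "((\<lambda>F. norm (sum v F - s)) \<longlongrightarrow> 0) (finite_subsets_at_top UNIV)"
    using Lim_transform_eventually by fastforce
  then have "(v has_sum s) UNIV"
    unfolding has_sum_def by (simp add: tendsto_norm_zero_iff LIM_zero_iff)
  moreover have "(norm s)\<^sup>2 = S" using tail[of "{}"] by (simp add: p_def)
  ultimately show ?thesis by blast
qed

lemma has_sum_bij:
  fixes f :: "'a \<Rightarrow> 'b::{comm_monoid_add, topological_space}"
  assumes "bij g"
  shows "((\<lambda>x. f (g x)) has_sum s) UNIV \<longleftrightarrow> (f has_sum s) UNIV"
  using has_sum_reindex_bij_betw[OF assms] .

section \<open>Shifts, convolution and wandering vectors\<close>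

text \<open>On coefficient sequences, \<open>shift k\<close> is multiplication by \<open>q\<^sup>k\<close>, \<open>conv\<close> is the star product, and
  \<open>conv (tilde a)\<close> is the adjoint of \<open>conv a\<close>.\<close>

lift_definition shift :: "int \<Rightarrow> ell2 \<Rightarrow> ell2" is "\<lambda>k a n. a (n - k)"
proof -
  fix k :: int and a :: "int \<Rightarrow> quat"
  assume "(\<lambda>n. (norm (a n))\<^sup>2) summable_on UNIV"
  then show "(\<lambda>n. (norm (a (n - k)))\<^sup>2) summable_on UNIV"
    using has_sum_bij[of "\<lambda>n. n - k" "\<lambda>n. (norm (a n))\<^sup>2"]
    by (simp add: summable_on_def bij_diff_right)
qed

lift_definition rmul :: "ell2 \<Rightarrow> quat \<Rightarrow> ell2" is "\<lambda>a p n. a n * p"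
  by (simp add: norm_mult power_mult_distrib summable_on_cmult_left)

lift_definition lmul :: "quat \<Rightarrow> ell2 \<Rightarrow> ell2" is "\<lambda>p a n. p * a n"
  by (simp add: norm_mult power_mult_distrib summable_on_cmult_right)

lift_definition tilde :: "ell2 \<Rightarrow> ell2" is "\<lambda>a n. qcnj (a (- n))"
proof -
  fix a :: "int \<Rightarrow> quat"
  assume "(\<lambda>n. (norm (a n))\<^sup>2) summable_on UNIV"
  then show "(\<lambda>n. (norm (qcnj (a (- n))))\<^sup>2) summable_on UNIV"
    using has_sum_bij[of "uminus :: int \<Rightarrow> int" "\<lambda>n. (norm (a n))\<^sup>2"]
    by (simp add: summable_on_def bij_uminus)
qed

lift_definition single :: "int \<Rightarrow> quat \<Rightarrow> ell2" is "\<lambda>k p n. if n = k then p else 0"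
  by (rule finite_nonzero_values_imp_summable_on) (auto intro: finite_subset[of _ "{_}"])

lemma seq_operations [simp]:
  "seq (shift k a) n = seq a (n - k)" "seq (rmul a p) n = seq a n * p"
  "seq (lmul p a) n = p * seq a n" "seq (tilde a) n = qcnj (seq a (- n))"
  "seq (single k p) n = (if n = k then p else 0)"
  by (transfer; simp)+

lemma tilde_tilde [simp]: "tilde (tilde a) = a"
  by (rule seq_eqI) simp

lemma inner_shift [simp]: "inner (shift k a) (shift k b) = inner a b"
  using infsum_reindex_bij_betw[OF bij_diff_right[of k],
      of "\<lambda>n. inner (seq a n) (seq b n)"] by (simp add: inner_ell2_def)

lemma norm_shift [simp]: "norm (shift k a) = norm a"
  by (simp add: norm_eq_sqrt_inner)

lemma inner_tilde [simp]: "inner (tilde a) (tilde b) = inner a b"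
  using infsum_reindex_bij_betw[OF bij_uminus,
      of "\<lambda>n. inner (seq a n) (seq b n)"] by (simp add: inner_ell2_def)

lemma norm_tilde [simp]: "norm (tilde a) = norm a"
  by (simp add: norm_eq_sqrt_inner)

lemma norm_rmul [simp]: "norm (rmul a p) = norm a * norm p"
proof -
  have "((\<lambda>n. (norm (seq a n))\<^sup>2 * (norm p)\<^sup>2) has_sum (norm a)\<^sup>2 * (norm p)\<^sup>2) UNIV"
    by (intro has_sum_cmult_left norm_ell2_has_sum)
  then have "(norm (rmul a p))\<^sup>2 = (norm a * norm p)\<^sup>2"
    using has_sum_unique[OF norm_ell2_has_sum[of "rmul a p"]]
    by (simp add: norm_mult power_mult_distrib)
  then show ?thesis by (simp add: power2_eq_iff_nonneg)
qed

lemma norm_single [simp]: "norm (single k p) = norm p"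
proof -
  have "(norm (single k p))\<^sup>2 = (norm p)\<^sup>2"
    by (rule has_sum_unique[OF norm_ell2_has_sum],
        rule has_sum_finite_neutralI[of "{k}"]) auto
  then show ?thesis by (simp add: power2_eq_iff_nonneg)
qed

lemma bounded_linear_shift: "bounded_linear (shift k)"
  by (rule bounded_linear_intro[of _ 1]) (auto intro: seq_eqI)

lemma shift_shift [simp]: "shift k (shift m a) = shift (k + m) a"
  by (rule seq_eqI) (simp add: algebra_simps)

lemma shift_0 [simp]: "shift 0 a = a"
  by (rule seq_eqI) simp

lemma shift_rmul: "shift k (rmul a p) = rmul (shift k a) p"
  by (rule seq_eqI) simp

lemma rmul_rmul: "rmul (rmul a p) r = rmul a (p * r)"
  by (rule seq_eqI) (simp add: mult.assoc)

lemma inner_rmul: "inner (rmul a p) b = inner a (rmul b (qcnj p))"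
  by (simp add: inner_ell2_def inner_mult_right_quat)

text \<open>\<open>inner\<close> on \<open>ell2\<close> is real valued; letting \<open>p\<close>
  range over all quaternions makes the condition say that the quaternionic inner product of
  \<open>q^k a\<close> with \<open>a\<close> vanishes.\<close>

definition wandering :: "ell2 \<Rightarrow> bool"
  where "wandering a \<longleftrightarrow> norm a = 1 \<and> (\<forall>k p. k \<noteq> 0 \<longrightarrow> inner (shift k (rmul a p)) a = 0)"

text \<open>The series is summed in the norm of \<open>ell2\<close>, and its convergence is
  established for wandering \<open>a\<close>. Where it fails to converge, the infinite sum takes its
  default value 0.\<close>

definition conv :: "ell2 \<Rightarrow> ell2 \<Rightarrow> ell2"
  where "conv a f = (\<Sum>\<^sub>\<infinity>i. shift i (rmul a (seq f i)))"

text \<open>Shifting both arguments by \<open>- j\<close> and moving \<open>r\<close> across the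
  inner product brings any two terms to the defining case.\<close>

lemma wandering_orthogonal:
  assumes "wandering a" "i \<noteq> j"
  shows "orthogonal (shift i (rmul a p)) (shift j (rmul a r))"
proof -
  have "inner (shift i (rmul a p)) (shift j (rmul a r))
      = inner (shift (- j) (shift i (rmul a p))) (shift (- j) (shift j (rmul a r)))"
    by (simp only: inner_shift)
  also have "\<dots> = inner (shift (i - j) (rmul a (p * qcnj r))) a"
    using inner_rmul[of "shift (i - j) (rmul a p)" "qcnj r" a]
    by (simp add: shift_rmul rmul_rmul)
  also have "\<dots> = 0"
    using assms unfolding wandering_def by simp
  finally show ?thesis by (simp add: orthogonal_def)
qed

context
  fixes a assumes a: "wandering a"
begin

lemma norm_wandering [simp]: "norm a = 1"
  using a by (simp add: wandering_def)

lemma conv_has_sum: "((\<lambda>i. shift i (rmul a (seq f i))) has_sum conv a f) UNIV"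
  and norm_conv: "norm (conv a f) = norm f"
proof -
  have "\<exists>s. ((\<lambda>i. shift i (rmul a (seq f i))) has_sum s) UNIV \<and> (norm s)\<^sup>2 = (norm f)\<^sup>2"
    using norm_ell2_has_sum[of f]
    by (intro orthogonal_series wandering_orthogonal a) simp_all
  then obtain s where s: "((\<lambda>i. shift i (rmul a (seq f i))) has_sum s) UNIV"
    "(norm s)\<^sup>2 = (norm f)\<^sup>2" by blast
  then have "conv a f = s" by (simp add: conv_def infsumI)
  with s show "((\<lambda>i. shift i (rmul a (seq f i))) has_sum conv a f) UNIV"
    "norm (conv a f) = norm f"
    by (simp_all add: power2_eq_iff_nonneg)
qed

lemma seq_conv_has_sum: "((\<lambda>i. seq a (n - i) * seq f i) has_sum seq (conv a f) n) UNIV"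
  using has_sum_bounded_linear[OF bounded_linear_seq[of n] conv_has_sum[of f]] by simp

lemma seq_conv_has_sum': "((\<lambda>k. seq a k * seq f (n - k)) has_sum seq (conv a f) n) UNIV"
proof -
  have "bij (\<lambda>k. n - k)" by (rule bij_betwI[of _ _ _ "\<lambda>k. n - k"]) auto
  then show ?thesis
    using seq_conv_has_sum[of n f] has_sum_bij[of "\<lambda>k. n - k" "\<lambda>i. seq a (n - i) * seq f i"] by simp
qed

lemma conv_eqI:
  assumes "\<And>n. ((\<lambda>i. seq a (n - i) * seq f i) has_sum seq g n) UNIV"
  shows "conv a f = g"
  by (rule seq_eqI, rule has_sum_unique[OF seq_conv_has_sum assms])

lemma bounded_linear_conv: "bounded_linear (conv a)"
proof (rule bounded_linear_intro[of _ 1])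
  show "conv a (f + g) = conv a f + conv a g" for f g
    using has_sum_add[OF seq_conv_has_sum[of _ f] seq_conv_has_sum[of _ g]]
    by (intro conv_eqI) (simp add: distrib_left)
  show "conv a (r *\<^sub>R f) = r *\<^sub>R conv a f" for r f
    using has_sum_bounded_linear[OF bounded_linear_scaleR_right[of r] seq_conv_has_sum[of _ f]]
    by (intro conv_eqI) simp
qed (simp add: norm_conv)

lemma conv_shift: "conv a (shift k f) = shift k (conv a f)"
proof (rule conv_eqI)
  fix n
  have "((\<lambda>i. seq a (n - k - (i - k)) * seq f (i - k)) has_sum seq (conv a f) (n - k)) UNIV"
    using seq_conv_has_sum by (subst has_sum_bij[OF bij_diff_right])
  then show "((\<lambda>i. seq a (n - i) * seq (shift k f) i) has_sum seq (shift k (conv a f)) n) UNIV"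
    by simp
qed

lemma conv_rmul: "conv a (rmul f p) = rmul (conv a f) p"
  using has_sum_cmult_left[OF seq_conv_has_sum[of _ f], where c = p] by (intro conv_eqI) (simp add: mult.assoc)

lemma conv_single: "conv a (single k p) = shift k (rmul a p)"
  by (rule conv_eqI, rule has_sum_finite_neutralI[of "{k}"]) auto

end

lemma wandering_single: "norm p = 1 \<Longrightarrow> wandering (single 0 p)"
  by (simp add: wandering_def inner_ell2_def infsum_0)

text \<open>The constant 1 is wandering and acts as the identity, so its orthogonal series is the
  expansion into coordinate vectors.\<close>

lemma single_has_sum: "((\<lambda>i. single i (seq f i)) has_sum f) UNIV"
proof -
  have w: "wandering (single 0 1)" by (simp add: wandering_single)
  have "conv (single 0 1) f = f"
    by (rule conv_eqI[OF w], rule has_sum_finite_neutralI[of "{_}"]) auto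
  moreover have "shift i (rmul (single 0 1) p) = single i p" for i p
    by (rule seq_eqI) auto
  ultimately show ?thesis using conv_has_sum[OF w, of f] by simp
qed

lemma bounded_linear_eq_id:
  assumes T: "bounded_linear T" and "\<And>i p. T (single i p) = single i p"
  shows "T f = f"
  using has_sum_unique[OF has_sum_bounded_linear[OF T single_has_sum]] single_has_sum assms(2)
  by simp

lemma conv_tilde:
  assumes a: "wandering a"
  shows "conv a (tilde a) = single 0 1"
proof -
  let ?c = "conv a (tilde a)"
  have norm_c: "norm ?c = 1" by (simp add: norm_conv[OF a] norm_wandering[OF a])
  have "((\<lambda>n. of_real ((norm (seq a n))\<^sup>2)) has_sum (of_real 1 :: quat)) UNIV"
    using norm_ell2_has_sum[of a] norm_wandering[OF a] has_sum_of_real by fastforce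
  then have c0: "seq ?c 0 = 1"
    using has_sum_unique[OF seq_conv_has_sum'[OF a, of "tilde a" 0]]
    by (simp add: mult_qcnj_self)
  have "seq ?c n = 0" if "n \<noteq> 0" for n
    using norm_ell2_sum_le[of "{0, n}" ?c] that by (simp add: norm_c c0)
  with c0 show ?thesis by (intro seq_eqI) auto
qed

text \<open>\<open>tilde\<close> reverses the order of products and the direction of shifts, so
  right multiples of \<open>tilde a\<close> turn into left multiples of \<open>a\<close>.\<close>

lemma wandering_tilde_iff:
  "wandering (tilde a) \<longleftrightarrow> norm a = 1 \<and> (\<forall>k p. k \<noteq> 0 \<longrightarrow> inner (lmul p (shift k a)) a = 0)"
proof -
  have "inner (shift k (rmul (tilde a) p)) (tilde a) = inner (lmul (qcnj p) (shift (- k) a)) a"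
    for k p
  proof -
    have "shift k (rmul (tilde a) p) = tilde (lmul (qcnj p) (shift (- k) a))"
      by (rule seq_eqI) (simp add: qcnj_mult)
    then show ?thesis by simp
  qed
  then have "inner (lmul p (shift k a)) a = inner (shift (- k) (rmul (tilde a) (qcnj p))) (tilde a)"
    "inner (shift k (rmul (tilde a) p)) (tilde a) = inner (lmul (qcnj p) (shift (- k) a)) a" for k p
    by simp_all
  then have "(\<forall>k p. k \<noteq> 0 \<longrightarrow> inner (shift k (rmul (tilde a) p)) (tilde a) = 0)
      \<longleftrightarrow> (\<forall>k p. k \<noteq> 0 \<longrightarrow> inner (lmul p (shift k a)) a = 0)"
    by (metis neg_0_equal_iff_equal)
  then show ?thesis by (simp add: wandering_def)
qed

text \<open>The coefficient of \<open>conv a (tilde a)\<close> at \<open>k\<close> is the sum of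
  \<open>a n * qcnj (a (n - k))\<close>, and pairing it with \<open>p\<close> gives the inner
  product of \<open>wandering_tilde_iff\<close>. Its vanishing for \<open>k \<noteq> 0\<close> is
  thus orthogonality to left multiples, deduced from orthogonality to right multiples.\<close>

lemma wandering_tilde:
  assumes a: "wandering a"
  shows "wandering (tilde a)"
  unfolding wandering_tilde_iff
proof (intro conjI allI impI)
  fix k :: int and p assume "k \<noteq> 0"
  have "((\<lambda>n. seq a n * seq (tilde a) (k - n)) has_sum 0) UNIV"
    using seq_conv_has_sum'[OF a, of "tilde a" k] \<open>k \<noteq> 0\<close> by (simp add: conv_tilde[OF a])
  then have "((\<lambda>n. seq a n * qcnj (seq a (n - k))) has_sum 0) UNIV" by simp
  from has_sum_bounded_linear[OF bounded_linear_inner_right[of p] this]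
  have "((\<lambda>n. inner p (seq a n * qcnj (seq a (n - k)))) has_sum 0) UNIV" by simp
  moreover have "inner p (seq a n * qcnj (seq a (n - k)))
      = inner (seq (lmul p (shift k a)) n) (seq a n)" for n
    by (simp add: inner_mult_right_quat)
  ultimately show "inner (lmul p (shift k a)) a = 0"
    by (simp add: inner_ell2_def infsumI)
qed (use a in \<open>simp add: wandering_def\<close>)

text \<open>\<open>conv\<close> commutes with shifts and right multiplications, so only coordinate
  vectors need to be treated, and there the identity is \<open>conv_tilde\<close>.\<close>

lemma conv_conv_tilde:
  assumes a: "wandering a"
  shows "conv a (conv (tilde a) f) = f"
proof (rule bounded_linear_eq_id)
  note ta = wandering_tilde[OF a]
  show "bounded_linear (\<lambda>f. conv a (conv (tilde a) f))"
    by (rule bounded_linear_compose[OF bounded_linear_conv[OF a] bounded_linear_conv[OF ta]])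
  show "conv a (conv (tilde a) (single i p)) = single i p" for i p
    by (rule seq_eqI)
      (simp add: conv_single[OF ta] conv_shift[OF a] conv_rmul[OF a] conv_tilde[OF a])
qed

lemma conv_tilde_conv:
  assumes a: "wandering a"
  shows "conv (tilde a) (conv a f) = f"
  using conv_conv_tilde[OF wandering_tilde[OF a]] by simp

section \<open>Closed invariant subspaces of sequences\<close>

text \<open>Nearest point argument: the parallelogram law makes a minimizing sequence Cauchy, and
  minimality along lines through the limit forces orthogonality.\<close>

lemma orthogonal_projection_exists:
  fixes V :: "'a::{real_inner, complete_space} set"
  assumes V: "subspace V" "closed V"
  shows "\<exists>y\<in>V. \<forall>v\<in>V. inner (x - y) v = 0"
proof -
  define D where "D = (\<lambda>v. (norm (x - v))\<^sup>2) ` V"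
  define d where "d = Inf D"
  have D: "D \<noteq> {}" "bdd_below D"
    using subspace_0[OF V(1)] by (auto simp: D_def intro!: bdd_belowI[of _ 0])
  have d_le: "d \<le> (norm (x - v))\<^sup>2" if "v \<in> V" for v
    unfolding d_def using that D by (intro cInf_lower) (auto simp: D_def)
  have "\<exists>v\<in>V. (norm (x - v))\<^sup>2 < d + inverse (real (Suc k))" for k
    using cInf_lessD[OF D(1), of "d + inverse (real (Suc k))"] by (auto simp: d_def D_def)
  then obtain y where y: "\<And>k. y k \<in> V"
    "\<And>k. (norm (x - y k))\<^sup>2 < d + inverse (real (Suc k))" by metis
  have gap: "(norm (y m - y n))\<^sup>2 \<le> 2 * inverse (real (Suc m)) + 2 * inverse (real (Suc n))" for m n
  proof -
    have "(1 / 2) *\<^sub>R (y m + y n) \<in> V"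
      using V(1) y by (intro subspace_scale subspace_add)
    then have "4 * d \<le> 4 * (norm (x - (1 / 2) *\<^sub>R (y m + y n)))\<^sup>2" using d_le by simp
    also have "\<dots> = 2 * (norm (x - y m))\<^sup>2 + 2 * (norm (x - y n))\<^sup>2 - (norm (y m - y n))\<^sup>2"
      by (simp add: power2_norm_eq_inner inner_diff inner_add inner_commute algebra_simps)
    finally show ?thesis using y(2)[of m] y(2)[of n] by linarith
  qed
  have "Cauchy y"
  proof (rule CauchyI)
    fix e :: real assume "0 < e"
    then obtain N where N: "N > 0" "inverse (real N) < e\<^sup>2 / 4"
      using ex_inverse_of_nat_less[of "e\<^sup>2 / 4"] by auto
    have small: "inverse (real (Suc k)) < e\<^sup>2 / 4" if "k \<ge> N" for k
      by (rule le_less_trans[OF _ N(2)]) (use that N(1) in \<open>auto intro!: le_imp_inverse_le\<close>)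
    have "norm (y m - y n) < e" if "m \<ge> N" "n \<ge> N" for m n
    proof -
      have "(norm (y m - y n))\<^sup>2 < e\<^sup>2"
        using gap[of m n] small[OF that(1)] small[OF that(2)] by linarith
      then show ?thesis using \<open>0 < e\<close> by (simp add: power2_less_imp_less)
    qed
    then show "\<exists>N. \<forall>m\<ge>N. \<forall>n\<ge>N. norm (y m - y n) < e" by blast
  qed
  then obtain l where l: "y \<longlonglongrightarrow> l"
    using Cauchy_convergent convergent_def by blast
  have lV: "l \<in> V" using closed_sequentially[OF V(2)] y(1) l by blast
  have "(norm (x - l))\<^sup>2 \<le> d + 0"
  proof (rule LIMSEQ_le)
    show "(\<lambda>k. (norm (x - y k))\<^sup>2) \<longlonglongrightarrow> (norm (x - l))\<^sup>2"
      by (intro tendsto_intros l)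
    show "(\<lambda>k. d + inverse (real (Suc k))) \<longlonglongrightarrow> d + 0"
      by (intro tendsto_intros LIMSEQ_inverse_real_of_nat)
    show "\<exists>N. \<forall>k\<ge>N. (norm (x - y k))\<^sup>2 \<le> d + inverse (real (Suc k))"
      using y(2) less_imp_le by blast
  qed
  then have min: "(norm (x - l))\<^sup>2 \<le> (norm (x - v))\<^sup>2" if "v \<in> V" for v
    using order_trans[OF _ d_le[OF that]] by simp
  have "inner (x - l) v = 0" if "v \<in> V" for v
  proof (cases "v = 0")
    case False
    \<comment> \<open>The minimizer in \<open>t\<close> of the squared distance from
      \<open>x\<close> to \<open>l + t *\<^sub>R v\<close>.\<close>
    define t where "t = inner (x - l) v / inner v v"
    have "l + t *\<^sub>R v \<in> V" using V(1) lV that by (intro subspace_add subspace_scale)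
    from min[OF this] have "0 \<le> t * t * inner v v - 2 * t * inner (x - l) v"
      by (simp add: power2_norm_eq_inner inner_diff inner_add inner_commute algebra_simps)
    also have "\<dots> = - ((inner (x - l) v)\<^sup>2 / inner v v)"
      using False by (simp add: t_def field_simps power2_eq_square)
    finally have "(inner (x - l) v)\<^sup>2 / inner v v \<le> 0" by simp
    moreover have "0 < inner v v" using False by simp
    ultimately show ?thesis by (simp add: divide_le_0_iff)
  qed simp
  with lV show ?thesis by blast
qed

definition ell2_plus :: "ell2 set"
  where "ell2_plus = {a. \<forall>n<0. seq a n = 0}"

text \<open>The adjoint relation tested on \<open>single n p\<close>, whose image under
  \<open>conv a\<close> is \<open>shift n (rmul a p)\<close>.\<close>

lemma inner_seq_conv_tilde:
  assumes a: "wandering a"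
  shows "inner p (seq (conv (tilde a) g) n) = inner (shift n (rmul a p)) g"
proof -
  have "((\<lambda>i. inner p (seq (tilde a) (n - i) * seq g i)) has_sum inner p (seq (conv (tilde a) g) n)) UNIV"
    by (intro has_sum_bounded_linear[OF bounded_linear_inner_right]
        seq_conv_has_sum wandering_tilde a)
  moreover have "inner p (seq (tilde a) (n - i) * seq g i)
      = inner (seq (shift n (rmul a p)) i) (seq g i)" for i
    using inner_mult_left_quat[of "seq a (i - n)" p "seq g i"] by simp
  ultimately show ?thesis by (simp add: inner_ell2_def infsumI)
qed

lemma inner_shift_left: "inner (shift k a) b = inner a (shift (- k) b)"
  using inner_shift[of "- k" "shift k a" b] by simp

theorem invariant_subspace_generator:
  assumes M: "subspace M" "closed M" "M \<subseteq> ell2_plus" "M \<noteq> {0}"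
    and rm: "\<And>f p. f \<in> M \<Longrightarrow> rmul f p \<in> M"
    and sh: "\<And>f. f \<in> M \<Longrightarrow> shift 1 f \<in> M"
  shows "\<exists>a\<in>M. wandering a \<and> M = conv a ` ell2_plus"
proof -
  define V where "V = shift 1 ` M"
  have shn: "shift (int n) f \<in> M" if "f \<in> M" for f n
    using that by (induction n) (auto dest: sh simp: add.commute)
  \<comment> \<open>\<open>shift 1\<close> is invertible on two-sided sequences, so the image
    \<open>V\<close> is also a preimage and inherits closedness.\<close>
  have "V = shift (- 1) -` M"
    by (force simp: V_def image_iff)
  then have "closed V"
    using M(2) bounded_linear_shift by (simp add: closed_vimage linear_continuous_on)
  moreover have V: "subspace V"
    unfolding V_def by (intro linear_subspace_image M bounded_linear.linear bounded_linear_shift)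
  ultimately have proj: "\<exists>y\<in>V. \<forall>v\<in>V. inner (x - y) v = 0" for x
    by (rule orthogonal_projection_exists[rotated])
  obtain f0 n0 where f0: "f0 \<in> M" "seq f0 n0 \<noteq> 0"
    using M(4) subspace_0[OF M(1)] seq_eqI[of _ 0] by (metis insertI1 seq_simps(1) singletonI subsetI subset_singletonD empty_iff)
  then have "n0 \<ge> 0" using M(3) by (force simp: ell2_plus_def)
  with f0 have ex: "\<exists>n. \<exists>f\<in>M. seq f (int n) \<noteq> 0" by (metis nonneg_int_cases)
  \<comment> \<open>All elements of \<open>V\<close> vanish at the first index where some element of
    \<open>M\<close> does not. An \<open>f\<close> with nonzero coefficient there lies outside
    \<open>V\<close>, so its component orthogonal to \<open>V\<close> is nonzero.\<close>
  define m where "m = (LEAST n. \<exists>f\<in>M. seq f (int n) \<noteq> 0)"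
  obtain f where f: "f \<in> M" "seq f (int m) \<noteq> 0"
    using LeastI_ex[OF ex] unfolding m_def by blast
  \<comment> \<open>The coefficient of \<open>shift 1 g\<close> at \<open>m\<close> is that of
    \<open>g\<close> at \<open>m - 1\<close>; for \<open>m = 0\<close> this index is negative and
    lies outside the support.\<close>
  have m_min: "seq g (int m - 1) = 0" if "g \<in> M" for g
  proof (cases m)
    case 0
    then show ?thesis using that M(3) by (force simp: ell2_plus_def)
  next
    case (Suc k)
    then show ?thesis
      using that not_less_Least[of k "\<lambda>n. \<exists>f\<in>M. seq f (int n) \<noteq> 0"] by (auto simp: m_def)
  qed
  obtain y where y: "y \<in> V" "\<And>v. v \<in> V \<Longrightarrow> inner (f - y) v = 0" using proj by blast
  define a where "a = inverse (norm (f - y)) *\<^sub>R (f - y)"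
  have "seq (f - y) (int m) \<noteq> 0" using y(1) m_min f by (auto simp: V_def)
  then have "f - y \<noteq> 0" by force
  then have na: "norm a = 1" by (simp add: a_def)
  have aM: "a \<in> M"
    unfolding a_def using f y M sh by (intro subspace_scale subspace_diff) (auto simp: V_def)
  \<comment> \<open>\<open>V\<close> is stable under right multiplication, which turns real
    orthogonality of \<open>a\<close> to \<open>V\<close> into quaternionic orthogonality.\<close>
  have orth: "inner (rmul a p) v = 0" if "v \<in> V" for v p
  proof -
    have "rmul v (qcnj p) \<in> V"
      using that rm by (auto simp: V_def shift_rmul[symmetric])
    then show ?thesis by (simp add: inner_rmul a_def y(2))
  qed
  have shV: "shift k g \<in> V" if "g \<in> M" "k > 0" for k g
    using shn[OF that(1), of "nat (k - 1)"] that(2)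
    by (auto simp: V_def intro!: image_eqI[of _ _ "shift (k - 1) g"])
  have w: "wandering a"
    unfolding wandering_def
  proof (intro conjI na allI impI)
    fix k :: int and p assume "k \<noteq> 0"
    \<comment> \<open>For positive \<open>k\<close> the shifted vector lies in \<open>V\<close>; for
      negative \<open>k\<close> the opposite shift of the other argument does.\<close>
    then consider "k > 0" | "k < 0" by linarith
    then show "inner (shift k (rmul a p)) a = 0"
    proof cases
      case 1
      then show ?thesis
        using orth[OF shV[OF rm[OF aM, of p] 1], of 1]
        by (simp add: inner_commute inner_rmul seq_eqI[of "rmul a 1" a])
    next
      case 2
      then show ?thesis using orth[OF shV[OF aM, of "- k"]] by (simp add: inner_shift_left)
    qed
  qed
  have "conv a g \<in> M" if g: "g \<in> ell2_plus" for g
  proof (rule Lim_in_closed_set[OF M(2)])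
    have "shift i (rmul a (seq g i)) \<in> M" for i
    proof (cases "i < 0")
      case True
      then have "shift i (rmul a (seq g i)) = 0"
        using g by (intro seq_eqI) (simp add: ell2_plus_def)
      then show ?thesis using subspace_0[OF M(1)] by simp
    next
      case False
      then show ?thesis using shn[OF rm[OF aM], of "nat i"] by simp
    qed
    then show "\<forall>\<^sub>F F in finite_subsets_at_top UNIV. (\<Sum>i\<in>F. shift i (rmul a (seq g i))) \<in> M"
      by (intro always_eventually allI subspace_sum[OF M(1)])
    show "((\<lambda>F. \<Sum>i\<in>F. shift i (rmul a (seq g i))) \<longlongrightarrow> conv a g) (finite_subsets_at_top UNIV)"
      using conv_has_sum[OF w] by (simp add: has_sum_def)
  qed simp
  moreover have "g \<in> conv a ` ell2_plus" if g: "g \<in> M" for g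
  proof (rule image_eqI)
    show "g = conv a (conv (tilde a) g)" by (simp add: conv_conv_tilde[OF w])
    \<comment> \<open>By the adjoint relation, pairing this coefficient with \<open>p\<close> pairs
      \<open>rmul a p\<close> with \<open>shift (- n) g\<close>, which lies in \<open>V\<close>
      because \<open>- n > 0\<close>.\<close>
    have "seq (conv (tilde a) g) n = 0" if "n < 0" for n
    proof -
      have "inner p (seq (conv (tilde a) g) n) = 0" for p
        using orth[OF shV[OF g, of "- n"], of p] that
        by (simp add: inner_seq_conv_tilde[OF w] inner_shift_left)
      then show ?thesis by (metis inner_eq_zero_iff)
    qed
    then show "conv (tilde a) g \<in> ell2_plus" by (simp add: ell2_plus_def)
  qed
  ultimately show ?thesis using w aM by blast
qed

lemma closed_ell2_plus: "closed ell2_plus"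
proof -
  have "ell2_plus = (\<Inter>n\<in>{..<0}. (\<lambda>a. seq a n) -` {0})" by (auto simp: ell2_plus_def)
  moreover have "closed \<dots>"
    by (intro closed_INT ballI closed_vimage closed_singleton linear_continuous_on bounded_linear_seq)
  ultimately show ?thesis by simp
qed

text \<open>\<open>conv (tilde a)\<close> is the inverse of \<open>conv a\<close>. The preimage form
  gives closedness at once and makes membership in the range a condition on
  \<open>conv (tilde a) g\<close>.\<close>

lemma conv_image_eq_vimage:
  assumes "wandering a"
  shows "conv a ` X = conv (tilde a) -` X"
proof (intro equalityI subsetI)
  fix g assume "g \<in> conv (tilde a) -` X"
  then show "g \<in> conv a ` X"
    using conv_conv_tilde[OF assms, of g] by (metis image_eqI vimageD)
qed (auto simp: conv_tilde_conv[OF assms])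

lemma closed_conv_ell2_plus:
  assumes a: "wandering a"
  shows "closed (conv a ` ell2_plus)"
  unfolding conv_image_eq_vimage[OF a]
  by (intro closed_vimage closed_ell2_plus linear_continuous_on bounded_linear_conv wandering_tilde a)

text \<open>\<open>conv (tilde a) b\<close> and \<open>conv (tilde b) a\<close> are
  \<open>tilde\<close> of each other, and equality of the ranges puts both in
  \<open>ell2_plus\<close>. Nonnegative support of both leaves only the coefficient at 0.\<close>

lemma generator_unique:
  assumes a: "wandering a" and b: "wandering b"
    and eq: "conv a ` ell2_plus = conv b ` ell2_plus"
  shows "\<exists>u. norm u = 1 \<and> b = rmul a u"
proof -
  have mem: "c \<in> conv c ` ell2_plus" if "wandering c" for c
  proof (rule image_eqI)
    show "c = conv c (single 0 1)" by (rule seq_eqI) (simp add: conv_single[OF that])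
  qed (simp add: ell2_plus_def)
  define v where "v = conv (tilde a) b"
  have v: "v \<in> ell2_plus" and u: "conv (tilde b) a \<in> ell2_plus"
    using mem[OF b] mem[OF a] eq conv_image_eq_vimage[OF a] conv_image_eq_vimage[OF b]
    by (auto simp: v_def)
  have v_pos: "seq v n = 0" if "n > 0" for n
  proof -
    have z: "seq (conv (tilde b) a) (- n) = 0" using u that by (simp add: ell2_plus_def)
    have "inner p (seq v n) = inner (qcnj p) (seq (conv (tilde b) a) (- n))" for p
      by (simp add: v_def inner_seq_conv_tilde[OF a] inner_seq_conv_tilde[OF b] shift_rmul
          inner_commute[of _ a] inner_rmul inner_shift_left)
    then show ?thesis by (metis z inner_eq_zero_iff inner_zero_right)
  qed
  have v0: "v = single 0 (seq v 0)"
  proof (rule seq_eqI)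
    show "seq v n = seq (single 0 (seq v 0)) n" for n
      using v v_pos by (cases n "0::int" rule: linorder_cases) (auto simp: ell2_plus_def)
  qed
  have b_eq: "b = conv a v" by (simp add: v_def conv_conv_tilde[OF a])
  have "norm (seq v 0) = norm v" using arg_cong[OF v0, of norm] by (simp only: norm_single)
  also have "\<dots> = 1" using norm_conv[OF a, of v] norm_wandering[OF b] b_eq by simp
  finally have "norm (seq v 0) = 1" .
  moreover have "b = conv a (single 0 (seq v 0))"
    by (subst v0[symmetric]) (rule b_eq)
  then have "b = rmul a (seq v 0)" by (simp add: conv_single[OF a])
  ultimately show ?thesis by blast
qed

lemma has_sum_int_nat:
  fixes f :: "int \<Rightarrow> 'a::{comm_monoid_add, topological_space}"
  assumes "\<And>n. n < 0 \<Longrightarrow> f n = 0"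
  shows "(f has_sum s) UNIV \<longleftrightarrow> ((\<lambda>n::nat. f (int n)) has_sum s) UNIV"
proof -
  have "(f has_sum s) UNIV \<longleftrightarrow> (f has_sum s) (range int)"
    by (rule has_sum_cong_neutral) (use assms in \<open>auto simp: image_iff, metis nonneg_int_cases not_le\<close>)
  also have "\<dots> \<longleftrightarrow> ((f \<circ> int) has_sum s) UNIV"
    by (rule has_sum_reindex) simp
  finally show ?thesis by (simp add: o_def)
qed

lemma summable_geometric_square: "norm (q::quat) < 1 \<Longrightarrow> summable (\<lambda>n. (norm (q ^ n))\<^sup>2)"
  using summable_geometric[of "(norm q)\<^sup>2"]
  by (simp add: norm_power power_less_one_iff mult.commute flip: power_mult)

text \<open>The adjoint of \<open>conv a\<close> compressed to \<open>ell2_plus\<close> multiplies the kernel sequence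
  \<open>\<lambda>n. qcnj q ^ n\<close> by the conjugate of \<open>F q\<close>.\<close>

lemma wandering_power_series_bound:
  assumes a: "wandering a" "a \<in> ell2_plus" and q: "norm q < 1"
    and F: "(\<lambda>n. q ^ n * seq a (int n)) sums F"
  shows "norm F \<le> 1"
proof -
  note ta = wandering_tilde[OF a(1)]
  let ?g = "\<lambda>n. if n < 0 then 0 else qcnj q ^ nat n"
  have qs: "(\<lambda>n. (norm (q ^ n))\<^sup>2) summable_on UNIV"
    using summable_geometric_square[OF q] by (intro summable_nonneg_imp_summable_on) auto
  then have "(\<lambda>n. (norm (?g n))\<^sup>2) summable_on UNIV"
    unfolding summable_on_def by (subst has_sum_int_nat) (auto simp: norm_power)
  then have g: "seq (Ell2 ?g) = ?g" by (simp add: Ell2_inverse)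
  have as: "(\<lambda>n. (norm (seq a (int n)))\<^sup>2) summable_on UNIV"
    using square_summable_seq[of a] a(2) unfolding summable_on_def
    by (subst (asm) has_sum_int_nat) (auto simp: ell2_plus_def)
  have "(\<lambda>n. norm (q ^ n * seq a (int n))) summable_on UNIV"
    using square_summable_product[OF qs as] by (simp add: norm_mult)
  from abs_summable_summable[OF this] have "(\<lambda>n. q ^ n * seq a (int n)) summable_on UNIV" .
  then obtain s where s: "((\<lambda>n. q ^ n * seq a (int n)) has_sum s) UNIV"
    unfolding summable_on_def by blast
  then have "s = F" using sums_unique2[OF has_sum_imp_sums[OF s] F] by blast
  have conv: "seq (conv (tilde a) (Ell2 ?g)) n = qcnj F * ?g n" if "n \<ge> 0" for n
  proof (rule has_sum_unique[OF seq_conv_has_sum[OF ta]])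
    have "((\<lambda>j. qcnj (q ^ j * seq a (int j))) has_sum qcnj F) UNIV"
      using s \<open>s = F\<close> has_sum_bounded_linear[OF bounded_linear_qcnj s] by simp
    then have "((\<lambda>j. qcnj (q ^ j * seq a (int j)) * qcnj q ^ nat n) has_sum qcnj F * qcnj q ^ nat n) UNIV"
      by (rule has_sum_cmult_left)
    also have "(\<lambda>j. qcnj (q ^ j * seq a (int j)) * qcnj q ^ nat n)
        = (\<lambda>j. qcnj (seq a (int j)) * ?g (int j + n))"
      using that by (simp add: fun_eq_iff qcnj_mult qcnj_power mult.assoc nat_add_distrib power_add)
    finally have "((\<lambda>j. qcnj (seq a j) * ?g (j + n)) has_sum qcnj F * ?g n) UNIV"
      using that a(2) by (subst has_sum_int_nat) (auto simp: ell2_plus_def)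
    then have "((\<lambda>j. qcnj (seq a (j - n)) * ?g (j - n + n)) has_sum qcnj F * ?g n) UNIV"
      by (subst has_sum_bij[OF bij_diff_right])
    then show "((\<lambda>i. seq (tilde a) (n - i) * seq (Ell2 ?g) i) has_sum qcnj F * ?g n) UNIV"
      using that by (simp only: g seq_operations minus_diff_eq diff_add_cancel)
  qed
  \<comment> \<open>Only the coefficients at nonnegative indices were computed; at negative ones the
    kernel vanishes, so whatever the image has there only enlarges the right side.\<close>
  have "(norm F)\<^sup>2 * (norm (Ell2 ?g))\<^sup>2 \<le> (norm (conv (tilde a) (Ell2 ?g)))\<^sup>2"
  proof (rule has_sum_mono[OF has_sum_cmult_right[OF norm_ell2_has_sum] norm_ell2_has_sum])
    show "(norm F)\<^sup>2 * (norm (seq (Ell2 ?g) n))\<^sup>2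
        \<le> (norm (seq (conv (tilde a) (Ell2 ?g)) n))\<^sup>2" for n
      by (cases "n < 0") (simp_all add: g conv norm_mult power_mult_distrib)
  qed
  then have "(norm F)\<^sup>2 * (norm (Ell2 ?g))\<^sup>2 \<le> 1 * (norm (Ell2 ?g))\<^sup>2"
    by (simp add: norm_conv[OF ta])
  \<comment> \<open>The kernel has coefficient 1 at index 0.\<close>
  moreover have "0 < (norm (Ell2 ?g))\<^sup>2"
    using norm_seq_le[of "Ell2 ?g" 0] by (simp add: g) (metis norm_zero not_one_le_zero)
  ultimately have "(norm F)\<^sup>2 \<le> 1" by (simp only: mult_le_cancel_right_pos)
  then show ?thesis by (simp add: power2_le_iff_abs_le abs_square_le_1)
qed

section \<open>The boundary of the ball and its slices\<close>

lemma imag_units_iff: "q \<in> imag_units \<longleftrightarrow> qRe q = 0 \<and> norm q = 1"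
proof
  assume "q \<in> imag_units"
  then have q: "q * q = - 1" by (simp add: imag_units_def power2_eq_square)
  then have "norm q * norm q = 1" by (metis norm_minus_cancel norm_mult norm_one)
  then have n: "norm q = 1" by (metis norm_ge_zero abs_of_nonneg real_sqrt_abs2 real_sqrt_one)
  have "qRe q * qI q = 0" "qRe q * qJ q = 0" "qRe q * qK q = 0"
    "qRe q * qRe q - qI q * qI q - qJ q * qJ q - qK q * qK q = - 1"
    using q by (auto simp: quat_eq_iff)
  moreover from this(4) have "\<not> (qI q = 0 \<and> qJ q = 0 \<and> qK q = 0)"
    using zero_le_square[of "qRe q"] by (auto simp del: zero_le_square)
  ultimately show "qRe q = 0 \<and> norm q = 1" using n by auto
next
  assume "qRe q = 0 \<and> norm q = 1"
  then show "q \<in> imag_units"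
    by (simp add: imag_units_def power2_eq_square quat_eq_iff norm_quat_def inner_quat_def)
      (elim conjE, simp)
qed

lemma imag_unit_square: "I \<in> imag_units \<Longrightarrow> I * I = - 1"
  by (simp add: imag_units_def power2_eq_square)

lemma imag_unit_norm: "I \<in> imag_units \<Longrightarrow> norm I = 1"
  by (simp add: imag_units_iff)

lemma imag_unit_uminus: "I \<in> imag_units \<Longrightarrow> - I \<in> imag_units"
  by (simp add: imag_units_def)

lemma imag_unit_exists: "Quat 0 1 0 0 \<in> imag_units"
  by (simp add: imag_units_iff norm_quat_def inner_quat_def)

lemma closed_imag_units: "closed imag_units"
  unfolding imag_units_def by (intro closed_Collect_eq continuous_intros)

lemma quat_of_real_sel [simp]:
  "qRe (of_real r) = r" "qI (of_real r) = 0" "qJ (of_real r) = 0" "qK (of_real r) = 0"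
  by (simp_all add: of_real_def)

lemma norm_slice_pt: "I \<in> imag_units \<Longrightarrow> (norm (slice_pt x y I))\<^sup>2 = x\<^sup>2 + y\<^sup>2"
proof -
  assume "I \<in> imag_units"
  then have I: "qRe I = 0" "qI I * qI I + qJ I * qJ I + qK I * qK I = 1"
    by (auto simp: imag_units_iff norm_quat_def inner_quat_def)
  have "(norm (slice_pt x y I))\<^sup>2 = x * x + y * y * (qI I * qI I + qJ I * qJ I + qK I * qK I)"
    by (simp add: power2_norm_eq_inner inner_quat_def I(1) algebra_simps)
  then show ?thesis by (simp add: I(2) power2_eq_square)
qed

lemma qexp_uminus: "qexp (- t) I = qexp t (- I)"
  by (simp add: qexp_def)

lemma qexp_0 [simp]: "qexp 0 I = 1"
  by (simp add: qexp_def)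

lemma qexp_add:
  assumes "I \<in> imag_units"
  shows "qexp (s + t) I = qexp s I * qexp t I"
proof -
  have "of_real y * I * (of_real w * I) = - of_real (y * w)" for y w :: real
    by (simp add: of_real_def imag_unit_square[OF assms])
  moreover have "I * of_real w = of_real w * I" for w
    by (simp add: of_real_def)
  ultimately show ?thesis
    by (simp add: qexp_def cos_add sin_add algebra_simps) (simp add: of_real_def)
qed

lemma norm_qexp [simp]: "I \<in> imag_units \<Longrightarrow> norm (qexp t I) = 1"
  using norm_slice_pt[of I "cos t" "sin t"] power2_eq_iff_nonneg[of "norm (qexp t I)" 1]
  by (simp add: qexp_def)

lemma qexp_power: "I \<in> imag_units \<Longrightarrow> qexp t I ^ n = qexp (real n * t) I"
  by (induction n) (simp_all add: qexp_add distrib_right)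

lemma inverse_qexp: "I \<in> imag_units \<Longrightarrow> inverse (qexp t I) = qexp (- t) I"
  using qexp_add[of I t "- t"] by (intro inverse_unique) simp

lemma qexp_powi: "I \<in> imag_units \<Longrightarrow> qexp t I powi n = qexp (of_int n * t) I"
  by (cases "n \<ge> 0") (simp_all add: power_int_def qexp_power inverse_qexp)

lemma qexp_surj:
  assumes "norm q = 1"
  shows "\<exists>t. \<exists>I\<in>imag_units. q = qexp t I"
proof -
  define v where "v = Quat 0 (qI q) (qJ q) (qK q)"
  have v: "(qRe q)\<^sup>2 + (norm v)\<^sup>2 = 1"
    using assms by (simp add: norm_quat_def inner_quat_def v_def power2_eq_square)
  obtain t where t: "qRe q = cos t" "norm v = sin t"
    using v by (metis sincos_total_2pi_le)
  show ?thesis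
  proof (cases "v = 0")
    case True
    then have "sin t = 0" using t(2) by simp
    then have "q = qexp t (Quat 0 1 0 0)"
      using t(1) True by (simp add: qexp_def quat_eq_iff v_def)
    then show ?thesis using imag_unit_exists by blast
  next
    case False
    then have "inverse (norm v) *\<^sub>R v \<in> imag_units"
      by (simp add: imag_units_iff v_def)
    moreover have "sin t \<noteq> 0" using False t(2) by auto
    then have "q = qexp t (inverse (norm v) *\<^sub>R v)"
      unfolding t(2) using t(1) by (simp add: qexp_def of_real_def quat_eq_iff v_def)
    ultimately show ?thesis by blast
  qed
qed

lemma bdB_eq: "bdB = sphere 0 1"
  by (auto simp: bdB_def dist_norm) (metis qexp_surj)

lemma qexp_in_bdB: "I \<in> imag_units \<Longrightarrow> qexp t I \<in> bdB"
  by (auto simp: bdB_def)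

lemma slice_pt_bdB_iff: "I \<in> imag_units \<Longrightarrow> slice_pt x y I \<in> bdB \<longleftrightarrow> (\<exists>t. x = cos t \<and> y = sin t)"
proof
  assume I: "I \<in> imag_units" and "slice_pt x y I \<in> bdB"
  then have "x\<^sup>2 + y\<^sup>2 = 1" using norm_slice_pt[OF I, of x y] by (simp add: bdB_eq)
  then show "\<exists>t. x = cos t \<and> y = sin t" by (metis sincos_total_2pi_le)
qed (auto simp: bdB_def qexp_def)

text \<open>For fixed \<open>t\<close> the defining formula is affine interpolation in
  \<open>I\<close> from two units, so it holds exactly when the values are affine in
  \<open>I\<close>.\<close>

lemma slice_function_iff:
  "slice_function f \<longleftrightarrow> (\<forall>t. \<exists>\<alpha> \<beta>. \<forall>I\<in>imag_units. f (qexp t I) = \<alpha> + I * \<beta>)"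
proof (intro iffI allI)
  fix t
  assume f: "slice_function f"
  \<comment> \<open>Opposite units \<open>J\<close> and \<open>- J\<close> suffice as interpolation
    nodes.\<close>
  define J where "J = Quat 0 1 0 0"
  define D where "D = inverse (J - (- J))"
  have J: "J \<in> imag_units" "- J \<in> imag_units"
    using imag_unit_exists imag_unit_uminus by (auto simp: J_def)
  have ne: "J \<noteq> - J" by (simp add: J_def quat_eq_iff)
  show "\<exists>\<alpha> \<beta>. \<forall>I\<in>imag_units. f (qexp t I) = \<alpha> + I * \<beta>"
  proof (intro exI ballI)
    fix I assume I: "I \<in> imag_units"
    have "f (qexp t I) = (D * J + I * D) * f (qexp t J) - (D * (- J) + I * D) * f (qexp t (- J))"
      using f J I ne qexp_in_bdB[OF I] unfolding slice_function_def qexp_def D_def by blast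
    then show "f (qexp t I) = (D * J * f (qexp t J) - D * (- J) * f (qexp t (- J)))
        + I * (D * (f (qexp t J) - f (qexp t (- J))))"
      by (simp add: algebra_simps)
  qed
next
  assume f: "\<forall>t. \<exists>\<alpha> \<beta>. \<forall>I\<in>imag_units. f (qexp t I) = \<alpha> + I * \<beta>"
  show "slice_function f"
    unfolding slice_function_def
  proof (intro ballI allI impI)
    fix J K I x y
    assume JKI: "J \<in> imag_units" "K \<in> imag_units" "I \<in> imag_units"
      and "J \<noteq> K" and "slice_pt x y I \<in> bdB"
    then obtain t where "x = cos t" "y = sin t" using slice_pt_bdB_iff by blast
    then obtain \<alpha> \<beta> where *: "\<And>I. I \<in> imag_units \<Longrightarrow> f (slice_pt x y I) = \<alpha> + I * \<beta>"
      using f unfolding qexp_def by blast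
    define D where "D = inverse (J - K)"
    have D: "D * (J - K) = 1" using \<open>J \<noteq> K\<close> by (simp add: D_def)
    \<comment> \<open>The order of factors is harmless: the outer terms contain
      \<open>D * (J - K) = 1\<close>, and the middle one contains
      \<open>J * J - K * K = 0\<close>.\<close>
    have "(D * J + I * D) * (\<alpha> + J * \<beta>) - (D * K + I * D) * (\<alpha> + K * \<beta>)
        = D * (J - K) * \<alpha> + D * (J * J - K * K) * \<beta> + I * (D * (J - K)) * \<beta>"
      by (simp add: algebra_simps)
    also have "\<dots> = \<alpha> + I * \<beta>"
      by (simp add: D imag_unit_square JKI)
    finally show "f (slice_pt x y I) = (inverse (J - K) * J + I * inverse (J - K)) * f (slice_pt x y J)
        - (inverse (J - K) * K + I * inverse (J - K)) * f (slice_pt x y K)"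
      using JKI by (simp add: * D_def)
  qed
qed

section \<open>Integration over the boundary, slice by slice\<close>

definition circle_measure :: "real measure"
  where "circle_measure = uniform_measure lborel {0..2 * pi}"

lemma space_circle_measure [simp]: "space circle_measure = UNIV"
  and sets_circle_measure [simp, measurable_cong]: "sets circle_measure = sets borel"
  by (simp_all add: circle_measure_def)

lemma emeasure_circle_measure [simp]: "emeasure circle_measure UNIV = 1"
  by (simp add: circle_measure_def ennreal_divide_self)

interpretation circle_measure: finite_measure circle_measure
  by (rule finite_measureI) simp

lemma imag_quat_measurable [measurable]:
  "(\<lambda>v. imag_quat (v /\<^sub>R norm v)) \<in> borel_measurable borel"
proof -
  have "imag_quat v = (v $ 1) *\<^sub>R Quat 0 1 0 0 + (v $ 2) *\<^sub>R Quat 0 0 1 0 + (v $ 3) *\<^sub>R Quat 0 0 0 1" for v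
    by (simp add: imag_quat_def quat_eq_iff)
  then have "continuous_on UNIV imag_quat"
    by (simp add: continuous_intros)
  then have [measurable]: "imag_quat \<in> borel_measurable borel"
    by (rule borel_measurable_continuous_onI)
  show ?thesis by measurable
qed

lemma imag_units_borel [measurable]: "imag_units \<in> sets borel"
  by (rule borel_closed[OF closed_imag_units])

lemma space_sigma_sph [simp]: "space sigma_sph = imag_units"
  and sets_sigma_sph [measurable_cong]: "sets sigma_sph = sets (restrict_space borel imag_units)"
  unfolding sigma_sph_def by (auto simp: space_restrict_space intro!: sets_restrict_space_cong)

lemma norm_imag_quat: "norm (imag_quat v) = norm v"
  by (simp add: imag_quat_def norm_quat_def inner_quat_def norm_eq_sqrt_inner inner_vec_def sum_3)

lemma imag_quat_radial: "v \<noteq> 0 \<Longrightarrow> imag_quat (v /\<^sub>R norm v) \<in> imag_units"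
  by (simp add: imag_units_iff norm_imag_quat) (simp add: imag_quat_def)

lemma emeasure_ball_pos: "0 < emeasure lborel (ball (0::real^3) 1)" "emeasure lborel (ball (0::real^3) 1) < \<infinity>"
  by (simp_all add: emeasure_ball)

text \<open>Null sets of the sphere are read off the ball in three-space; the radial projection
  misses the sphere only at the origin, which is a null set.\<close>

lemma AE_sigma_sph_iff:
  assumes [measurable]: "Measurable.pred borel P"
  shows "(AE I in sigma_sph. P I) \<longleftrightarrow> (AE v in lborel. v \<in> ball 0 1 \<longrightarrow> P (imag_quat (v /\<^sub>R norm v)))"
proof -
  have "(AE I in sigma_sph. P I) \<longleftrightarrow>
      (AE v in uniform_measure lborel (ball 0 1). imag_quat (v /\<^sub>R norm v) \<in> imag_units
        \<longrightarrow> P (imag_quat (v /\<^sub>R norm v)))"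
    unfolding sigma_sph_def by (subst AE_restrict_space_iff) (auto simp: AE_distr_iff)
  also have "\<dots> \<longleftrightarrow> (AE v in lborel. v \<in> ball 0 1 \<longrightarrow> imag_quat (v /\<^sub>R norm v) \<in> imag_units
        \<longrightarrow> P (imag_quat (v /\<^sub>R norm v)))"
    by (rule AE_uniform_measure) (use emeasure_ball_pos in \<open>auto simp: less_top[symmetric]\<close>)
  also have "\<dots> \<longleftrightarrow> (AE v in lborel. v \<in> ball 0 1 \<longrightarrow> P (imag_quat (v /\<^sub>R norm v)))"
    (is "?A \<longleftrightarrow> ?B")
  proof
    assume ?A
    with AE_lborel_singleton[of "0 :: real ^ 3"] show ?B
      by eventually_elim (use imag_quat_radial in blast)
  next
    assume ?B
    then show ?A by eventually_elim blast
  qed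
  finally show ?thesis .
qed

lemma emeasure_sigma_sph [simp]: "emeasure sigma_sph imag_units = 1"
proof -
  let ?U = "uniform_measure lborel (ball (0 :: real ^ 3) 1)"
  have "emeasure sigma_sph imag_units = emeasure ?U {v. imag_quat (v /\<^sub>R norm v) \<in> imag_units}"
    unfolding sigma_sph_def
    by (subst emeasure_restrict_space) (auto simp: emeasure_distr vimage_def)
  also have "\<dots> = emeasure ?U UNIV"
  proof (rule emeasure_eq_AE)
    have "AE v in ?U. v \<noteq> 0"
      using AE_lborel_singleton[of "0 :: real ^ 3"] by (intro AE_uniform_measureI) auto
    then show "AE v in ?U. v \<in> {v. imag_quat (v /\<^sub>R norm v) \<in> imag_units} \<longleftrightarrow> v \<in> UNIV"
      by eventually_elim (simp add: imag_quat_radial)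
  qed auto
  also have "\<dots> = 1"
    using emeasure_ball_pos by (simp add: ennreal_divide_self)
  finally show ?thesis .
qed

interpretation sigma_sph: finite_measure sigma_sph
  by (rule finite_measureI) simp

text \<open>The radial projection pulls a great circle back to a plane through the origin, a
  Lebesgue null set, while the ball has positive measure.\<close>

lemma sigma_sph_not_on_great_circle:
  assumes "qRe w = 0" "AE I in sigma_sph. inner I w = 0"
  shows "w = 0"
proof (rule ccontr)
  assume "w \<noteq> 0"
  define c :: "real ^ 3" where "c = vector [qI w, qJ w, qK w]"
  have c: "inner (imag_quat v) w = inner v c" for v
    by (simp add: c_def imag_quat_def inner_quat_def inner_vec_def sum_3)
  have "c \<noteq> 0"
    using \<open>w \<noteq> 0\<close> assms(1) by (auto simp: c_def vec_eq_iff forall_3 quat_eq_iff)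
  then have "negligible {x. inner c x = 0}" by (intro negligible_hyperplane) auto
  then have "AE x in lebesgue. x \<notin> {x. inner c x = 0}"
    by (intro AE_not_in) (simp add: negligible_iff_null_sets)
  then have "AE x in lborel. inner c x \<noteq> 0"
    by (simp add: AE_completion_iff)
  moreover have "AE v in lborel. v \<in> ball 0 1 \<longrightarrow> inner (imag_quat (v /\<^sub>R norm v)) w = 0"
    using assms(2) by (subst (asm) AE_sigma_sph_iff) auto
  ultimately have "AE v in lborel. v \<notin> ball (0 :: real ^ 3) 1"
    by eventually_elim (auto simp: c inner_commute[of c])
  then have "emeasure lborel (ball (0 :: real ^ 3) 1) = 0"
    by (subst (asm) AE_iff_measurable) auto
  then show False using emeasure_ball_pos(1) by simp
qed

lemma bdB_borel [measurable]: "bdB \<in> sets borel"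
  by (simp add: bdB_eq)

lemma space_Sigma_bd [simp]: "space Sigma_bd = bdB"
  and sets_Sigma_bd [measurable_cong]: "sets Sigma_bd = sets (restrict_space borel bdB)"
  unfolding Sigma_bd_def by (auto simp: space_restrict_space intro!: sets_restrict_space_cong)

lemma qexp_measurable [measurable]:
  "(\<lambda>(I, t). qexp t I) \<in> borel_measurable (sigma_sph \<Otimes>\<^sub>M circle_measure)"
proof -
  have "(\<lambda>I. I) \<in> borel_measurable (restrict_space borel imag_units)"
    by (rule measurable_restrict_space1) simp
  then have [measurable]: "(\<lambda>I. I) \<in> borel_measurable sigma_sph"
    by (simp add: measurable_cong_sets[OF sets_sigma_sph refl])
  show ?thesis unfolding qexp_def by measurable
qed

lemma qexp_measurable_Sigma [measurable]:
  "(\<lambda>(I, t). qexp t I) \<in> measurable (sigma_sph \<Otimes>\<^sub>M circle_measure) Sigma_bd"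
proof -
  have "(\<lambda>(I, t). qexp t I) \<in> measurable (sigma_sph \<Otimes>\<^sub>M circle_measure) (restrict_space borel bdB)"
    by (rule measurable_restrict_space2) (auto simp: space_pair_measure qexp_in_bdB)
  then show ?thesis by (simp add: measurable_cong_sets[OF refl sets_Sigma_bd])
qed

lemma qexp_measurable_slice:
  assumes "I \<in> imag_units"
  shows "(\<lambda>t. qexp t I) \<in> measurable circle_measure Sigma_bd"
  using measurable_compose[OF measurable_Pair1'[of I sigma_sph circle_measure] qexp_measurable_Sigma] assms
  by simp

text \<open>\<open>Sigma_bd\<close> comes from a product measure, so by Tonelli boundary estimates
  reduce to integrals over single circles.\<close>

lemma nn_integral_Sigma_bd:
  assumes f: "f \<in> borel_measurable Sigma_bd"
  shows "(\<integral>\<^sup>+ q. f q \<partial>Sigma_bd) = (\<integral>\<^sup>+ I. \<integral>\<^sup>+ t. f (qexp t I) \<partial>circle_measure \<partial>sigma_sph)"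
proof -
  let ?M = "sigma_sph \<Otimes>\<^sub>M circle_measure"
  have f': "(\<lambda>q. f q * indicator bdB q) \<in> borel_measurable borel"
    using f by (subst (asm) measurable_cong_sets[OF sets_Sigma_bd refl])
      (simp add: borel_measurable_restrict_space_iff_ennreal)
  have "(\<integral>\<^sup>+ q. f q \<partial>Sigma_bd) = (\<integral>\<^sup>+ q. f q * indicator bdB q \<partial>distr ?M borel (\<lambda>(I, t). qexp t I))"
    unfolding Sigma_bd_def circle_measure_def[symmetric] by (rule nn_integral_restrict_space) simp
  also have "\<dots> = (\<integral>\<^sup>+ x. (case x of (I, t) \<Rightarrow> f (qexp t I) * indicator bdB (qexp t I)) \<partial>?M)"
    by (subst nn_integral_distr) (use f' in \<open>auto simp: case_prod_beta'\<close>)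
  also have "\<dots> = (\<integral>\<^sup>+ x. (case x of (I, t) \<Rightarrow> f (qexp t I)) \<partial>?M)"
    by (rule nn_integral_cong) (auto simp: space_pair_measure qexp_in_bdB)
  also have "\<dots> = (\<integral>\<^sup>+ I. \<integral>\<^sup>+ t. f (qexp t I) \<partial>circle_measure \<partial>sigma_sph)"
    using measurable_compose[OF qexp_measurable_Sigma f]
    by (subst circle_measure.nn_integral_fst[symmetric]) (auto simp: case_prod_beta')
  finally show ?thesis .
qed

lemma emeasure_Sigma_bd: "(\<integral>\<^sup>+ q. c \<partial>Sigma_bd) = c"
  by (subst nn_integral_Sigma_bd) simp_all

lemma powi_measurable [measurable]: "(\<lambda>q. q powi n) \<in> borel_measurable Sigma_bd"
proof -
  have "continuous_on bdB (\<lambda>q::quat. q powi n)"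
    by (intro continuous_intros) (auto simp: bdB_eq)
  then show ?thesis
    by (subst measurable_cong_sets[OF sets_Sigma_bd refl])
      (rule borel_measurable_continuous_on_restrict)
qed

section \<open>Fourier orthogonality and Parseval's identity on a slice\<close>

lemma has_integral_circle_cos:
  "((\<lambda>t. cos (of_int k * t)) has_integral (if k = 0 then 2 * pi else 0)) {0..2 * pi}"
proof (cases "k = 0")
  case True
  then show ?thesis using has_integral_const_real[of "1::real" 0 "2 * pi"] by simp
next
  case False
  have "((\<lambda>t. cos (of_int k * t)) has_integral
      sin (of_int k * (2 * pi)) / of_int k - sin (of_int k * 0) / of_int k) {0..2 * pi}"
    using False
    by (intro fundamental_theorem_of_calculus)
      (auto intro!: derivative_eq_intros simp flip: has_real_derivative_iff_has_vector_derivative)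
  moreover have "sin (of_int k * (2 * pi)) = 0"
    using sin_int_2pin[of k] by (simp add: mult.commute)
  ultimately show ?thesis using False by simp
qed

lemma has_integral_circle_sin: "((\<lambda>t. sin (of_int k * t)) has_integral 0) {0..2 * pi}"
proof (cases "k = 0")
  case False
  have "((\<lambda>t. sin (of_int k * t)) has_integral
      - cos (of_int k * (2 * pi)) / of_int k - (- cos (of_int k * 0) / of_int k)) {0..2 * pi}"
    using False
    by (intro fundamental_theorem_of_calculus)
      (auto intro!: derivative_eq_intros simp flip: has_real_derivative_iff_has_vector_derivative)
  moreover have "cos (of_int k * (2 * pi)) = 1"
    using cos_int_2pin[of k] by (simp add: mult.commute)
  ultimately show ?thesis by simp
qed simp

text \<open>The bridge from integrals found by the fundamental theorem of calculus to the normalized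
  measure, hence the factor \<open>2 * pi\<close>.\<close>

lemma nn_integral_circle_measure:
  assumes "(f has_integral (2 * pi * r)) {0..2 * pi}" "\<And>t. 0 \<le> f t" "f \<in> borel_measurable borel"
  shows "(\<integral>\<^sup>+ t. ennreal (f t) \<partial>circle_measure) = ennreal r"
proof -
  have r: "0 \<le> r" using has_integral_nonneg[OF assms(1)] assms(2) by (simp add: zero_le_mult_iff) (use pi_gt_zero in linarith)
  have "(\<integral>\<^sup>+ t. ennreal (f t) \<partial>circle_measure)
      = (\<integral>\<^sup>+ t. ennreal (f t) * indicator {0..2 * pi} t \<partial>lborel) / emeasure lborel {0..2 * pi}"
    unfolding circle_measure_def using assms(3) by (intro nn_integral_uniform_measure) auto
  also have "(\<integral>\<^sup>+ t. ennreal (f t) * indicator {0..2 * pi} t \<partial>lborel) = ennreal (2 * pi * r)"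
    using nn_integral_has_integral_lebesgue[OF assms(2,1)]
    by (simp add: ennreal_mult'' ennreal_indicator mult.commute)
  also have "ennreal (2 * pi * r) / emeasure lborel {0..2 * pi} = ennreal r"
    using r by (simp add: divide_ennreal)
  finally show ?thesis .
qed

text \<open>The coefficients stand on the right and need not commute with \<open>I\<close>, but the
  exponential factors lie in one commutative slice and combine to the exponential at
  \<open>(m - n) * t\<close>. The cross terms, including those with \<open>I * c m\<close>,
  integrate to 0.\<close>

lemma parseval_slice:
  assumes I: "I \<in> imag_units" and F: "finite F"
  shows "(\<integral>\<^sup>+ t. ennreal ((norm (\<Sum>n\<in>F. qexp t I powi n * c n))\<^sup>2) \<partial>circle_measure)
    = ennreal (\<Sum>n\<in>F. (norm (c n))\<^sup>2)"
proof (rule nn_integral_circle_measure)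
  have eq: "(norm (\<Sum>n\<in>F. qexp t I powi n * c n))\<^sup>2 = (\<Sum>m\<in>F. \<Sum>n\<in>F.
      cos (of_int (m - n) * t) * inner (c m) (c n) + sin (of_int (m - n) * t) * inner (I * c m) (c n))" for t
  proof -
    have "inner (qexp (of_int m * t) I * c m) (qexp (of_int n * t) I * c n)
        = cos (of_int (m - n) * t) * inner (c m) (c n) + sin (of_int (m - n) * t) * inner (I * c m) (c n)" for m n
    proof -
      have "qcnj (qexp (of_int n * t) I) = qexp (- (of_int n * t)) I"
        using I by (simp add: qexp_def imag_units_iff quat_eq_iff)
      then have "inner (qexp (of_int m * t) I * c m) (qexp (of_int n * t) I * c n)
          = inner (qexp (- (of_int n * t)) I * (qexp (of_int m * t) I * c m)) (c n)"
        using inner_mult_left_quat[of "qexp (- (of_int n * t)) I" "qexp (of_int m * t) I * c m" "c n"]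
        by (metis qcnj_simps(1))
      also have "\<dots> = inner (qexp (of_int (m - n) * t) I * c m) (c n)"
        using qexp_add[OF I, of "- (of_int n * t)" "of_int m * t"]
        by (simp add: mult.assoc[symmetric] left_diff_distrib)
      also have "\<dots> = cos (of_int (m - n) * t) * inner (c m) (c n)
          + sin (of_int (m - n) * t) * inner (I * c m) (c n)"
        by (simp add: qexp_def distrib_right inner_add_left of_real_def)
      finally show ?thesis .
    qed
    then show ?thesis
      by (simp add: qexp_powi[OF I] power2_norm_eq_inner inner_sum_left inner_sum_right)
        (rule sum.swap)
  qed
  have "((\<lambda>t. \<Sum>m\<in>F. \<Sum>n\<in>F.
      cos (of_int (m - n) * t) * inner (c m) (c n) + sin (of_int (m - n) * t) * inner (I * c m) (c n))
    has_integral (\<Sum>m\<in>F. \<Sum>n\<in>F. (if m - n = 0 then 2 * pi else 0) * inner (c m) (c n) + 0 * inner (I * c m) (c n)))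
    {0..2 * pi}"
    by (intro has_integral_sum has_integral_add has_integral_mult_left
        has_integral_circle_cos has_integral_circle_sin F)
  also have "(\<Sum>m\<in>F. \<Sum>n\<in>F. (if m - n = 0 then 2 * pi else 0) * inner (c m) (c n) + 0 * inner (I * c m) (c n))
      = 2 * pi * (\<Sum>n\<in>F. (norm (c n))\<^sup>2)"
    using F by (simp add: if_distrib[of "\<lambda>x. x * _"] sum.delta sum_distrib_left power2_norm_eq_inner cong: if_cong)
  finally show "((\<lambda>t. (norm (\<Sum>n\<in>F. qexp t I powi n * c n))\<^sup>2) has_integral
      2 * pi * (\<Sum>n\<in>F. (norm (c n))\<^sup>2)) {0..2 * pi}"
    unfolding eq .
  show "(\<lambda>t. (norm (\<Sum>n\<in>F. qexp t I powi n * c n))\<^sup>2) \<in> borel_measurable borel"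
    unfolding eq by measurable
qed simp

section \<open>Boundary functions and their coefficients\<close>

text \<open>The square of the distance is kept, with values in \<open>ennreal\<close>, so that no
  integrability has to be carried along; the price is a triangle inequality with constants.\<close>

definition l2_dist2 :: "'a measure \<Rightarrow> ('a \<Rightarrow> quat) \<Rightarrow> ('a \<Rightarrow> quat) \<Rightarrow> ennreal"
  where "l2_dist2 M f g = (\<integral>\<^sup>+ x. ennreal ((norm (f x - g x))\<^sup>2) \<partial>M)"

lemma l2_dist2_commute: "l2_dist2 M f g = l2_dist2 M g f"
  by (simp add: l2_dist2_def norm_minus_commute)

text \<open>Young's inequality with weight \<open>e\<close>. A factor \<open>1 + e\<close> near 1 on
  one of the terms is what lets exact norms pass to the limit.\<close>

lemma norm_add_square_le:
  fixes x y :: "'a::real_normed_vector"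
  assumes "0 < e"
  shows "(norm (x + y))\<^sup>2 \<le> (1 + e) * (norm x)\<^sup>2 + (1 + 1 / e) * (norm y)\<^sup>2"
proof -
  have "(norm (x + y))\<^sup>2 \<le> (norm x + norm y)\<^sup>2"
    by (simp add: norm_triangle_ineq)
  moreover have "2 * norm x * norm y \<le> e * (norm x)\<^sup>2 + (norm y)\<^sup>2 / e"
    using sum_squares_bound[of "sqrt e * norm x" "norm y / sqrt e"] assms
    by (simp add: power_mult_distrib power_divide)
  ultimately show ?thesis by (simp add: power2_sum algebra_simps)
qed

lemma l2_dist2_triangle_weighted:
  assumes [measurable]: "f \<in> borel_measurable M" "g \<in> borel_measurable M" "h \<in> borel_measurable M"
    and e: "0 < e"
  shows "l2_dist2 M f h \<le> ennreal (1 + e) * l2_dist2 M f g + ennreal (1 + 1 / e) * l2_dist2 M g h"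
proof -
  have "l2_dist2 M f h \<le> (\<integral>\<^sup>+ x. ennreal (1 + e) * ennreal ((norm (f x - g x))\<^sup>2)
      + ennreal (1 + 1 / e) * ennreal ((norm (g x - h x))\<^sup>2) \<partial>M)"
    unfolding l2_dist2_def
  proof (rule nn_integral_mono)
    fix x
    have "(norm (f x - h x))\<^sup>2 \<le> (1 + e) * (norm (f x - g x))\<^sup>2 + (1 + 1 / e) * (norm (g x - h x))\<^sup>2"
      using norm_add_square_le[OF e, of "f x - g x" "g x - h x"] by simp
    then show "ennreal ((norm (f x - h x))\<^sup>2) \<le> ennreal (1 + e) * ennreal ((norm (f x - g x))\<^sup>2)
      + ennreal (1 + 1 / e) * ennreal ((norm (g x - h x))\<^sup>2)"
      using e by (simp add: ennreal_mult[symmetric] ennreal_plus[symmetric] ennreal_leI del: ennreal_plus)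
  qed
  also have "\<dots> = ennreal (1 + e) * l2_dist2 M f g + ennreal (1 + 1 / e) * l2_dist2 M g h"
    unfolding l2_dist2_def by (simp add: nn_integral_add nn_integral_cmult)
  finally show ?thesis .
qed

lemma l2_dist2_triangle:
  assumes "f \<in> borel_measurable M" "g \<in> borel_measurable M" "h \<in> borel_measurable M"
  shows "l2_dist2 M f h \<le> 2 * (l2_dist2 M f g + l2_dist2 M g h)"
  using l2_dist2_triangle_weighted[OF assms, of 1] by (simp add: distrib_left)

text \<open>Both inequalities come from the weighted triangle inequality: \<open>N\<close> tends to
  infinity first, which removes the term with the large factor \<open>1 + 1 / e\<close>, and then
  \<open>e\<close> tends to 0.\<close>

lemma l2_dist2_limit:
  assumes [measurable]: "f \<in> borel_measurable M" "\<And>N. s N \<in> borel_measurable M"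
    and lim: "(\<lambda>N. l2_dist2 M f (s N)) \<longlonglongrightarrow> 0"
    and s: "(\<lambda>N. l2_dist2 M (s N) (\<lambda>_. 0)) \<longlonglongrightarrow> ennreal x" and x: "0 \<le> x"
  shows "l2_dist2 M f (\<lambda>_. 0) = ennreal x"
proof -
  let ?y = "l2_dist2 M f (\<lambda>_. 0)"
  have upper: "?y \<le> ennreal ((1 + e) * x)" if "0 < e" for e
  proof -
    have "(\<lambda>N. ennreal (1 + 1 / e) * l2_dist2 M f (s N) + ennreal (1 + e) * l2_dist2 M (s N) (\<lambda>_. 0))
        \<longlonglongrightarrow> ennreal (1 + 1 / e) * 0 + ennreal (1 + e) * ennreal x"
      by (intro tendsto_add ennreal_tendsto_cmult lim s) (auto simp: less_top[symmetric])
    moreover have "?y \<le> ennreal (1 + 1 / e) * l2_dist2 M f (s N) + ennreal (1 + e) * l2_dist2 M (s N) (\<lambda>_. 0)" for N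
      using l2_dist2_triangle_weighted[of f M "s N" "\<lambda>_. 0" "1 / e"] that by simp
    ultimately have "?y \<le> ennreal (1 + 1 / e) * 0 + ennreal (1 + e) * ennreal x"
      by (intro LIMSEQ_le_const) auto
    then show ?thesis using that x by (simp add: ennreal_mult[symmetric] del: ennreal_plus)
  qed
  have lower: "ennreal x \<le> ennreal (1 + e) * ?y" if "0 < e" for e
  proof -
    have "(\<lambda>N. ennreal (1 + 1 / e) * l2_dist2 M f (s N) + ennreal (1 + e) * ?y)
        \<longlonglongrightarrow> ennreal (1 + 1 / e) * 0 + ennreal (1 + e) * ?y"
      by (intro tendsto_add ennreal_tendsto_cmult lim tendsto_const) (auto simp: less_top[symmetric])
    moreover have "l2_dist2 M (s N) (\<lambda>_. 0) \<le> ennreal (1 + 1 / e) * l2_dist2 M f (s N) + ennreal (1 + e) * ?y" for N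
      using l2_dist2_triangle_weighted[of "s N" M f "\<lambda>_. 0" "1 / e"] that
      by (simp add: l2_dist2_commute[of M "s N" f])
    ultimately show ?thesis using LIMSEQ_le[OF s] by fastforce
  qed
  obtain y where y: "?y = ennreal y" "0 \<le> y"
    using upper[of 1] by (metis ennreal_cases ennreal_less_top not_le zero_less_one)
  have "y \<le> x"
  proof (rule field_le_epsilon)
    fix e :: real assume e: "0 < e"
    \<comment> \<open>With this weight the excess is \<open>e * x / (x + 1)\<close>, which stays
      below \<open>e\<close> and makes sense for \<open>x = 0\<close> too.\<close>
    then have "y \<le> (1 + e / (x + 1)) * x"
      using upper[of "e / (x + 1)"] x y by (simp add: ennreal_le_iff)
    also have "\<dots> \<le> x + e" using e x by (simp add: field_simps)
    finally show "y \<le> x + e" .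
  qed
  moreover have "x \<le> y"
  proof (rule field_le_epsilon)
    fix e :: real assume e: "0 < e"
    then have "x \<le> (1 + e / (y + 1)) * y"
      using lower[of "e / (y + 1)"] x y by (simp add: ennreal_mult[symmetric] ennreal_le_iff del: ennreal_plus)
    also have "\<dots> \<le> y + e" using e y by (simp add: field_simps)
    finally show "x \<le> y + e" .
  qed
  ultimately show ?thesis using y by simp
qed

section \<open>Laurent sums and their convergence almost everywhere\<close>

definition laurent_sum :: "(int \<Rightarrow> quat) \<Rightarrow> nat \<Rightarrow> quat \<Rightarrow> quat"
  where "laurent_sum a N q = (\<Sum>n = - int N..int N. q powi n * a n)"

lemma laurent_sum_measurable [measurable]: "laurent_sum a N \<in> borel_measurable Sigma_bd"
  unfolding laurent_sum_def by measurable

definition tail2 :: "ell2 \<Rightarrow> nat \<Rightarrow> real"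
  where "tail2 a N = (norm a)\<^sup>2 - (\<Sum>n = - int N..int N. (norm (seq a n))\<^sup>2)"

lemma tail2_tendsto: "tail2 a \<longlonglongrightarrow> 0"
proof -
  have "(\<lambda>N. (norm a)\<^sup>2 - (\<Sum>n = - int N..int N. (norm (seq a n))\<^sup>2)) \<longlonglongrightarrow> (norm a)\<^sup>2 - (norm a)\<^sup>2"
    by (intro tendsto_intros has_sum_imp_symmetric_limit norm_ell2_has_sum)
  then show ?thesis by (simp add: tail2_def[abs_def])
qed

lemma sum_le_tail2:
  assumes "finite F" "F \<inter> {- int N..int N} = {}"
  shows "(\<Sum>n\<in>F. (norm (seq a n))\<^sup>2) \<le> tail2 a N"
  using norm_ell2_sum_le[of "F \<union> {- int N..int N}" a] assms
  by (simp add: tail2_def sum.union_disjoint)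

lemma laurent_sum_measurable_slice:
  assumes "I \<in> imag_units"
  shows "(\<lambda>t. laurent_sum a N (qexp t I)) \<in> borel_measurable circle_measure"
  by (rule measurable_compose[OF qexp_measurable_slice[OF assms] laurent_sum_measurable])

lemma l2_dist2_laurent_sum_slice:
  assumes "I \<in> imag_units" "M \<le> N"
  shows "l2_dist2 circle_measure (\<lambda>t. laurent_sum (seq a) N (qexp t I)) (\<lambda>t. laurent_sum (seq a) M (qexp t I))
    \<le> ennreal (tail2 a M)"
proof -
  have "laurent_sum (seq a) N q - laurent_sum (seq a) M q
      = (\<Sum>n\<in>{- int N..int N} - {- int M..int M}. q powi n * seq a n)" for q
    unfolding laurent_sum_def using assms(2) by (intro sum_diff[symmetric]) auto
  then show ?thesis
    using assms(1) by (simp add: l2_dist2_def parseval_slice)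
      (intro ennreal_leI sum_le_tail2, auto)
qed

text \<open>Riesz-Fischer argument: increments with square integral at most
  \<open>(1 / 4) ^ k\<close> have integrals bounded by a geometric series, so they are absolutely
  summable almost everywhere.\<close>

lemma AE_Cauchy_laurent_sum_slice:
  assumes I: "I \<in> imag_units" and r: "mono r" "\<And>k. tail2 a (r k) \<le> (1 / 4) ^ k"
  shows "AE t in circle_measure. Cauchy (\<lambda>k. laurent_sum (seq a) (r k) (qexp t I))"
proof -
  let ?L = "\<lambda>k t. laurent_sum (seq a) (r k) (qexp t I)"
  define D where "D k t = ?L (Suc k) t - ?L k t" for k t
  have [measurable]: "D k \<in> borel_measurable circle_measure" for k
    unfolding D_def by (intro borel_measurable_diff laurent_sum_measurable_slice I)
  have "(\<integral>\<^sup>+ t. ennreal (norm (D k t)) \<partial>circle_measure) \<le> ennreal (2 * (1 / 2) ^ k)" for k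
  proof -
    \<comment> \<open>A weighted arithmetic-geometric mean instead of Cauchy-Schwarz; against the
      bound \<open>(1 / 4) ^ k\<close> both terms contribute at most
      \<open>(1 / 2) ^ k\<close>.\<close>
    have "norm (D k t) \<le> 2 ^ k * (norm (D k t))\<^sup>2 + (1 / 2) ^ k" for t
    proof -
      have "sqrt (2 ^ k) * sqrt ((1 / 2) ^ k) = 1"
        by (simp add: real_sqrt_mult[symmetric] power_mult_distrib[symmetric])
      then have "2 * norm (D k t) = 2 * (sqrt (2 ^ k) * norm (D k t)) * sqrt ((1 / 2) ^ k)"
        by (simp add: mult_ac)
      also have "\<dots> \<le> 2 ^ k * (norm (D k t))\<^sup>2 + (1 / 2) ^ k"
        using sum_squares_bound[of "sqrt (2 ^ k) * norm (D k t)" "sqrt ((1 / 2) ^ k)"]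
        by (simp add: power_mult_distrib)
      finally show ?thesis using norm_ge_zero[of "D k t"] by linarith
    qed
    then have "(\<integral>\<^sup>+ t. ennreal (norm (D k t)) \<partial>circle_measure)
        \<le> (\<integral>\<^sup>+ t. ennreal (2 ^ k) * ennreal ((norm (D k t))\<^sup>2) + ennreal ((1 / 2) ^ k) \<partial>circle_measure)"
      by (intro nn_integral_mono)
        (simp add: ennreal_mult[symmetric] ennreal_plus[symmetric] ennreal_leI del: ennreal_plus)
    also have "\<dots> = ennreal (2 ^ k) * (\<integral>\<^sup>+ t. ennreal ((norm (D k t))\<^sup>2) \<partial>circle_measure) + ennreal ((1 / 2) ^ k)"
      by (simp add: nn_integral_add nn_integral_cmult)
    also have "\<dots> \<le> ennreal (2 ^ k) * ennreal ((1 / 4) ^ k) + ennreal ((1 / 2) ^ k)"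
    proof (intro add_mono mult_left_mono order_refl)
      have "(\<integral>\<^sup>+ t. ennreal ((norm (D k t))\<^sup>2) \<partial>circle_measure) \<le> ennreal (tail2 a (r k))"
        using l2_dist2_laurent_sum_slice[OF I monoD[OF r(1)], of k "Suc k"]
        by (simp add: l2_dist2_def D_def)
      also have "\<dots> \<le> ennreal ((1 / 4) ^ k)" using r(2) by (rule ennreal_leI)
      finally show "(\<integral>\<^sup>+ t. ennreal ((norm (D k t))\<^sup>2) \<partial>circle_measure) \<le> ennreal ((1 / 4) ^ k)" .
    qed simp
    also have "\<dots> = ennreal (2 ^ k * (1 / 4) ^ k + (1 / 2) ^ k)"
      by (simp add: ennreal_mult ennreal_plus)
    also have "2 ^ k * (1 / 4) ^ k + (1 / 2) ^ k = (2 * (1 / 2) ^ k :: real)"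
      by (simp add: power_mult_distrib[symmetric])
    finally show ?thesis .
  qed
  then have "(\<integral>\<^sup>+ t. (\<Sum>k. ennreal (norm (D k t))) \<partial>circle_measure) \<le> (\<Sum>k. ennreal (2 * (1 / 2) ^ k))"
    by (subst nn_integral_suminf) (auto intro!: suminf_le)
  also have "\<dots> = ennreal (\<Sum>k. 2 * (1 / 2) ^ k)"
    by (rule suminf_ennreal2) (auto intro!: summable_mult summable_geometric)
  finally have "(\<integral>\<^sup>+ t. (\<Sum>k. ennreal (norm (D k t))) \<partial>circle_measure) \<noteq> \<infinity>"
    by (auto simp: top_unique)
  then have "AE t in circle_measure. (\<Sum>k. ennreal (norm (D k t))) \<noteq> \<infinity>"
    by (rule nn_integral_PInf_AE[rotated]) measurable
  then show ?thesis
  proof eventually_elim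
    case (elim t)
    then have "summable (\<lambda>k. norm (D k t))"
      by (intro summable_suminf_not_top) auto
    then have "summable (\<lambda>k. D k t)" by (rule summable_norm_cancel)
    then have "convergent (\<lambda>n. \<Sum>k<n. D k t)" by (simp add: summable_iff_convergent)
    then have "convergent (\<lambda>n. ?L n t - ?L 0 t)"
      unfolding D_def sum_lessThan_telescope[of "\<lambda>k. ?L k t"] .
    then show ?case
      by (simp add: convergent_diff_const_right_iff Cauchy_convergent_iff)
  qed
qed

lemma laurent_sum_slice:
  assumes "I \<in> imag_units"
  shows "laurent_sum a N (qexp t I) = (\<Sum>n = - int N..int N. cos (of_int n * t) *\<^sub>R a n)
    + I * (\<Sum>n = - int N..int N. sin (of_int n * t) *\<^sub>R a n)"
  using assms
  by (simp add: laurent_sum_def qexp_powi qexp_def[of "_ * _"] of_real_def distrib_right sum.distrib sum_distrib_left)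

lemma tail2_subsequence: "\<exists>r. mono r \<and> (\<forall>k. k \<le> r k \<and> tail2 a (r k) \<le> (1 / 4) ^ k)"
proof -
  have "\<exists>N. \<forall>n\<ge>N. tail2 a n \<le> (1 / 4) ^ k" for k
    using order_tendstoD(2)[OF tail2_tendsto[of a], of "(1 / 4) ^ k"]
    by (auto simp: eventually_sequentially intro: less_imp_le)
  then obtain g where g: "\<And>k n. g k \<le> n \<Longrightarrow> tail2 a n \<le> (1 / 4) ^ k" by metis
  \<comment> \<open>The sum is monotone and dominates each threshold \<open>g k\<close>; the summand
    \<open>k\<close> secures \<open>k \<le> r k\<close>.\<close>
  define r where "r k = (\<Sum>j\<le>k. g j) + k" for k
  have "g k \<le> r k" for k unfolding r_def by (rule trans_le_add1) (auto intro!: member_le_sum)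
  moreover have "mono r" by (rule incseq_SucI) (simp add: r_def)
  moreover have "k \<le> r k" for k by (simp add: r_def)
  ultimately show ?thesis using g by blast
qed

text \<open>A sparse subsequence of the Laurent sums converges almost everywhere on each slice. Asking for
  convergence at both \<open>q\<close> and its conjugate makes the set of convergence the same on all slices,
  so that the limit is a slice function at every point.\<close>

theorem L2s_exists_slicewise:
  fixes a :: ell2
  shows "\<exists>f. slice_function f \<and> f \<in> borel_measurable Sigma_bd \<and>
    (\<forall>I\<in>imag_units. \<forall>M. l2_dist2 circle_measure (\<lambda>t. f (qexp t I))
        (\<lambda>t. laurent_sum (seq a) M (qexp t I)) \<le> ennreal (tail2 a M))"
proof -
  obtain r where r: "mono r" "\<And>k. k \<le> r k" "\<And>k. tail2 a (r k) \<le> (1 / 4) ^ k"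
    using tail2_subsequence[of a] by blast
  define L where "L k = laurent_sum (seq a) (r k)" for k
  define f where "f q = (if Cauchy (\<lambda>k. L k q) \<and> Cauchy (\<lambda>k. L k (inverse q)) then lim (\<lambda>k. L k q) else 0)" for q
  have "slice_function f"
    unfolding slice_function_iff
  proof
    fix t
    define A where "A k = (\<Sum>n = - int (r k)..int (r k). cos (of_int n * t) *\<^sub>R seq a n)" for k
    define B where "B k = (\<Sum>n = - int (r k)..int (r k). sin (of_int n * t) *\<^sub>R seq a n)" for k
    have L: "L k (qexp t I) = A k + I * B k" "L k (inverse (qexp t I)) = A k - I * B k"
      if "I \<in> imag_units" for I k
      using laurent_sum_slice[OF that] laurent_sum_slice[OF imag_unit_uminus[OF that]]
      by (simp_all add: L_def A_def B_def inverse_qexp[OF that] qexp_uminus)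
    show "\<exists>\<alpha> \<beta>. \<forall>I\<in>imag_units. f (qexp t I) = \<alpha> + I * \<beta>"
    proof (cases "convergent A \<and> convergent B")
      case True
      then obtain \<alpha> \<beta> where "A \<longlonglongrightarrow> \<alpha>" "B \<longlonglongrightarrow> \<beta>" by (auto simp: convergent_def)
      then have "(\<lambda>k. A k + I * B k) \<longlonglongrightarrow> \<alpha> + I * \<beta>" "(\<lambda>k. A k - I * B k) \<longlonglongrightarrow> \<alpha> - I * \<beta>" for I
        by (auto intro!: tendsto_intros)
      then have "f (qexp t I) = \<alpha> + I * \<beta>" if "I \<in> imag_units" for I
        using LIMSEQ_imp_Cauchy[of "\<lambda>k. A k + I * B k"] LIMSEQ_imp_Cauchy[of "\<lambda>k. A k - I * B k"]
        by (simp add: f_def L[OF that] limI) blast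
      then show ?thesis by blast
    next
      case False
      have "f (qexp t I) = 0" if I: "I \<in> imag_units" for I
      proof (rule ccontr)
        assume "f (qexp t I) \<noteq> 0"
        then have "convergent (\<lambda>k. A k + I * B k)" "convergent (\<lambda>k. A k - I * B k)"
          by (auto simp: f_def L[OF I] Cauchy_convergent_iff split: if_splits)
        then obtain x y where xy: "(\<lambda>k. A k + I * B k) \<longlonglongrightarrow> x" "(\<lambda>k. A k - I * B k) \<longlonglongrightarrow> y"
          by (auto simp: convergent_def)
        \<comment> \<open>Half the sum of the two sequences is \<open>A\<close>; their half
          difference, multiplied by \<open>- I\<close>, is \<open>B\<close>. Convergence at one unit
          and its opposite thus gives it at all units.\<close>
        have "(\<lambda>k. (1 / 2) *\<^sub>R ((A k + I * B k) + (A k - I * B k))) \<longlonglongrightarrow> (1 / 2) *\<^sub>R (x + y)"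
          by (intro tendsto_intros xy)
        moreover have "(1 / 2) *\<^sub>R ((A k + I * B k) + (A k - I * B k)) = A k" for k
          by (simp add: scaleR_2[symmetric])
        ultimately have "convergent A" by (auto simp: convergent_def)
        moreover
        have "(\<lambda>k. - (I * ((1 / 2) *\<^sub>R ((A k + I * B k) - (A k - I * B k))))) \<longlonglongrightarrow> - (I * ((1 / 2) *\<^sub>R (x - y)))"
          by (intro tendsto_intros xy)
        moreover have "- (I * ((1 / 2) *\<^sub>R ((A k + I * B k) - (A k - I * B k)))) = B k" for k
          by (simp add: scaleR_2[symmetric] mult.assoc[symmetric] imag_unit_square[OF I])
        ultimately have "convergent B" by (auto simp: convergent_def)
        with \<open>convergent A\<close> False show False by blast
      qed
      then show ?thesis by (intro exI[of _ 0]) simp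
    qed
  qed
  moreover have f_meas: "f \<in> borel_measurable Sigma_bd"
  proof -
    have "(\<lambda>q. inverse q powi n) \<in> borel_measurable Sigma_bd" for n
    proof -
      have "continuous_on bdB (\<lambda>q::quat. inverse q powi n)"
        by (intro continuous_intros) (auto simp: bdB_eq)
      then show ?thesis
        by (subst measurable_cong_sets[OF sets_Sigma_bd refl])
          (rule borel_measurable_continuous_on_restrict)
    qed
    then have [measurable]: "(\<lambda>q. L k (inverse q)) \<in> borel_measurable Sigma_bd" for k
      unfolding L_def laurent_sum_def by measurable
    have [measurable]: "L k \<in> borel_measurable Sigma_bd" for k
      unfolding L_def by measurable
    show ?thesis unfolding f_def by measurable
  qed
  moreover have "l2_dist2 circle_measure (\<lambda>t. f (qexp t I)) (\<lambda>t. laurent_sum (seq a) M (qexp t I)) \<le> ennreal (tail2 a M)"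
    if I: "I \<in> imag_units" for I M
  proof -
    have I': "- I \<in> imag_units" by (rule imag_unit_uminus[OF I])
    note [measurable] = laurent_sum_measurable_slice[OF I] measurable_compose[OF qexp_measurable_slice[OF I] f_meas]
    let ?d = "\<lambda>k t. ennreal ((norm (L k (qexp t I) - laurent_sum (seq a) M (qexp t I)))\<^sup>2)"
    have "AE t in circle_measure. ennreal ((norm (f (qexp t I) - laurent_sum (seq a) M (qexp t I)))\<^sup>2)
        = liminf (\<lambda>k. ?d k t)"
      using AE_Cauchy_laurent_sum_slice[OF I r(1,3)] AE_Cauchy_laurent_sum_slice[OF I' r(1,3)]
    proof eventually_elim
      case (elim t)
      then have "Cauchy (\<lambda>k. L k (qexp t I))" "Cauchy (\<lambda>k. L k (inverse (qexp t I)))"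
        by (simp_all add: L_def inverse_qexp[OF I] qexp_uminus)
      then have "(\<lambda>k. L k (qexp t I)) \<longlonglongrightarrow> f (qexp t I)"
        by (simp add: f_def Cauchy_convergent_iff convergent_LIMSEQ_iff)
      then have "(\<lambda>k. ?d k t) \<longlonglongrightarrow> ennreal ((norm (f (qexp t I) - laurent_sum (seq a) M (qexp t I)))\<^sup>2)"
        by (intro tendsto_intros)
      then show ?case by (intro lim_imp_Liminf[symmetric]) auto
    qed
    then have "l2_dist2 circle_measure (\<lambda>t. f (qexp t I)) (\<lambda>t. laurent_sum (seq a) M (qexp t I))
        = (\<integral>\<^sup>+ t. liminf (\<lambda>k. ?d k t) \<partial>circle_measure)"
      unfolding l2_dist2_def by (rule nn_integral_cong_AE)
    \<comment> \<open>Fatou's lemma in \<open>k\<close> with \<open>M\<close> fixed; for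
      \<open>k\<close> beyond \<open>M\<close> each integral is already bounded by the tail.\<close>
    also have "\<dots> \<le> liminf (\<lambda>k. \<integral>\<^sup>+ t. ?d k t \<partial>circle_measure)"
      unfolding L_def by (rule nn_integral_liminf) measurable
    also have "\<dots> \<le> limsup (\<lambda>k. \<integral>\<^sup>+ t. ?d k t \<partial>circle_measure)"
      by (rule Liminf_le_Limsup) simp
    also have "\<dots> \<le> ennreal (tail2 a M)"
    proof (rule Limsup_bounded, rule eventually_sequentiallyI)
      fix k assume "M \<le> k"
      then show "(\<integral>\<^sup>+ t. ?d k t \<partial>circle_measure) \<le> ennreal (tail2 a M)"
        using l2_dist2_laurent_sum_slice[OF I, of M "r k" a] r(2)[of k] by (simp add: l2_dist2_def L_def)
    qed
    finally show ?thesis .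
  qed
  ultimately show ?thesis by blast
qed

section \<open>The correspondence between functions and coefficients\<close>

lemma has_coeffs_iff:
  "has_coeffs f a \<longleftrightarrow> f \<in> L2s \<and> (\<lambda>n. (norm (a n))\<^sup>2) summable_on UNIV \<and>
    (\<lambda>N. l2_dist2 Sigma_bd f (laurent_sum a N)) \<longlonglongrightarrow> 0"
  by (simp add: has_coeffs_def l2_dist2_def laurent_sum_def)

lemma L2s_iff:
  "f \<in> L2s \<longleftrightarrow> slice_function f \<and> f \<in> borel_measurable Sigma_bd \<and> l2_dist2 Sigma_bd f (\<lambda>_. 0) < \<infinity>"
  by (simp add: L2s_def l2_dist2_def)

lemma emeasure_Sigma_bd_space [simp]: "emeasure Sigma_bd bdB = 1"
  using emeasure_Sigma_bd[of 1] by simp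

lemma has_coeffs_measurable: "has_coeffs f a \<Longrightarrow> f \<in> borel_measurable Sigma_bd"
  by (simp add: has_coeffs_iff L2s_iff)

lemma has_coeffs_ell2: "has_coeffs f a \<Longrightarrow> \<exists>a'. a = seq a'"
  by (metis Ell2_inverse has_coeffs_iff mem_Collect_eq)

lemma l2_dist2_Sigma_bd:
  assumes "f \<in> borel_measurable Sigma_bd" "g \<in> borel_measurable Sigma_bd"
  shows "l2_dist2 Sigma_bd f g
    = (\<integral>\<^sup>+ I. l2_dist2 circle_measure (\<lambda>t. f (qexp t I)) (\<lambda>t. g (qexp t I)) \<partial>sigma_sph)"
proof -
  note [measurable] = assms
  show ?thesis unfolding l2_dist2_def by (intro nn_integral_Sigma_bd) measurable
qed

lemma parseval_Sigma_bd:
  assumes "finite F"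
  shows "l2_dist2 Sigma_bd (\<lambda>q. \<Sum>n\<in>F. q powi n * c n) (\<lambda>_. 0) = ennreal (\<Sum>n\<in>F. (norm (c n))\<^sup>2)"
proof -
  have "l2_dist2 Sigma_bd (\<lambda>q. \<Sum>n\<in>F. q powi n * c n) (\<lambda>_. 0) = (\<integral>\<^sup>+ I.
      l2_dist2 circle_measure (\<lambda>t. \<Sum>n\<in>F. qexp t I powi n * c n) (\<lambda>_. 0) \<partial>sigma_sph)"
    by (rule l2_dist2_Sigma_bd) measurable
  also have "\<dots> = (\<integral>\<^sup>+ I. ennreal (\<Sum>n\<in>F. (norm (c n))\<^sup>2) \<partial>sigma_sph)"
    by (rule nn_integral_cong) (simp add: l2_dist2_def assms parseval_slice)
  finally show ?thesis by simp
qed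

lemma laurent_sum_diff: "laurent_sum a N q - laurent_sum b N q = laurent_sum (\<lambda>n. a n - b n) N q"
  by (simp add: laurent_sum_def sum_subtractf right_diff_distrib)

lemma parseval_laurent_sum:
  "l2_dist2 Sigma_bd (laurent_sum a N) (\<lambda>_. 0) = ennreal (\<Sum>n = - int N..int N. (norm (a n))\<^sup>2)"
  using parseval_Sigma_bd[of "{- int N..int N}" a] by (simp add: laurent_sum_def[abs_def])

lemma l2_dist2_laurent_sum:
  "l2_dist2 Sigma_bd (laurent_sum a N) (laurent_sum b N)
    = ennreal (\<Sum>n = - int N..int N. (norm (a n - b n))\<^sup>2)"
  using parseval_laurent_sum[of "\<lambda>n. a n - b n" N] by (simp add: l2_dist2_def laurent_sum_diff)

lemma ennreal_squeeze_zero: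
  fixes f g h :: "nat \<Rightarrow> ennreal"
  assumes "g \<longlonglongrightarrow> 0" "h \<longlonglongrightarrow> 0" "\<And>N. f N \<le> 2 * (g N + h N)"
  shows "f \<longlonglongrightarrow> 0"
proof (rule tendsto_sandwich[OF _ _ tendsto_const])
  have "(\<lambda>N. 2 * (g N + h N)) \<longlonglongrightarrow> 2 * (0 + 0)"
    by (intro ennreal_tendsto_cmult tendsto_add assms) simp
  then show "(\<lambda>N. 2 * (g N + h N)) \<longlonglongrightarrow> 0" by simp
qed (use assms(3) in auto)

text \<open>\<open>has_coeffs\<close> records convergence averaged over all slices; the second
  conjunct supplies it on each single slice, as the study of unimodular functions requires.\<close>

lemma has_coeffs_exists:
  "\<exists>f. has_coeffs f (seq a) \<and> (\<forall>I\<in>imag_units.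
    (\<lambda>N. l2_dist2 circle_measure (\<lambda>t. f (qexp t I)) (\<lambda>t. laurent_sum (seq a) N (qexp t I))) \<longlonglongrightarrow> 0)"
proof -
  obtain f where f: "slice_function f" and [measurable]: "f \<in> borel_measurable Sigma_bd"
    and slice: "\<And>I M. I \<in> imag_units \<Longrightarrow> l2_dist2 circle_measure (\<lambda>t. f (qexp t I))
        (\<lambda>t. laurent_sum (seq a) M (qexp t I)) \<le> ennreal (tail2 a M)"
    using L2s_exists_slicewise[of a] by blast
  have tail: "(\<lambda>N. ennreal (tail2 a N)) \<longlonglongrightarrow> 0"
    using tendsto_ennrealI[OF tail2_tendsto[of a]] by simp
  have dist: "l2_dist2 Sigma_bd f (laurent_sum (seq a) M) \<le> ennreal (tail2 a M)" for M
  proof -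
    have "l2_dist2 Sigma_bd f (laurent_sum (seq a) M) \<le> (\<integral>\<^sup>+ I. ennreal (tail2 a M) \<partial>sigma_sph)"
      by (subst l2_dist2_Sigma_bd, measurable) (rule nn_integral_mono, simp add: slice)
    then show ?thesis by simp
  qed
  have "l2_dist2 Sigma_bd f (\<lambda>_. 0)
      \<le> 2 * (l2_dist2 Sigma_bd f (laurent_sum (seq a) 0) + l2_dist2 Sigma_bd (laurent_sum (seq a) 0) (\<lambda>_. 0))"
    by (rule l2_dist2_triangle) measurable
  also have "\<dots> \<le> 2 * (ennreal (tail2 a 0) + ennreal ((norm (seq a 0))\<^sup>2))"
    using dist[of 0] by (intro mult_left_mono add_mono) (auto simp: parseval_laurent_sum)
  also have "\<dots> < \<infinity>" by (simp add: ennreal_mult_less_top)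
  finally have "f \<in> L2s" using f by (simp add: L2s_iff)
  moreover have "(\<lambda>N. l2_dist2 Sigma_bd f (laurent_sum (seq a) N)) \<longlonglongrightarrow> 0"
    by (rule tendsto_sandwich[OF _ _ tendsto_const tail]) (use dist in auto)
  ultimately have "has_coeffs f (seq a)"
    by (simp add: has_coeffs_iff square_summable_seq)
  moreover have "(\<lambda>N. l2_dist2 circle_measure (\<lambda>t. f (qexp t I)) (\<lambda>t. laurent_sum (seq a) N (qexp t I))) \<longlonglongrightarrow> 0"
    if "I \<in> imag_units" for I
    by (rule tendsto_sandwich[OF _ _ tendsto_const tail]) (use slice that in auto)
  ultimately show ?thesis by blast
qed

text \<open>Parseval for the difference of the two Laurent sums dominates each single coefficient
  difference. This gives \<open>coeff_bd\<close>, and with it \<open>norm_bd\<close>, a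
  meaning.\<close>

lemma has_coeffs_unique:
  assumes f: "has_coeffs f a" and g: "has_coeffs f b"
  shows "a = b"
proof
  fix n
  note [measurable] = has_coeffs_measurable[OF f]
  have "(\<lambda>N. l2_dist2 Sigma_bd (laurent_sum a N) (laurent_sum b N)) \<longlonglongrightarrow> 0"
  proof (rule ennreal_squeeze_zero)
    show "l2_dist2 Sigma_bd (laurent_sum a N) (laurent_sum b N)
        \<le> 2 * (l2_dist2 Sigma_bd f (laurent_sum a N) + l2_dist2 Sigma_bd f (laurent_sum b N))" for N
      unfolding l2_dist2_commute[of _ f "laurent_sum a N"] by (rule l2_dist2_triangle) measurable
  qed (use f g in \<open>auto simp: has_coeffs_iff\<close>)
  moreover have "ennreal ((norm (a n - b n))\<^sup>2) \<le> l2_dist2 Sigma_bd (laurent_sum a N) (laurent_sum b N)"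
    if "nat \<bar>n\<bar> \<le> N" for N
    unfolding l2_dist2_laurent_sum using that
    by (intro ennreal_leI member_le_sum) auto
  ultimately have "ennreal ((norm (a n - b n))\<^sup>2) \<le> 0"
    by (intro LIMSEQ_le_const) auto
  then show "a n = b n" by simp
qed

lemma coeff_bd_eq: "has_coeffs f a \<Longrightarrow> coeff_bd f = a"
  unfolding coeff_bd_def by (rule the_equality) (auto dest: has_coeffs_unique)

lemma norm_bd_eq:
  assumes "has_coeffs f (seq a)"
  shows "norm_bd f = norm a"
proof -
  have "((\<lambda>n. of_real ((norm (seq a n))\<^sup>2)) has_sum (of_real ((norm a)\<^sup>2) :: quat)) UNIV"
    by (rule has_sum_of_real[OF norm_ell2_has_sum])
  then have "inner_bd f f = of_real ((norm a)\<^sup>2)"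
    by (simp add: inner_bd_def coeff_bd_eq[OF assms] mult_qcnj_self infsumI)
  then show ?thesis by (simp add: norm_bd_def del: of_real_power)
qed

lemma has_coeffs_imp_eq_ae:
  assumes f: "has_coeffs f a" and g: "has_coeffs g a"
  shows "eq_ae f g"
proof -
  note [measurable] = has_coeffs_measurable[OF f] has_coeffs_measurable[OF g]
  have "(\<lambda>N::nat. l2_dist2 Sigma_bd f g) \<longlonglongrightarrow> 0"
  proof (rule ennreal_squeeze_zero)
    show "l2_dist2 Sigma_bd f g
        \<le> 2 * (l2_dist2 Sigma_bd f (laurent_sum a N) + l2_dist2 Sigma_bd g (laurent_sum a N))" for N
      unfolding l2_dist2_commute[of _ g "laurent_sum a N"] by (rule l2_dist2_triangle) measurable
  qed (use f g in \<open>auto simp: has_coeffs_iff\<close>)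
  then have "l2_dist2 Sigma_bd f g = 0" by (simp add: LIMSEQ_const_iff)
  then show ?thesis
    by (simp add: l2_dist2_def nn_integral_0_iff_AE eq_ae_def)
qed

lemma has_coeffs_cong_ae:
  assumes f: "has_coeffs f a" and g: "g \<in> L2s" "eq_ae f g"
  shows "has_coeffs g a"
proof -
  have "l2_dist2 Sigma_bd f h = l2_dist2 Sigma_bd g h" for h
    unfolding l2_dist2_def using g(2) by (intro nn_integral_cong_AE) (auto simp: eq_ae_def)
  then show ?thesis using f g by (simp add: has_coeffs_iff)
qed

lemma has_coeffs_norm:
  assumes f: "has_coeffs f (seq a)"
  shows "l2_dist2 Sigma_bd f (\<lambda>_. 0) = ennreal ((norm a)\<^sup>2)"
proof (rule l2_dist2_limit)
  show "(\<lambda>N. l2_dist2 Sigma_bd f (laurent_sum (seq a) N)) \<longlonglongrightarrow> 0"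
    using f by (simp add: has_coeffs_iff)
  show "(\<lambda>N. l2_dist2 Sigma_bd (laurent_sum (seq a) N) (\<lambda>_. 0)) \<longlonglongrightarrow> ennreal ((norm a)\<^sup>2)"
    unfolding parseval_laurent_sum
    by (intro tendsto_ennrealI has_sum_imp_symmetric_limit norm_ell2_has_sum)
qed (use has_coeffs_measurable[OF f] in simp_all)

section \<open>Operations on boundary functions\<close>

lemma has_coeffs_add:
  assumes f: "has_coeffs f a" and g: "has_coeffs g b"
  shows "has_coeffs (\<lambda>q. f q + g q) (\<lambda>n. a n + b n)"
proof -
  note [measurable] = has_coeffs_measurable[OF f] has_coeffs_measurable[OF g]
  have le: "l2_dist2 Sigma_bd (\<lambda>q. f q + g q) (\<lambda>q. h q + k q) \<le> 2 * (l2_dist2 Sigma_bd f h + l2_dist2 Sigma_bd g k)"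
    if [measurable]: "h \<in> borel_measurable Sigma_bd" "k \<in> borel_measurable Sigma_bd" for h k
  proof -
    have "l2_dist2 Sigma_bd (\<lambda>q. f q + g q) (\<lambda>q. h q + k q)
        \<le> 2 * (l2_dist2 Sigma_bd (\<lambda>q. f q + g q) (\<lambda>q. h q + g q) + l2_dist2 Sigma_bd (\<lambda>q. h q + g q) (\<lambda>q. h q + k q))"
      by (rule l2_dist2_triangle) measurable
    then show ?thesis by (simp add: l2_dist2_def)
  qed
  have "slice_function (\<lambda>q. f q + g q)"
    unfolding slice_function_iff
  proof
    fix t
    obtain \<alpha> \<beta> \<gamma> \<delta> where "\<forall>I\<in>imag_units. f (qexp t I) = \<alpha> + I * \<beta>" "\<forall>I\<in>imag_units. g (qexp t I) = \<gamma> + I * \<delta>"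
      using f g unfolding has_coeffs_iff L2s_iff slice_function_iff by metis
    then show "\<exists>\<alpha> \<beta>. \<forall>I\<in>imag_units. f (qexp t I) + g (qexp t I) = \<alpha> + I * \<beta>"
      by (intro exI[of _ "\<alpha> + \<gamma>"] exI[of _ "\<beta> + \<delta>"]) (simp add: distrib_left)
  qed
  moreover have "l2_dist2 Sigma_bd (\<lambda>q. f q + g q) (\<lambda>_. 0) < \<infinity>"
    using f g le_less_trans[OF le[of "\<lambda>_. 0" "\<lambda>_. 0"], of \<infinity>]
    by (simp add: has_coeffs_iff L2s_iff ennreal_mult_less_top)
  moreover have "(\<lambda>N. l2_dist2 Sigma_bd (\<lambda>q. f q + g q) (laurent_sum (\<lambda>n. a n + b n) N)) \<longlonglongrightarrow> 0"
  proof (rule ennreal_squeeze_zero)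
    have "laurent_sum (\<lambda>n. a n + b n) N = (\<lambda>q. laurent_sum a N q + laurent_sum b N q)" for N
      by (simp add: fun_eq_iff laurent_sum_def distrib_left sum.distrib)
    then show "l2_dist2 Sigma_bd (\<lambda>q. f q + g q) (laurent_sum (\<lambda>n. a n + b n) N)
        \<le> 2 * (l2_dist2 Sigma_bd f (laurent_sum a N) + l2_dist2 Sigma_bd g (laurent_sum b N))" for N
      by (simp only:) (rule le; measurable)
  qed (use f g in \<open>auto simp: has_coeffs_iff\<close>)
  ultimately show ?thesis
    using f g by (simp add: has_coeffs_iff L2s_iff square_summable_add)
qed

lemma has_coeffs_rmul:
  assumes f: "has_coeffs f a"
  shows "has_coeffs (\<lambda>q. f q * c) (\<lambda>n. a n * c)"
proof -
  note [measurable] = has_coeffs_measurable[OF f]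
  have eq: "l2_dist2 Sigma_bd (\<lambda>q. f q * c) (\<lambda>q. g q * c) = ennreal ((norm c)\<^sup>2) * l2_dist2 Sigma_bd f g"
    if [measurable]: "g \<in> borel_measurable Sigma_bd" for g
    unfolding l2_dist2_def
    by (subst nn_integral_cmult[symmetric])
      (auto simp: norm_mult power_mult_distrib ennreal_mult mult.commute simp flip: left_diff_distrib)
  have "slice_function (\<lambda>q. f q * c)"
    unfolding slice_function_iff
  proof
    fix t
    obtain \<alpha> \<beta> where "\<forall>I\<in>imag_units. f (qexp t I) = \<alpha> + I * \<beta>"
      using f unfolding has_coeffs_iff L2s_iff slice_function_iff by metis
    then show "\<exists>\<alpha> \<beta>. \<forall>I\<in>imag_units. f (qexp t I) * c = \<alpha> + I * \<beta>"
      by (intro exI[of _ "\<alpha> * c"] exI[of _ "\<beta> * c"]) (simp add: distrib_right mult.assoc)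
  qed
  moreover have "l2_dist2 Sigma_bd (\<lambda>q. f q * c) (\<lambda>_. 0) < \<infinity>"
    using f eq[of "\<lambda>_. 0"] by (simp add: has_coeffs_iff L2s_iff ennreal_mult_less_top)
  moreover have "(\<lambda>N. l2_dist2 Sigma_bd (\<lambda>q. f q * c) (laurent_sum (\<lambda>n. a n * c) N)) \<longlonglongrightarrow> 0"
  proof -
    have "laurent_sum (\<lambda>n. a n * c) N = (\<lambda>q. laurent_sum a N q * c)" for N
      by (simp add: fun_eq_iff laurent_sum_def sum_distrib_right mult.assoc)
    moreover have "(\<lambda>N. ennreal ((norm c)\<^sup>2) * l2_dist2 Sigma_bd f (laurent_sum a N)) \<longlonglongrightarrow> ennreal ((norm c)\<^sup>2) * 0"
      using f by (intro ennreal_tendsto_cmult) (auto simp: has_coeffs_iff)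
    ultimately show ?thesis by (simp add: eq)
  qed
  ultimately show ?thesis
    using f by (simp add: has_coeffs_iff L2s_iff norm_mult power_mult_distrib summable_on_cmult_left)
qed

lemma has_coeffs_diff:
  assumes "has_coeffs f a" "has_coeffs g b"
  shows "has_coeffs (\<lambda>q. f q - g q) (\<lambda>n. a n - b n)"
  using has_coeffs_add[OF assms(1) has_coeffs_rmul[OF assms(2), of "- 1"]] by simp

lemma laurent_sum_single: "laurent_sum (seq (single 0 u)) N q = u"
proof -
  have "laurent_sum (seq (single 0 u)) N q = (\<Sum>n = - int N..int N. if n = 0 then u else 0)"
    unfolding laurent_sum_def by (rule sum.cong) auto
  then show ?thesis by (simp add: sum.delta)
qed

lemma has_coeffs_const: "has_coeffs (\<lambda>_. u) (seq (single 0 u))"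
proof -
  have "slice_function (\<lambda>_. u)"
    unfolding slice_function_iff by (intro allI exI[of _ u] exI[of _ 0]) simp
  moreover have "l2_dist2 Sigma_bd (\<lambda>_. u) (\<lambda>_. 0) < \<infinity>"
    by (simp add: l2_dist2_def)
  ultimately show ?thesis
    by (simp add: has_coeffs_iff L2s_iff square_summable_seq laurent_sum_single[abs_def] l2_dist2_def del: seq_operations)
qed

lemma has_coeffs_Mq:
  assumes f: "has_coeffs f (seq a)"
  shows "has_coeffs (Mq f) (seq (shift 1 a))"
proof -
  note f_meas [measurable] = has_coeffs_measurable[OF f]
  have "(\<lambda>q::quat. q) \<in> borel_measurable Sigma_bd"
    using powi_measurable[of 1] by simp
  then have Mq_meas [measurable]: "Mq g \<in> borel_measurable Sigma_bd" if "g \<in> borel_measurable Sigma_bd" for g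
    using that unfolding Mq_def by measurable
  have eq: "l2_dist2 Sigma_bd (Mq f) (Mq g) = l2_dist2 Sigma_bd f g" for g
    unfolding l2_dist2_def Mq_def
    by (intro nn_integral_cong) (simp add: bdB_eq norm_mult flip: right_diff_distrib)
  have "slice_function (Mq f)"
    unfolding slice_function_iff
  proof
    fix t
    obtain \<alpha> \<beta> where *: "\<And>I. I \<in> imag_units \<Longrightarrow> f (qexp t I) = \<alpha> + I * \<beta>"
      using f unfolding has_coeffs_iff L2s_iff slice_function_iff by metis
    have "Mq f (qexp t I) = (cos t *\<^sub>R \<alpha> - sin t *\<^sub>R \<beta>) + I * (cos t *\<^sub>R \<beta> + sin t *\<^sub>R \<alpha>)"
      if I: "I \<in> imag_units" for I
    proof -
      have "Mq f (qexp t I) = qexp t I * (\<alpha> + I * \<beta>)" by (simp add: Mq_def *[OF I])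
      also have "\<dots> = (cos t *\<^sub>R \<alpha> - sin t *\<^sub>R \<beta>) + I * (cos t *\<^sub>R \<beta> + sin t *\<^sub>R \<alpha>)"
        by (simp add: qexp_def of_real_def distrib_left distrib_right left_diff_distrib mult.assoc[symmetric] imag_unit_square[OF I])
      finally show ?thesis .
    qed
    then show "\<exists>\<alpha> \<beta>. \<forall>I\<in>imag_units. Mq f (qexp t I) = \<alpha> + I * \<beta>" by blast
  qed
  moreover have "l2_dist2 Sigma_bd (Mq f) (\<lambda>_. 0) < \<infinity>"
    using f eq[of "\<lambda>_. 0"] by (simp add: has_coeffs_iff L2s_iff Mq_def)
  moreover have "(\<lambda>N. l2_dist2 Sigma_bd (Mq f) (laurent_sum (seq (shift 1 a)) N)) \<longlonglongrightarrow> 0"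
  proof (rule ennreal_squeeze_zero)
    \<comment> \<open>Multiplication by \<open>q\<close> moves the summation interval by one, so
      \<open>Mq\<close> of a Laurent sum and the Laurent sum of the shifted sequence differ in two
      terms, at \<open>N + 1\<close> and \<open>- N\<close>; \<open>?e N\<close> is the square norm
      of this error.\<close>
    let ?e = "\<lambda>N. ennreal ((norm (seq a (int N)))\<^sup>2 + (norm (seq a (- int N - 1)))\<^sup>2)"
    show "(\<lambda>N. l2_dist2 Sigma_bd f (laurent_sum (seq a) N)) \<longlonglongrightarrow> 0"
      using f by (simp add: has_coeffs_iff)
    \<comment> \<open>Both indices lie outside the interval of radius \<open>N - 1\<close>; the
      subtraction in the naturals is exact because \<open>1 \<le> N\<close>.\<close>
    have e: "?e N \<le> ennreal (tail2 a (N - 1))" if "1 \<le> N" for N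
      using sum_le_tail2[of "{int N, - int N - 1}" "N - 1" a] that by (intro ennreal_leI) auto
    have lim: "(\<lambda>N. ennreal (tail2 a (N - 1))) \<longlonglongrightarrow> 0"
      using tendsto_ennrealI[OF tail2_tendsto[of a]] by (subst filterlim_sequentially_Suc[symmetric]) simp
    show "?e \<longlonglongrightarrow> 0"
    proof (rule tendsto_sandwich[OF _ _ tendsto_const lim])
      show "\<forall>\<^sub>F N in sequentially. ?e N \<le> ennreal (tail2 a (N - 1))"
        using e by (rule eventually_sequentiallyI)
    qed simp
    fix N
    let ?c = "\<lambda>n. if n = int N + 1 then seq a (int N) else - seq a (- int N - 1)"
    have diff: "Mq (laurent_sum (seq a) N) q - laurent_sum (seq (shift 1 a)) N q
        = (\<Sum>n\<in>{int N + 1, - int N}. q powi n * ?c n)" if "q \<in> bdB" for q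
    proof -
      have "q \<noteq> 0" using that by (auto simp: bdB_eq)
      then have "Mq (laurent_sum (seq a) N) q = (\<Sum>n = - int N..int N. q powi (n + 1) * seq a n)"
        by (simp add: Mq_def laurent_sum_def sum_distrib_left power_int_add_1' mult.assoc)
      also have "\<dots> = (\<Sum>n = - int N + 1..int N + 1. q powi n * seq a (n - 1))"
        by (rule sum.reindex_bij_witness[of _ "\<lambda>n. n - 1" "\<lambda>n. n + 1"]) auto
      also have "{- int N + 1..int N + 1} = insert (int N + 1) ({- int N..int N} - {- int N})" by auto
      finally show ?thesis
        by (simp add: laurent_sum_def[abs_def] sum_diff1)
    qed
    have "l2_dist2 Sigma_bd (Mq (laurent_sum (seq a) N)) (laurent_sum (seq (shift 1 a)) N)
        = l2_dist2 Sigma_bd (\<lambda>q. \<Sum>n\<in>{int N + 1, - int N}. q powi n * ?c n) (\<lambda>_. 0)"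
      unfolding l2_dist2_def by (intro nn_integral_cong) (simp only: diff space_Sigma_bd diff_zero)
    also have "\<dots> = ?e N"
      by (subst parseval_Sigma_bd) auto
    finally show "l2_dist2 Sigma_bd (Mq f) (laurent_sum (seq (shift 1 a)) N)
        \<le> 2 * (l2_dist2 Sigma_bd f (laurent_sum (seq a) N) + ?e N)"
      using l2_dist2_triangle[of "Mq f" Sigma_bd "Mq (laurent_sum (seq a) N)" "laurent_sum (seq (shift 1 a)) N"]
      by (simp add: eq f_meas)
  qed
  ultimately show ?thesis
    using Mq_meas[OF f_meas] by (simp add: has_coeffs_iff L2s_iff square_summable_seq del: seq_operations)
qed

section \<open>Slice regularity of power series\<close>

lemma summable_power_series_ball:
  fixes c :: "nat \<Rightarrow> 'a::{real_normed_div_algebra, banach}"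
  assumes "\<And>n. norm (c n) \<le> C" "norm q < 1"
  shows "summable (\<lambda>n. q ^ n * c n)"
proof (rule summable_comparison_test)
  show "summable (\<lambda>n. C * norm q ^ n)"
    using assms(2) by (intro summable_mult summable_geometric) simp
  show "\<exists>N. \<forall>n\<ge>N. norm (q ^ n * c n) \<le> C * norm q ^ n"
    using assms(1) by (auto simp: norm_mult norm_power mult.commute[of C] intro!: mult_left_mono)
qed

text \<open>For an imaginary unit \<open>I\<close>, the isometric field embedding of the complex
  numbers onto the plane of \<open>I\<close>; it makes complex power series available on a
  slice.\<close>

definition slice_emb :: "quat \<Rightarrow> complex \<Rightarrow> quat"
  where "slice_emb I z = slice_pt (Re z) (Im z) I"

lemma slice_emb_mult: "I \<in> imag_units \<Longrightarrow> slice_emb I (z * w) = slice_emb I z * slice_emb I w"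
  using imag_unit_square[of I]
  by (simp add: slice_emb_def of_real_def algebra_simps)

lemma slice_emb_1 [simp]: "slice_emb I 1 = 1"
  by (simp add: slice_emb_def)

lemma slice_emb_imaginary_unit [simp]: "slice_emb I \<i> = I"
  by (simp add: slice_emb_def)

lemma slice_emb_power: "I \<in> imag_units \<Longrightarrow> slice_emb I (z ^ n) = slice_emb I z ^ n"
  by (induction n) (simp_all add: slice_emb_mult)

lemma norm_slice_emb: "I \<in> imag_units \<Longrightarrow> norm (slice_emb I z) = norm z"
  using norm_slice_pt[of I "Re z" "Im z"] cmod_power2[of z]
    power2_eq_iff_nonneg[of "norm (slice_emb I z)" "norm z"]
  by (simp add: slice_emb_def)

text \<open>The components of a quaternionic power series on a slice are real parts of complex power series
  with these coefficients.\<close>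

definition component_coeff :: "quat \<Rightarrow> quat \<Rightarrow> quat \<Rightarrow> complex"
  where "component_coeff I b x = Complex (inner x b) (- inner (I * x) b)"

lemma Re_component_coeff: "Re (z * component_coeff I b x) = inner (slice_emb I z * x) b"
  by (simp add: component_coeff_def slice_emb_def of_real_def distrib_right inner_add_left)

lemma norm_component_coeff_le:
  assumes "I \<in> imag_units" "b \<in> Basis"
  shows "norm (component_coeff I b x) \<le> 2 * norm x"
proof -
  have "norm (component_coeff I b x) \<le> \<bar>inner x b\<bar> + \<bar>inner (I * x) b\<bar>"
    using cmod_le[of "component_coeff I b x"] by (simp add: component_coeff_def)
  also have "\<bar>inner x b\<bar> \<le> norm x" using Basis_le_norm[OF assms(2)] .
  also have "\<bar>inner (I * x) b\<bar> \<le> norm x"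
    using Basis_le_norm[OF assms(2), of "I * x"] assms(1) by (simp add: norm_mult imag_unit_norm)
  finally show ?thesis by simp
qed

lemma component_coeff_scaleR: "component_coeff I b (r *\<^sub>R x) = of_real r * component_coeff I b x"
  by (simp add: component_coeff_def complex_eq_iff)

text \<open>The factor \<open>\<zeta>\<close> serves both partial derivatives: 1 gives the series
  itself, and \<open>\<i>\<close> gives it multiplied by \<open>I\<close> from the left.\<close>

lemma slice_power_series_sums:
  assumes I: "I \<in> imag_units"
    and h: "\<And>b. b \<in> Basis \<Longrightarrow> (\<lambda>n. component_coeff I b (d n) * z ^ n) sums h b"
  shows "(\<lambda>n. slice_emb I \<zeta> * (slice_emb I z ^ n * d n)) sums (\<Sum>b\<in>Basis. Re (\<zeta> * h b) *\<^sub>R b)"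
proof -
  have "(\<lambda>n. \<Sum>b\<in>Basis. Re (\<zeta> * (component_coeff I b (d n) * z ^ n)) *\<^sub>R b)
      sums (\<Sum>b\<in>Basis. Re (\<zeta> * h b) *\<^sub>R b)"
    by (intro sums_sum sums_scaleR_left sums_Re sums_mult h)
  moreover have "(\<Sum>b\<in>Basis. Re (\<zeta> * (component_coeff I b (d n) * z ^ n)) *\<^sub>R b)
      = slice_emb I \<zeta> * (slice_emb I z ^ n * d n)" for n
  proof -
    have "Re (\<zeta> * (component_coeff I b (d n) * z ^ n)) = inner (slice_emb I \<zeta> * (slice_emb I z ^ n * d n)) b" for b
      using Re_component_coeff[of "\<zeta> * z ^ n" I b "d n"]
      by (simp add: mult_ac slice_emb_mult[OF I] slice_emb_power[OF I] mult.assoc)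
    then show ?thesis by (simp add: euclidean_representation)
  qed
  ultimately show ?thesis by simp
qed

text \<open>On a slice, \<open>F\<close> is assembled from real parts of the holomorphic functions
  \<open>h b\<close>. Differentiation in \<open>y\<close> inserts a factor \<open>\<i>\<close>
  before \<open>h' b\<close>, which \<open>slice_power_series_sums\<close> turns into left
  multiplication by \<open>I\<close>; this is the Cauchy-Riemann equation.\<close>

lemma slice_regular_power_series:
  assumes c: "\<And>n. norm (c n) \<le> C"
    and F: "\<And>q. q \<in> qball \<Longrightarrow> (\<lambda>n. q ^ n * c n) sums F q"
  shows "slice_regular F"
  unfolding slice_regular_def
proof
  fix I assume I: "I \<in> imag_units"
  define w where "w b n = component_coeff I b (c n)" for b n
  define h where "h b z = (\<Sum>n. w b n * z ^ n)" for b z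
  define h' where "h' b z = (\<Sum>n. diffs (w b) n * z ^ n)" for b z
  define Fx where "Fx = (\<lambda>(x, y). \<Sum>b\<in>Basis. Re (h' b (Complex x y)) *\<^sub>R b)"
  define Fy where "Fy = (\<lambda>(x, y). \<Sum>b\<in>Basis. Re (\<i> * h' b (Complex x y)) *\<^sub>R b)"
  have dom: "slice_pt x y I \<in> qball \<longleftrightarrow> norm (Complex x y) < 1" for x y
    using norm_slice_emb[OF I, of "Complex x y"] by (simp add: slice_emb_def)
  have sw: "summable (\<lambda>n. w b n * z ^ n)" if "norm z < 1" "b \<in> Basis" for b z
  proof -
    have "norm (w b n) \<le> 2 * C" for n
      using norm_component_coeff_le[OF I that(2), of "c n"] c[of n] by (simp add: w_def)
    then show ?thesis
      using summable_power_series_ball[of "w b" "2 * C" z] that(1) by (simp add: mult.commute)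
  qed
  have sw': "summable (\<lambda>n. diffs (w b) n * z ^ n)" if "norm z < 1" "b \<in> Basis" for b z
    using termdiff_converges[of z 1 "w b"] sw that by blast
  \<comment> \<open>Termwise differentiation needs convergence at a point of larger modulus; the
    midpoint of \<open>norm z\<close> and 1 serves.\<close>
  have between: "\<exists>K::complex. norm z < norm K \<and> norm K < 1" if "norm z < 1" for z :: complex
    using that by (intro exI[of _ "of_real ((norm z + 1) / 2)"]) simp
  have dh: "(h b has_field_derivative h' b z) (at z)" if z: "norm z < 1" "b \<in> Basis" for b z
  proof -
    obtain K :: complex where "norm z < norm K" "norm K < 1" using between[OF z(1)] by blast
    then show ?thesis
      unfolding h_def[abs_def] h'_def by (intro termdiffs_strong[of _ K] sw z)
  qed
  have dh': "isCont (h' b) z" if z: "norm z < 1" "b \<in> Basis" for b z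
  proof -
    obtain K :: complex where "norm z < norm K" "norm K < 1" using between[OF z(1)] by blast
    then have "(h' b has_field_derivative (\<Sum>n. diffs (diffs (w b)) n * z ^ n)) (at z)"
      unfolding h'_def[abs_def] by (intro termdiffs_strong[of _ K] sw' z)
    then show ?thesis by (rule DERIV_isCont)
  qed
  have F_eq: "F (slice_pt x y I) = (\<Sum>b\<in>Basis. Re (h b (Complex x y)) *\<^sub>R b)"
    if xy: "norm (Complex x y) < 1" for x y
  proof (rule sums_unique2[OF F])
    show "slice_pt x y I \<in> qball" using xy dom by blast
    have "(\<lambda>n. component_coeff I b (c n) * Complex x y ^ n) sums h b (Complex x y)" if "b \<in> Basis" for b
      using summable_sums[OF sw[OF xy that]] by (simp add: h_def w_def)
    from slice_power_series_sums[OF I this, of 1]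
    show "(\<lambda>n. slice_pt x y I ^ n * c n) sums (\<Sum>b\<in>Basis. Re (h b (Complex x y)) *\<^sub>R b)"
      by (simp add: slice_emb_def)
  qed
  have Fy_eq: "Fy (x, y) = I * Fx (x, y)" if xy: "norm (Complex x y) < 1" for x y
  proof -
    define d where "d n = real (Suc n) *\<^sub>R c (Suc n)" for n
    have d: "(\<lambda>n. component_coeff I b (d n) * Complex x y ^ n) sums h' b (Complex x y)" if "b \<in> Basis" for b
      using summable_sums[OF sw'[OF xy that]]
      by (simp add: h'_def w_def[abs_def] diffs_def d_def component_coeff_scaleR)
    have "(\<lambda>n. slice_emb I (Complex x y) ^ n * d n) sums Fx (x, y)"
      using slice_power_series_sums[OF I d, of 1] by (simp add: Fx_def)
    then have "(\<lambda>n. I * (slice_emb I (Complex x y) ^ n * d n)) sums (I * Fx (x, y))"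
      by (rule sums_mult)
    moreover have "(\<lambda>n. I * (slice_emb I (Complex x y) ^ n * d n)) sums Fy (x, y)"
      using slice_power_series_sums[OF I d, of \<i>] by (simp add: Fy_def)
    ultimately show ?thesis using sums_unique2 by blast
  qed
  have cont: "continuous_on {(x, y). slice_pt x y I \<in> qball} (\<lambda>p. h' b (Complex (fst p) (snd p)))" if "b \<in> Basis" for b
  proof -
    have "continuous_on {p. norm (Complex (fst p) (snd p)) < 1} (\<lambda>p. h' b (Complex (fst p) (snd p)))"
    proof (rule continuous_on_compose2[of "ball 0 1" "h' b"])
      show "continuous_on (ball 0 1) (h' b)"
        using dh' that by (intro continuous_at_imp_continuous_on) auto
      show "continuous_on {p. norm (Complex (fst p) (snd p)) < 1} (\<lambda>p. Complex (fst p) (snd p))"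
        unfolding Complex_eq by (intro continuous_intros)
    qed auto
    also have "{p. norm (Complex (fst p) (snd p)) < 1} = {(x, y). slice_pt x y I \<in> qball}"
      by (auto simp only: dom fst_conv snd_conv)
    finally show ?thesis .
  qed
  \<comment> \<open>Derivative along a curve in the slice; horizontal lines have
    \<open>\<zeta> = 1\<close> and vertical ones \<open>\<zeta> = \<i>\<close>.\<close>
  have deriv: "((\<lambda>s. F (slice_pt (u s) (v s) I)) has_vector_derivative
      (\<Sum>b\<in>Basis. Re (\<zeta> * h' b (Complex (u s0) (v s0))) *\<^sub>R b)) (at s0)"
    if uv: "((\<lambda>s. Complex (u s) (v s)) has_vector_derivative \<zeta>) (at s0)"
      and s0: "norm (Complex (u s0) (v s0)) < 1" for u v :: "real \<Rightarrow> real" and \<zeta> s0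
  proof -
    have "((\<lambda>s. Re ((h b \<circ> (\<lambda>s. Complex (u s) (v s))) s) *\<^sub>R b) has_vector_derivative
        Re (\<zeta> * h' b (Complex (u s0) (v s0))) *\<^sub>R b) (at s0)" if "b \<in> Basis" for b
      by (intro bounded_linear.has_vector_derivative[OF bounded_linear_scaleR_left]
          bounded_linear.has_vector_derivative[OF bounded_linear_Re]
          field_vector_diff_chain_at uv dh s0 that)
    then have "((\<lambda>s. \<Sum>b\<in>Basis. Re (h b (Complex (u s) (v s))) *\<^sub>R b) has_vector_derivative
        (\<Sum>b\<in>Basis. Re (\<zeta> * h' b (Complex (u s0) (v s0))) *\<^sub>R b)) (at s0)"
      by (intro has_vector_derivative_sum) simp
    \<comment> \<open>The series formula for \<open>F\<close> is known only in the ball, so the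
      curve has to stay inside near \<open>s0\<close>.\<close>
    moreover have "\<forall>\<^sub>F s in nhds s0. norm (Complex (u s) (v s)) < 1"
    proof -
      have "isCont (\<lambda>s. norm (Complex (u s) (v s))) s0"
        using has_vector_derivative_continuous[OF uv] by (intro continuous_norm)
      then show ?thesis
        using s0 by (auto simp: eventually_nhds_conv_at isCont_def intro: order_tendstoD(2))
    qed
    then have "\<forall>\<^sub>F s in nhds s0. (\<Sum>b\<in>Basis. Re (h b (Complex (u s) (v s))) *\<^sub>R b) = F (slice_pt (u s) (v s) I)"
      by eventually_elim (simp add: F_eq)
    ultimately show ?thesis
      using F_eq[OF s0] by (simp add: has_vector_derivative_cong_ev)
  qed
  show "\<exists>Fx Fy. continuous_on {(x, y). slice_pt x y I \<in> qball} Fx \<and>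
      continuous_on {(x, y). slice_pt x y I \<in> qball} Fy \<and>
      (\<forall>x y. slice_pt x y I \<in> qball \<longrightarrow>
        ((\<lambda>s. F (slice_pt s y I)) has_vector_derivative Fx (x, y)) (at x) \<and>
        ((\<lambda>s. F (slice_pt x s I)) has_vector_derivative Fy (x, y)) (at y) \<and>
        (1 / 2) *\<^sub>R (Fx (x, y) + I * Fy (x, y)) = 0)"
  proof (intro exI conjI allI impI)
    show "continuous_on {(x, y). slice_pt x y I \<in> qball} Fx" "continuous_on {(x, y). slice_pt x y I \<in> qball} Fy"
      unfolding Fx_def Fy_def case_prod_beta'[of "\<lambda>x y. \<Sum>b\<in>Basis. _ x y b"]
      by (intro continuous_intros cont; simp)+
    fix x y assume "slice_pt x y I \<in> qball"
    then have xy: "norm (Complex x y) < 1" by (simp only: dom)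
    have "((\<lambda>s. Complex s y) has_vector_derivative 1) (at x)" "((\<lambda>s. Complex x s) has_vector_derivative \<i>) (at y)"
      unfolding Complex_eq by (auto intro!: derivative_eq_intros)
    from deriv[OF this(1) xy] deriv[OF this(2) xy]
    show "((\<lambda>s. F (slice_pt s y I)) has_vector_derivative Fx (x, y)) (at x)"
      "((\<lambda>s. F (slice_pt x s I)) has_vector_derivative Fy (x, y)) (at y)"
      by (simp_all add: Fx_def Fy_def)
    show "(1 / 2) *\<^sub>R (Fx (x, y) + I * Fy (x, y)) = 0"
      using imag_unit_square[OF I] by (simp add: Fy_eq[OF xy] mult.assoc[symmetric])
  qed
qed

section \<open>Inner functions and wandering vectors\<close>

text \<open>Fatou's lemma bounds the distance from \<open>f\<close> to the pointwise limit by the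
  limit of the distances, which is 0.\<close>

lemma l2_dist2_pointwise_limit:
  assumes [measurable]: "f \<in> borel_measurable M" "\<And>N. s N \<in> borel_measurable M"
    and lim: "\<And>x. x \<in> space M \<Longrightarrow> (\<lambda>N. s N x) \<longlonglongrightarrow> g x"
    and zero: "(\<lambda>N. l2_dist2 M f (s N)) \<longlonglongrightarrow> 0"
  shows "AE x in M. f x = g x"
proof -
  have [measurable]: "g \<in> borel_measurable M"
    by (rule borel_measurable_LIMSEQ_metric[OF assms(2) lim])
  have "l2_dist2 M f g = (\<integral>\<^sup>+ x. liminf (\<lambda>N. ennreal ((norm (f x - s N x))\<^sup>2)) \<partial>M)"
    unfolding l2_dist2_def
  proof (rule nn_integral_cong)
    fix x assume "x \<in> space M"
    then have "(\<lambda>N. ennreal ((norm (f x - s N x))\<^sup>2)) \<longlonglongrightarrow> ennreal ((norm (f x - g x))\<^sup>2)"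
      by (intro tendsto_intros lim)
    then show "ennreal ((norm (f x - g x))\<^sup>2) = liminf (\<lambda>N. ennreal ((norm (f x - s N x))\<^sup>2))"
      by (intro lim_imp_Liminf[symmetric]) auto
  qed
  also have "\<dots> \<le> liminf (\<lambda>N. l2_dist2 M f (s N))"
    unfolding l2_dist2_def by (rule nn_integral_liminf) measurable
  also have "\<dots> = 0" using zero by (intro lim_imp_Liminf) auto
  finally show ?thesis by (simp add: l2_dist2_def nn_integral_0_iff_AE)
qed

text \<open>Fubini for null sets, applied to the indicator of the exceptional set.\<close>

lemma AE_Sigma_bd_slicewise:
  assumes [measurable]: "Measurable.pred Sigma_bd P" and "AE q in Sigma_bd. P q"
  shows "AE I in sigma_sph. AE t in circle_measure. P (qexp t I)"
proof -
  let ?g = "\<lambda>q. if P q then 0 else 1 :: ennreal"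
  have "(\<integral>\<^sup>+ q. ?g q \<partial>Sigma_bd) = 0"
    using assms(2) by (subst nn_integral_0_iff_AE) auto
  then have z: "(\<integral>\<^sup>+ I. \<integral>\<^sup>+ t. ?g (qexp t I) \<partial>circle_measure \<partial>sigma_sph) = 0"
    by (subst (asm) nn_integral_Sigma_bd) auto
  have "(\<lambda>x. ?g (case x of (I, t) \<Rightarrow> qexp t I)) \<in> borel_measurable (sigma_sph \<Otimes>\<^sub>M circle_measure)"
    by measurable
  then have "(\<lambda>I. \<integral>\<^sup>+ t. ?g (qexp t I) \<partial>circle_measure) \<in> borel_measurable sigma_sph"
    by (intro circle_measure.borel_measurable_nn_integral) (simp add: case_prod_beta')
  with z have "AE I in sigma_sph. (\<integral>\<^sup>+ t. ?g (qexp t I) \<partial>circle_measure) = 0"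
    by (simp add: nn_integral_0_iff_AE)
  then show ?thesis
    using AE_space
  proof eventually_elim
    case (elim I)
    have [measurable]: "Measurable.pred circle_measure (\<lambda>t. P (qexp t I))"
      using measurable_compose[OF qexp_measurable_slice assms(1)] elim(2) by simp
    have "AE t in circle_measure. ?g (qexp t I) = 0"
      using elim(1) by (subst (asm) nn_integral_0_iff_AE) auto
    then show ?case by eventually_elim (simp split: if_splits)
  qed
qed

text \<open>For a truncated sequence the product with \<open>1 + q^k u\<close> is a finite sum, to
  which \<open>parseval_slice\<close> applies.\<close>

lift_definition trunc :: "nat \<Rightarrow> ell2 \<Rightarrow> ell2" is "\<lambda>N a n. if \<bar>n\<bar> \<le> int N then a n else 0"
proof (rule finite_nonzero_values_imp_summable_on)
  fix N and a :: "int \<Rightarrow> quat"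
  show "finite {n \<in> UNIV. (norm (if \<bar>n\<bar> \<le> int N then a n else 0))\<^sup>2 \<noteq> 0}"
    by (rule finite_subset[of _ "{- int N..int N}"]) (auto split: if_splits)
qed

lemma seq_trunc [simp]: "seq (trunc N a) n = (if \<bar>n\<bar> \<le> int N then seq a n else 0)"
  by transfer simp

lemma norm_finite_support:
  assumes "finite F" "\<And>n. n \<notin> F \<Longrightarrow> seq a n = 0"
  shows "(\<Sum>n\<in>F. (norm (seq a n))\<^sup>2) = (norm a)\<^sup>2"
  by (rule has_sum_unique[OF has_sum_finite_neutralI[OF assms(1)] norm_ell2_has_sum])
    (use assms(2) in auto)

lemma trunc_tendsto: "(\<lambda>N. trunc N a) \<longlonglongrightarrow> a"
proof -
  have "(norm (trunc N a - a))\<^sup>2 \<le> tail2 a N" for N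
  proof (rule has_sum_le_finite_sums[OF norm_ell2_has_sum])
    fix F :: "int set" assume "finite F"
    have "(\<Sum>n\<in>F. (norm (seq (trunc N a - a) n))\<^sup>2) = (\<Sum>n\<in>F - {- int N..int N}. (norm (seq a n))\<^sup>2)"
      using \<open>finite F\<close> by (intro sum.mono_neutral_cong_right) auto
    also have "\<dots> \<le> tail2 a N" using \<open>finite F\<close> by (intro sum_le_tail2) auto
    finally show "(\<Sum>n\<in>F. (norm (seq (trunc N a - a) n))\<^sup>2) \<le> tail2 a N" .
  qed
  then have "(\<lambda>N. (norm (trunc N a - a))\<^sup>2) \<longlonglongrightarrow> 0"
    by (intro tendsto_sandwich[OF _ _ tendsto_const tail2_tendsto[of a]]) auto
  then have "(\<lambda>N. norm (trunc N a - a)) \<longlonglongrightarrow> 0"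
    using tendsto_real_sqrt[of "\<lambda>N. (norm (trunc N a - a))\<^sup>2" 0] by simp
  then show ?thesis by (simp add: tendsto_norm_zero_iff LIM_zero_iff)
qed

lemma norm_lmul [simp]: "norm (lmul p a) = norm p * norm a"
proof -
  have "((\<lambda>n. (norm p)\<^sup>2 * (norm (seq a n))\<^sup>2) has_sum (norm p)\<^sup>2 * (norm a)\<^sup>2) UNIV"
    by (intro has_sum_cmult_right norm_ell2_has_sum)
  then have "(norm (lmul p a))\<^sup>2 = (norm p * norm a)\<^sup>2"
    using has_sum_unique[OF norm_ell2_has_sum[of "lmul p a"]]
    by (simp add: norm_mult power_mult_distrib)
  then show ?thesis by (simp add: power2_eq_iff_nonneg)
qed

lemma bounded_linear_lmul: "bounded_linear (lmul p)"
  by (rule bounded_linear_intro[of _ "norm p"]) (auto intro: seq_eqI simp: algebra_simps)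

text \<open>On the slice of \<open>I\<close>, multiplication by \<open>1 + q\<^sup>k u\<close> with \<open>u\<close> commuting with \<open>I\<close> acts on the
  coefficients as \<open>a \<mapsto> a + lmul u (shift k a)\<close>; if the boundary function is unimodular on the
  slice, the norm of the product is that of \<open>1 + q\<^sup>k u\<close>.\<close>

lemma unimodular_slice_norm:
  assumes I: "I \<in> imag_units" and u: "norm u = 1" "u * I = I * u" and k: "k \<noteq> 0"
    and f: "f \<in> borel_measurable Sigma_bd"
    and lim: "(\<lambda>N. l2_dist2 circle_measure (\<lambda>t. f (qexp t I)) (\<lambda>t. laurent_sum (seq a) N (qexp t I))) \<longlonglongrightarrow> 0"
    and ae: "AE t in circle_measure. norm (f (qexp t I)) = 1"
  shows "(norm (a + lmul u (shift k a)))\<^sup>2 = 2"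
proof -
  define v where "v t = (\<Sum>n\<in>{0, k}. qexp t I powi n * (if n = 0 then 1 else u))" for t
  define x where "x N = trunc N a + lmul u (shift k (trunc N a))" for N
  \<comment> \<open>Widened by \<open>\<bar>k\<bar>\<close> to contain the support of both the
    truncation and its shift.\<close>
  define F where "F N = {- int N - \<bar>k\<bar>..int N + \<bar>k\<bar>}" for N
  define s where "s N t = (\<Sum>n\<in>F N. qexp t I powi n * seq (x N) n)" for N t
  have v: "v t = 1 + qexp t I powi k * u" for t
    using k by (simp add: v_def)
  have qm: "(\<lambda>t. qexp t I powi n) \<in> borel_measurable circle_measure" for n
    by (rule measurable_compose[OF qexp_measurable_slice[OF I] powi_measurable])
  note [measurable] = qm measurable_compose[OF qexp_measurable_slice[OF I] f]
    laurent_sum_measurable_slice[OF I]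
  have [measurable]: "v \<in> borel_measurable circle_measure"
    unfolding v_def by (intro borel_measurable_sum borel_measurable_times qm) auto
  have s_meas [measurable]: "s N \<in> borel_measurable circle_measure" for N
    unfolding s_def by (intro borel_measurable_sum borel_measurable_times qm) auto
  \<comment> \<open>This is where \<open>u\<close> has to commute with \<open>I\<close>:
    \<open>u\<close> moves past the powers of \<open>q\<close> and acts on the coefficients from the
    left.\<close>
  have comm: "u * qexp t I = qexp t I * u" for t
    using u(2) by (simp add: qexp_def of_real_def distrib_left distrib_right)
  have s_eq: "s N t = v t * laurent_sum (seq a) N (qexp t I)" for N t
  proof -
    have q0: "qexp t I \<noteq> 0" using norm_qexp[OF I, of t] by force
    have "(\<Sum>n\<in>F N. qexp t I powi n * seq (trunc N a) n) = laurent_sum (seq a) N (qexp t I)"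
      unfolding laurent_sum_def F_def by (intro sum.mono_neutral_cong_right) auto
    moreover have "(\<Sum>n\<in>F N. qexp t I powi n * (u * seq (trunc N a) (n - k)))
        = qexp t I powi k * u * laurent_sum (seq a) N (qexp t I)"
    proof -
      have "(\<Sum>n\<in>F N. qexp t I powi n * (u * seq (trunc N a) (n - k)))
          = (\<Sum>n = - int N + k..int N + k. qexp t I powi n * (u * seq a (n - k)))"
        unfolding F_def by (intro sum.mono_neutral_cong_right) (auto split: if_splits)
      also have "\<dots> = (\<Sum>n = - int N..int N. qexp t I powi (n + k) * (u * seq a n))"
        by (rule sum.reindex_bij_witness[of _ "\<lambda>n. n + k" "\<lambda>n. n - k"]) auto
      also have "\<dots> = (\<Sum>n = - int N..int N. qexp t I powi k * u * (qexp t I powi n * seq a n))"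
      proof (rule sum.cong[OF refl])
        fix n
        have "qexp t I powi (n + k) * u = qexp t I powi k * (qexp t I powi n * u)"
          using q0 by (simp add: power_int_add add.commute[of n] mult.assoc)
        also have "qexp t I powi n * u = u * qexp t I powi n"
          using comm by (simp add: qexp_powi[OF I])
        finally show "qexp t I powi (n + k) * (u * seq a n) = qexp t I powi k * u * (qexp t I powi n * seq a n)"
          by (simp add: mult.assoc[symmetric])
      qed
      finally show ?thesis by (simp add: laurent_sum_def sum_distrib_left)
    qed
    ultimately show ?thesis
      by (simp add: s_def x_def v distrib_left distrib_right sum.distrib del: seq_trunc)
  qed
  have "l2_dist2 circle_measure (\<lambda>t. v t * f (qexp t I)) (\<lambda>_. 0) = ennreal ((norm (a + lmul u (shift k a)))\<^sup>2)"
  proof (rule l2_dist2_limit)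
    have "l2_dist2 circle_measure (s N) (\<lambda>_. 0) = ennreal ((norm (x N))\<^sup>2)" for N
    proof -
      have "(\<Sum>n\<in>F N. (norm (seq (x N) n))\<^sup>2) = (norm (x N))\<^sup>2"
        by (rule norm_finite_support) (auto simp: F_def x_def)
      then show ?thesis
        using parseval_slice[OF I, of "F N" "seq (x N)"] by (simp add: l2_dist2_def s_def F_def)
    qed
    moreover have "(\<lambda>N. ennreal ((norm (x N))\<^sup>2)) \<longlonglongrightarrow> ennreal ((norm (a + lmul u (shift k a)))\<^sup>2)"
      unfolding x_def
      by (intro tendsto_ennrealI tendsto_intros trunc_tendsto
          bounded_linear.tendsto[OF bounded_linear_lmul] bounded_linear.tendsto[OF bounded_linear_shift])
    ultimately show "(\<lambda>N. l2_dist2 circle_measure (s N) (\<lambda>_. 0)) \<longlonglongrightarrow> ennreal ((norm (a + lmul u (shift k a)))\<^sup>2)"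
      by simp
    have "(\<lambda>N. l2_dist2 circle_measure (\<lambda>t. v t * f (qexp t I)) (s N)) \<longlonglongrightarrow> 0"
    proof (rule tendsto_sandwich[OF _ _ tendsto_const])
      \<comment> \<open>The constant 4 is the square of the bound 2 for
        \<open>norm (v t)\<close>.\<close>
      have "ennreal 4 * 0 = 0" by simp
      then show "(\<lambda>N. ennreal 4 * l2_dist2 circle_measure (\<lambda>t. f (qexp t I)) (\<lambda>t. laurent_sum (seq a) N (qexp t I))) \<longlonglongrightarrow> 0"
        using ennreal_tendsto_cmult[OF _ lim, of "ennreal 4"] by simp
      have "l2_dist2 circle_measure (\<lambda>t. v t * f (qexp t I)) (s N)
          \<le> ennreal 4 * l2_dist2 circle_measure (\<lambda>t. f (qexp t I)) (\<lambda>t. laurent_sum (seq a) N (qexp t I))" for N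
        unfolding l2_dist2_def
      proof (subst nn_integral_cmult[symmetric])
        show "(\<integral>\<^sup>+ t. ennreal ((norm (v t * f (qexp t I) - s N t))\<^sup>2) \<partial>circle_measure)
            \<le> (\<integral>\<^sup>+ t. ennreal 4 * ennreal ((norm (f (qexp t I) - laurent_sum (seq a) N (qexp t I)))\<^sup>2) \<partial>circle_measure)"
        proof (rule nn_integral_mono)
          fix t
          have "norm (v t) \<le> 2"
            using norm_triangle_ineq[of 1 "qexp t I powi k * u"] u(1)
            by (simp add: v norm_mult qexp_powi[OF I] norm_qexp[OF I])
          then have "(norm (v t))\<^sup>2 \<le> 2\<^sup>2" by (intro power_mono) auto
          moreover have "norm (v t * f (qexp t I) - s N t) = norm (v t) * norm (f (qexp t I) - laurent_sum (seq a) N (qexp t I))"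
            by (simp add: s_eq norm_mult flip: right_diff_distrib)
          ultimately show "ennreal ((norm (v t * f (qexp t I) - s N t))\<^sup>2)
              \<le> ennreal 4 * ennreal ((norm (f (qexp t I) - laurent_sum (seq a) N (qexp t I)))\<^sup>2)"
            by (simp add: power_mult_distrib ennreal_mult[symmetric] mult_right_mono ennreal_leI del: ennreal_numeral)
        qed
      qed measurable
      then show "\<forall>\<^sub>F N in sequentially. l2_dist2 circle_measure (\<lambda>t. v t * f (qexp t I)) (s N)
          \<le> ennreal 4 * l2_dist2 circle_measure (\<lambda>t. f (qexp t I)) (\<lambda>t. laurent_sum (seq a) N (qexp t I))"
        by simp
    qed simp
    then show "(\<lambda>N. l2_dist2 circle_measure (\<lambda>t. v t * f (qexp t I)) (s N)) \<longlonglongrightarrow> 0" .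
    show "(\<lambda>t. v t * f (qexp t I)) \<in> borel_measurable circle_measure" by measurable
  qed (use s_meas in auto)
  moreover have "l2_dist2 circle_measure (\<lambda>t. v t * f (qexp t I)) (\<lambda>_. 0) = ennreal 2"
  proof -
    have "l2_dist2 circle_measure (\<lambda>t. v t * f (qexp t I)) (\<lambda>_. 0)
        = (\<integral>\<^sup>+ t. ennreal ((norm (v t))\<^sup>2) \<partial>circle_measure)"
      unfolding l2_dist2_def
      by (rule nn_integral_cong_AE) (use ae in \<open>eventually_elim, simp add: norm_mult\<close>)
    also have "\<dots> = ennreal (\<Sum>n\<in>{0, k}. (norm (if n = 0 then 1 else u))\<^sup>2)"
      unfolding v_def by (rule parseval_slice[OF I]) simp
    also have "(\<Sum>n\<in>{0, k}. (norm (if n = 0 then 1 else u))\<^sup>2) = 2"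
      using k u(1) by simp
    finally show ?thesis .
  qed
  ultimately show ?thesis by (simp add: ennreal_inj flip: ennreal_numeral)
qed

lemma unimodular_imp_wandering:
  assumes \<phi>: "has_coeffs \<phi> (seq a)" and ae: "AE q in Sigma_bd. norm (\<phi> q) = 1"
  shows "wandering a"
proof -
  have "l2_dist2 Sigma_bd \<phi> (\<lambda>_. 0) = (\<integral>\<^sup>+ q. 1 \<partial>Sigma_bd)"
    unfolding l2_dist2_def by (rule nn_integral_cong_AE) (use ae in \<open>eventually_elim, simp\<close>)
  then have "(norm a)\<^sup>2 = 1"
    using has_coeffs_norm[OF \<phi>] by simp
  then have na: "norm a = 1" by (simp add: power2_eq_1_iff) (smt (verit) norm_ge_zero)
  \<comment> \<open>\<open>\<phi>\<close> is replaced by a representative whose Laurent sums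
    converge on every slice.\<close>
  obtain f where f: "has_coeffs f (seq a)" and slices: "\<And>I. I \<in> imag_units \<Longrightarrow>
      (\<lambda>N. l2_dist2 circle_measure (\<lambda>t. f (qexp t I)) (\<lambda>t. laurent_sum (seq a) N (qexp t I))) \<longlonglongrightarrow> 0"
    using has_coeffs_exists[of a] by blast
  note f_meas [measurable] = has_coeffs_measurable[OF f]
  have "AE q in Sigma_bd. norm (f q) = 1"
    using ae has_coeffs_imp_eq_ae[OF \<phi> f] unfolding eq_ae_def by eventually_elim simp
  then have good: "AE I in sigma_sph. AE t in circle_measure. norm (f (qexp t I)) = 1"
    by (intro AE_Sigma_bd_slicewise) measurable
  have "inner (lmul p (shift k a)) a = 0" if k: "k \<noteq> 0" for k p
  proof -
    let ?l = "\<lambda>p. inner (lmul p (shift k a)) a"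
    \<comment> \<open>\<open>w\<close> represents the real linear functional \<open>?l\<close>, so
      the claim becomes \<open>w = 0\<close>; the slice of \<open>I\<close> yields orthogonality of
      \<open>w\<close> to 1 and to \<open>I\<close>.\<close>
    define w where "w = (\<Sum>b\<in>Basis. ?l b *\<^sub>R b)"
    have lin: "linear ?l"
    proof
      have "lmul (p + r) b = lmul p b + lmul r b" "lmul (c *\<^sub>R p) b = c *\<^sub>R lmul p b" for p r b c
        by (auto intro!: seq_eqI simp: distrib_right)
      then show "?l (p + r) = ?l p + ?l r" "?l (c *\<^sub>R p) = c *\<^sub>R ?l p" for p r c
        by (simp_all add: inner_add_left)
    qed
    have l: "?l p = inner p w" for p
    proof -
      have "?l p = ?l (\<Sum>b\<in>Basis. inner p b *\<^sub>R b)" by (simp add: euclidean_representation)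
      also have "\<dots> = (\<Sum>b\<in>Basis. inner p b * ?l b)"
        by (simp add: linear_sum[OF lin] linear_scale[OF lin])
      also have "\<dots> = inner p w" by (simp add: w_def inner_sum_right mult.commute)
      finally show ?thesis .
    qed
    have *: "inner u w = 0"
      if "I \<in> imag_units" "AE t in circle_measure. norm (f (qexp t I)) = 1" "norm u = 1" "u * I = I * u" for I u
    proof -
      have "(norm (a + lmul u (shift k a)))\<^sup>2 = 2"
        by (rule unimodular_slice_norm[OF that(1,3,4) k f_meas slices[OF that(1)] that(2)])
      \<comment> \<open>Both summands have norm 1, so the square norm 2 leaves nothing for the cross
        term.\<close>
      also have "(norm (a + lmul u (shift k a)))\<^sup>2 = (norm a)\<^sup>2 + 2 * ?l u + (norm (lmul u (shift k a)))\<^sup>2"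
        by (simp add: power2_norm_eq_inner inner_add inner_commute del: norm_lmul)
      finally show ?thesis using l[of u] na that(3) by simp
    qed
    have "AE I in sigma_sph. inner 1 w = 0 \<and> inner I w = 0"
      using good AE_space
    proof eventually_elim
      case (elim I)
      then show ?case using *[of I 1] *[of I I] by (simp add: imag_unit_norm)
    qed
    moreover have "inner 1 w = qRe w" by (simp add: inner_quat_def)
    ultimately have AE0: "AE I in sigma_sph. qRe w = 0 \<and> inner I w = 0" by simp
    \<comment> \<open>A constant condition holding almost everywhere is true because
      \<open>sigma_sph\<close> is not the zero measure: were it false, every great circle condition
      would hold almost everywhere.\<close>
    have "qRe w = 0"
    proof (rule ccontr)
      assume w: "qRe w \<noteq> 0"
      from AE0 have "AE I in sigma_sph. inner I (Quat 0 1 0 0) = 0" by eventually_elim (simp add: w)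
      then have "Quat 0 1 0 0 = 0" by (rule sigma_sph_not_on_great_circle[rotated]) simp
      then show False by (simp add: quat_eq_iff)
    qed
    then have "w = 0"
      by (rule sigma_sph_not_on_great_circle) (use AE0 in \<open>eventually_elim, simp\<close>)
    then show ?thesis by (simp add: l)
  qed
  then have "wandering (tilde a)" using na by (simp add: wandering_tilde_iff)
  then show ?thesis using wandering_tilde[of "tilde a"] by simp
qed

text \<open>The value for \<open>\<bar>r\<bar> > 1\<close> is junk: the dilated sequence need not be square summable.\<close>

lift_definition dilate :: "real \<Rightarrow> ell2 \<Rightarrow> ell2"
  is "\<lambda>r a n. if 0 \<le> n \<and> \<bar>r\<bar> \<le> 1 then r ^ nat n *\<^sub>R a n else 0"
proof -
  fix r :: real and a :: "int \<Rightarrow> quat"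
  assume a: "(\<lambda>n. (norm (a n))\<^sup>2) summable_on UNIV"
  show "(\<lambda>n. (norm (if 0 \<le> n \<and> \<bar>r\<bar> \<le> 1 then r ^ nat n *\<^sub>R a n else 0))\<^sup>2) summable_on UNIV"
  proof (rule summable_on_comparison_test[OF a])
    fix n
    have "\<bar>r ^ nat n\<bar> * norm (a n) \<le> norm (a n)" if "\<bar>r\<bar> \<le> 1"
      using mult_right_mono[OF power_le_one[of "\<bar>r\<bar>" "nat n"] norm_ge_zero[of "a n"]] that
      by (simp add: power_abs)
    then show "(norm (if 0 \<le> n \<and> \<bar>r\<bar> \<le> 1 then r ^ nat n *\<^sub>R a n else 0))\<^sup>2 \<le> (norm (a n))\<^sup>2"
      by (auto intro!: power_mono simp: power_abs)
  qed simp
qed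

lemma seq_dilate: "0 \<le> r \<Longrightarrow> r \<le> 1 \<Longrightarrow> seq (dilate r a) n = (if 0 \<le> n then r ^ nat n *\<^sub>R seq a n else 0)"
  by transfer auto

text \<open>Up to index \<open>N\<close> the factor \<open>1 - r ^ n\<close> is at most
  \<open>1 - r ^ N\<close>, small for \<open>r\<close> near 1; beyond \<open>N\<close> it is at most
  1 and the tail bound does not depend on \<open>r\<close>. Each part receives half of
  \<open>e\<close>.\<close>

lemma dilate_approximates:
  assumes a: "a \<in> ell2_plus" and e: "0 < e"
  shows "\<exists>r. 0 < r \<and> r < 1 \<and> (norm (a - dilate r a))\<^sup>2 \<le> e"
proof -
  obtain N where N: "tail2 a N \<le> e / 2"
    using order_tendstoD(2)[OF tail2_tendsto[of a], of "e / 2"] e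
    by (auto simp: eventually_sequentially intro: less_imp_le)
  have "((\<lambda>r. (1 - r ^ N)\<^sup>2 * (norm a)\<^sup>2) \<longlongrightarrow> (1 - 1 ^ N)\<^sup>2 * (norm a)\<^sup>2) (at_left (1::real))"
    by (intro tendsto_intros)
  then have "\<forall>\<^sub>F r in at_left 1. (1 - r ^ N)\<^sup>2 * (norm a)\<^sup>2 < e / 2"
    by (rule order_tendstoD(2)) (use e in simp)
  then have "\<forall>\<^sub>F r in at_left 1. (1 - r ^ N)\<^sup>2 * (norm a)\<^sup>2 < e / 2 \<and> r \<in> {0<..<1}"
    using eventually_at_left_real[of 0 "1::real"] by (intro eventually_conj) auto
  then obtain r where r: "(1 - r ^ N)\<^sup>2 * (norm a)\<^sup>2 < e / 2" "0 < r" "r < 1"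
    using eventually_happens[of _ "at_left (1::real)"] by auto
  have diff: "seq (a - dilate r a) n = (1 - r ^ nat n) *\<^sub>R seq a n" for n
    using a r by (auto simp: seq_dilate ell2_plus_def scaleR_diff_left)
  have "(norm (a - dilate r a))\<^sup>2 \<le> (1 - r ^ N)\<^sup>2 * (norm a)\<^sup>2 + tail2 a N"
  proof (rule has_sum_le_finite_sums[OF norm_ell2_has_sum])
    fix F :: "int set" assume F: "finite F"
    let ?B = "{- int N..int N}"
    have "(\<Sum>n\<in>F. (norm (seq (a - dilate r a) n))\<^sup>2)
        = (\<Sum>n\<in>F \<inter> ?B. (norm (seq (a - dilate r a) n))\<^sup>2) + (\<Sum>n\<in>F - ?B. (norm (seq (a - dilate r a) n))\<^sup>2)"
      using F by (simp add: sum.Int_Diff)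
    also have "(\<Sum>n\<in>F \<inter> ?B. (norm (seq (a - dilate r a) n))\<^sup>2)
        \<le> (\<Sum>n\<in>F \<inter> ?B. (1 - r ^ N)\<^sup>2 * (norm (seq a n))\<^sup>2)"
    proof (rule sum_mono)
      fix n assume n: "n \<in> F \<inter> ?B"
      then have "r ^ N \<le> r ^ nat n" using r by (intro power_decreasing) auto
      moreover have "r ^ nat n \<le> 1" using r by (intro power_le_one) auto
      ultimately have "(1 - r ^ nat n)\<^sup>2 \<le> (1 - r ^ N)\<^sup>2" by (intro power_mono) auto
      then show "(norm (seq (a - dilate r a) n))\<^sup>2 \<le> (1 - r ^ N)\<^sup>2 * (norm (seq a n))\<^sup>2"
        unfolding diff by (simp add: power_mult_distrib mult_right_mono)
    qed
    also have "\<dots> \<le> (1 - r ^ N)\<^sup>2 * (norm a)\<^sup>2"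
      using F norm_ell2_sum_le[of "F \<inter> ?B" a]
      by (simp add: sum_distrib_left[symmetric] mult_left_mono)
    also have "(\<Sum>n\<in>F - ?B. (norm (seq (a - dilate r a) n))\<^sup>2) \<le> (\<Sum>n\<in>F - ?B. (norm (seq a n))\<^sup>2)"
    proof (rule sum_mono)
      fix n
      have "\<bar>1 - r ^ nat n\<bar> \<le> 1" using r power_le_one[of r "nat n"] zero_le_power[of r "nat n"] by linarith
      then show "(norm (seq (a - dilate r a) n))\<^sup>2 \<le> (norm (seq a n))\<^sup>2"
        unfolding diff by (auto intro!: power_mono mult_left_le_one_le)
    qed
    also have "\<dots> \<le> tail2 a N" using F by (intro sum_le_tail2) auto
    finally show "(\<Sum>n\<in>F. (norm (seq (a - dilate r a) n))\<^sup>2) \<le> (1 - r ^ N)\<^sup>2 * (norm a)\<^sup>2 + tail2 a N"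
      by simp
  qed
  with r N show ?thesis by (intro exI[of _ r]) linarith
qed

lemma laurent_sum_power_series:
  assumes "\<And>n. n < 0 \<Longrightarrow> a n = 0"
  shows "laurent_sum a N q = (\<Sum>n<Suc N. q ^ n * a (int n))"
proof -
  have "laurent_sum a N q = (\<Sum>n = 0..int N. q powi n * a n)"
    unfolding laurent_sum_def using assms by (intro sum.mono_neutral_right) auto
  also have "\<dots> = (\<Sum>n<Suc N. q ^ n * a (int n))"
    by (rule sum.reindex_bij_witness[of _ int nat]) (auto simp: power_int_def)
  finally show ?thesis .
qed

lemma wandering_imp_inner_function:
  assumes a: "wandering a" "a \<in> ell2_plus" and \<phi>: "has_coeffs \<phi> (seq a)"
  shows "inner_function \<phi>"
proof -
  note [measurable] = has_coeffs_measurable[OF \<phi>]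
  define F where "F q = (\<Sum>n. q ^ n * seq a (int n))" for q
  have F: "(\<lambda>n. q ^ n * seq a (int n)) sums F q" if "norm q < 1" for q
    unfolding F_def using summable_power_series_ball[OF norm_seq_le that] by (rule summable_sums)
  have F_le: "norm (F q) \<le> 1" if "norm q < 1" for q
    by (rule wandering_power_series_bound[OF a that F[OF that]])
  have reg: "slice_regular F"
    by (rule slice_regular_power_series[of "\<lambda>n. seq a (int n)" "norm a"]) (simp_all add: norm_seq_le F)
  have bv: "boundary_value F \<phi>"
    unfolding boundary_value_def using \<phi> a(2) F by (auto simp: ell2_plus_def)
  \<comment> \<open>The excess of \<open>norm (\<phi> q)\<close> over 1 is at most the distance to
    any value of norm at most 1, so closeness in square mean suffices and no radial limits are
    taken.\<close>
  have approx: "(\<integral>\<^sup>+ q. ennreal ((max 0 (norm (\<phi> q) - 1))\<^sup>2) \<partial>Sigma_bd) \<le> ennreal e" if e: "0 < e" for e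
  proof -
    obtain r where r: "0 < r" "r < 1" "(norm (a - dilate r a))\<^sup>2 \<le> e"
      using dilate_approximates[OF a(2) e] by blast
    let ?b = "dilate r a"
    obtain \<psi> where \<psi>: "has_coeffs \<psi> (seq ?b)" using has_coeffs_exists by blast
    note [measurable] = has_coeffs_measurable[OF \<psi>]
    \<comment> \<open>For \<open>r < 1\<close> the points \<open>r *\<^sub>R q\<close> lie in the
      open ball, where the power series converges pointwise.\<close>
    have "AE q in Sigma_bd. \<psi> q = F (r *\<^sub>R q)"
    proof (rule l2_dist2_pointwise_limit)
      show "(\<lambda>N. l2_dist2 Sigma_bd \<psi> (laurent_sum (seq ?b) N)) \<longlonglongrightarrow> 0"
        using \<psi> by (simp add: has_coeffs_iff)
      fix q assume "q \<in> space Sigma_bd"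
      then have "norm (r *\<^sub>R q) < 1" using r by (simp add: bdB_eq)
      then have "(\<lambda>N. \<Sum>n<N. (r *\<^sub>R q) ^ n * seq a (int n)) \<longlonglongrightarrow> F (r *\<^sub>R q)"
        using F unfolding sums_def by blast
      then have "(\<lambda>N. \<Sum>n<Suc N. (r *\<^sub>R q) ^ n * seq a (int n)) \<longlonglongrightarrow> F (r *\<^sub>R q)"
        by (rule LIMSEQ_Suc)
      moreover have "laurent_sum (seq ?b) N q = (\<Sum>n<Suc N. (r *\<^sub>R q) ^ n * seq a (int n))" for N
        using r by (subst laurent_sum_power_series) (auto simp: seq_dilate scaleR_power)
      ultimately show "(\<lambda>N. laurent_sum (seq ?b) N q) \<longlonglongrightarrow> F (r *\<^sub>R q)" by simp
    qed measurable
    then have \<psi>_le: "AE q in Sigma_bd. norm (\<psi> q) \<le> 1"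
      using AE_space
    proof eventually_elim
      case (elim q)
      then show ?case using F_le[of "r *\<^sub>R q"] r by (simp add: bdB_eq)
    qed
    have "(\<integral>\<^sup>+ q. ennreal ((max 0 (norm (\<phi> q) - 1))\<^sup>2) \<partial>Sigma_bd) \<le> l2_dist2 Sigma_bd \<phi> \<psi>"
      unfolding l2_dist2_def
    proof (rule nn_integral_mono_AE)
      show "AE q in Sigma_bd. ennreal ((max 0 (norm (\<phi> q) - 1))\<^sup>2) \<le> ennreal ((norm (\<phi> q - \<psi> q))\<^sup>2)"
        using \<psi>_le
      proof eventually_elim
        case (elim q)
        then have "max 0 (norm (\<phi> q) - 1) \<le> norm (\<phi> q - \<psi> q)"
          using norm_triangle_ineq2[of "\<phi> q" "\<psi> q"] by simp
        then show ?case by (intro ennreal_leI power_mono) auto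
      qed
    qed
    also have "\<dots> = ennreal ((norm (a - ?b))\<^sup>2)"
    proof -
      have "(\<lambda>n. seq a n - seq ?b n) = seq (a - ?b)" by (simp add: fun_eq_iff)
      then show ?thesis
        using has_coeffs_norm[of "\<lambda>q. \<phi> q - \<psi> q" "a - ?b"] has_coeffs_diff[OF \<phi> \<psi>]
        by (simp add: l2_dist2_def)
    qed
    also have "\<dots> \<le> ennreal e" using r(3) by (rule ennreal_leI)
    finally show ?thesis .
  qed
  have "(\<integral>\<^sup>+ q. ennreal ((max 0 (norm (\<phi> q) - 1))\<^sup>2) \<partial>Sigma_bd) \<le> 0"
    by (rule ennreal_le_epsilon) (simp add: approx)
  then have "(\<integral>\<^sup>+ q. ennreal ((max 0 (norm (\<phi> q) - 1))\<^sup>2) \<partial>Sigma_bd) = 0" by simp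
  then have le: "AE q in Sigma_bd. norm (\<phi> q) \<le> 1"
    by (subst (asm) nn_integral_0_iff_AE) (auto simp: max_def)
  \<comment> \<open>The two integrals add up to 1 and the second one is already 1. The bound
    \<open>le\<close> keeps \<open>ennreal\<close> from cutting off negative values of the first
    integrand.\<close>
  have "(\<integral>\<^sup>+ q. ennreal (1 - (norm (\<phi> q))\<^sup>2) \<partial>Sigma_bd) + l2_dist2 Sigma_bd \<phi> (\<lambda>_. 0)
      = (\<integral>\<^sup>+ q. ennreal (1 - (norm (\<phi> q))\<^sup>2) + ennreal ((norm (\<phi> q))\<^sup>2) \<partial>Sigma_bd)"
    unfolding l2_dist2_def by (subst nn_integral_add) auto
  also have "\<dots> = (\<integral>\<^sup>+ q. 1 \<partial>Sigma_bd)"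
  proof (rule nn_integral_cong_AE)
    show "AE q in Sigma_bd. ennreal (1 - (norm (\<phi> q))\<^sup>2) + ennreal ((norm (\<phi> q))\<^sup>2) = 1"
      using le by eventually_elim (simp add: ennreal_plus[symmetric] power_le_one del: ennreal_plus)
  qed
  finally have "(\<integral>\<^sup>+ q. ennreal (1 - (norm (\<phi> q))\<^sup>2) \<partial>Sigma_bd) + 1 = 1"
    using has_coeffs_norm[OF \<phi>] norm_wandering[OF a(1)] by simp
  then have "1 + (\<integral>\<^sup>+ q. ennreal (1 - (norm (\<phi> q))\<^sup>2) \<partial>Sigma_bd) = 1 + 0"
    by (simp add: add.commute)
  then have "(\<integral>\<^sup>+ q. ennreal (1 - (norm (\<phi> q))\<^sup>2) \<partial>Sigma_bd) = 0"
    unfolding ennreal_add_left_cancel by simp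
  then have "AE q in Sigma_bd. ennreal (1 - (norm (\<phi> q))\<^sup>2) = 0"
    by (subst (asm) nn_integral_0_iff_AE) auto
  with le have "AE q in Sigma_bd. norm (\<phi> q) = 1"
  proof eventually_elim
    case (elim q)
    then have "1\<^sup>2 \<le> (norm (\<phi> q))\<^sup>2" by (simp add: ennreal_eq_0_iff)
    then show ?case using elim(1) power2_le_imp_le[of 1 "norm (\<phi> q)"] by simp
  qed
  moreover have "bounded (F ` qball)"
    using F_le by (auto intro!: boundedI[of _ 1])
  ultimately show ?thesis
    unfolding inner_function_def Hinf_def using reg bv F_le by auto
qed

lemma inner_function_imp_wandering:
  assumes "inner_function \<phi>"
  shows "\<exists>a\<in>ell2_plus. wandering a \<and> has_coeffs \<phi> (seq a)"
proof -
  obtain a where a: "has_coeffs \<phi> (seq a)" "\<forall>n<0. seq a n = 0"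
    using assms has_coeffs_ell2 unfolding inner_function_def boundary_value_def by metis
  then show ?thesis
    using unimodular_imp_wandering[OF a(1)] assms by (auto simp: inner_function_def ell2_plus_def)
qed

section \<open>Invariant subspaces of the Hardy space\<close>

lemma H2_iff: "f \<in> H2 \<longleftrightarrow> (\<exists>a\<in>ell2_plus. has_coeffs f (seq a))"
proof
  assume "f \<in> H2"
  then obtain a where "has_coeffs f a" "\<forall>n<0. a n = 0" by (auto simp: H2_def)
  then show "\<exists>a\<in>ell2_plus. has_coeffs f (seq a)"
    using has_coeffs_ell2[of f a] by (auto simp: ell2_plus_def)
qed (auto simp: H2_def ell2_plus_def)

lemma conv_eq_infsum:
  "wandering a \<Longrightarrow> seq (conv a g) = (\<lambda>n. \<Sum>\<^sub>\<infinity>k. seq a k * seq g (n - k))"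
  by (simp add: fun_eq_iff infsumI[OF seq_conv_has_sum'])

text \<open>For wandering \<open>a\<close> the convolution is the square summable sequence of
  \<open>conv a\<close>; uniqueness of coefficients removes the choice hidden in
  \<open>is_star\<close>.\<close>

lemma star_H2_iff:
  assumes a: "wandering a" and \<phi>: "has_coeffs \<phi> (seq a)"
  shows "h \<in> star_H2 \<phi> \<longleftrightarrow> (\<exists>g\<in>ell2_plus. has_coeffs h (seq (conv a g)))"
proof
  assume "h \<in> star_H2 \<phi>"
  then obtain g x y where g: "g \<in> H2" and x: "has_coeffs \<phi> x" and y: "has_coeffs g y"
    and h: "has_coeffs h (\<lambda>n. \<Sum>\<^sub>\<infinity>k. x k * y (n - k))"
    unfolding star_H2_def is_star_def by blast
  obtain b where "b \<in> ell2_plus" "has_coeffs g (seq b)" using g H2_iff by blast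
  with h show "\<exists>g\<in>ell2_plus. has_coeffs h (seq (conv a g))"
    using has_coeffs_unique[OF x \<phi>] has_coeffs_unique[OF y] by (auto simp: conv_eq_infsum[OF a])
next
  assume "\<exists>g\<in>ell2_plus. has_coeffs h (seq (conv a g))"
  then obtain b where b: "b \<in> ell2_plus" "has_coeffs h (seq (conv a b))" by blast
  obtain g where g: "has_coeffs g (seq b)" using has_coeffs_exists by blast
  then have "g \<in> H2" using b(1) H2_iff by blast
  moreover have "is_star \<phi> g h"
    unfolding is_star_def using \<phi> g b(2) conv_eq_infsum[OF a] by (intro exI[of _ "seq a"] exI[of _ "seq b"]) simp
  ultimately show "h \<in> star_H2 \<phi>" unfolding star_H2_def by blast
qed

definition coeff_set :: "(quat \<Rightarrow> quat) set \<Rightarrow> ell2 set"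
  where "coeff_set K = {a. \<exists>f\<in>K. has_coeffs f (seq a)}"

context
  fixes K assumes K: "subspace_H2 K"
begin

text \<open>\<open>K\<close> contains all representatives in \<open>H2\<close> of its elements, so
  membership depends on the coefficients alone; this is what permits the passage to
  \<open>ell2\<close> and back.\<close>

lemma mem_iff_coeff_set:
  assumes f: "has_coeffs f (seq a)"
  shows "f \<in> K \<longleftrightarrow> a \<in> coeff_set K"
proof
  assume "a \<in> coeff_set K"
  then obtain g where g: "g \<in> K" "has_coeffs g (seq a)" by (auto simp: coeff_set_def)
  then have "g \<in> H2" using K by (auto simp: subspace_H2_def)
  then obtain b where b: "b \<in> ell2_plus" "has_coeffs g (seq b)" using H2_iff by blast
  then have "a = b" using has_coeffs_unique[OF g(2) b(2)] by (simp add: seq_inject)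
  then have "f \<in> H2" using b(1) f H2_iff by blast
  moreover have "eq_ae g f" by (rule has_coeffs_imp_eq_ae[OF g(2) f])
  ultimately show "f \<in> K" using K g(1) unfolding subspace_H2_def by blast
qed (use f in \<open>auto simp: coeff_set_def\<close>)

lemma coeff_set_subset: "coeff_set K \<subseteq> ell2_plus"
proof
  fix a assume "a \<in> coeff_set K"
  then obtain g where g: "g \<in> K" "has_coeffs g (seq a)" by (auto simp: coeff_set_def)
  have "g \<in> H2" using g(1) K unfolding subspace_H2_def by blast
  then obtain b where b: "b \<in> ell2_plus" "has_coeffs g (seq b)" using H2_iff by blast
  then show "a \<in> ell2_plus" using has_coeffs_unique[OF g(2) b(2)] by (simp add: seq_inject)
qed

lemma mem_K_coeffs: "f \<in> K \<Longrightarrow> \<exists>a\<in>coeff_set K. has_coeffs f (seq a)"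
  using K H2_iff mem_iff_coeff_set by (metis subspace_H2_def subsetD)

lemma coeff_set_rmul: "a \<in> coeff_set K \<Longrightarrow> rmul a p \<in> coeff_set K"
proof -
  assume "a \<in> coeff_set K"
  then obtain f where f: "f \<in> K" "has_coeffs f (seq a)" by (auto simp: coeff_set_def)
  have "(\<lambda>n. seq a n * p) = seq (rmul a p)" by (simp add: fun_eq_iff)
  then show ?thesis
    using has_coeffs_rmul[OF f(2), of p] f(1) K by (auto simp: coeff_set_def subspace_H2_def)
qed

lemma subspace_coeff_set: "subspace (coeff_set K)"
  unfolding subspace_def
proof (intro conjI ballI allI)
  have "seq (single 0 0) = seq 0" by (simp add: fun_eq_iff)
  then show "0 \<in> coeff_set K"
    using K has_coeffs_const[of 0] by (auto simp: coeff_set_def subspace_H2_def)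
next
  fix a b assume "a \<in> coeff_set K" "b \<in> coeff_set K"
  then obtain f g where "f \<in> K" "has_coeffs f (seq a)" "g \<in> K" "has_coeffs g (seq b)"
    by (auto simp: coeff_set_def)
  moreover have "(\<lambda>n. seq a n + seq b n) = seq (a + b)" by (simp add: fun_eq_iff)
  ultimately show "a + b \<in> coeff_set K"
    using has_coeffs_add[of f "seq a" g "seq b"] K by (auto simp: coeff_set_def subspace_H2_def)
next
  fix c a assume "a \<in> coeff_set K"
  then have "rmul a (of_real c) \<in> coeff_set K" by (rule coeff_set_rmul)
  moreover have "rmul a (of_real c) = c *\<^sub>R a" by (rule seq_eqI) (simp add: of_real_def)
  ultimately show "c *\<^sub>R a \<in> coeff_set K" by simp
qed

lemma norm_bd_diff:
  assumes "has_coeffs f (seq a)" "has_coeffs g (seq b)"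
  shows "norm_bd (\<lambda>q. f q - g q) = norm (a - b)"
proof -
  have "(\<lambda>n. seq a n - seq b n) = seq (a - b)" by (simp add: fun_eq_iff)
  then show ?thesis using norm_bd_eq[of "\<lambda>q. f q - g q" "a - b"] has_coeffs_diff[OF assms] by simp
qed

text \<open>\<open>norm_bd\<close> is the norm of the coefficients, and every element of
  \<open>ell2\<close> belongs to some boundary function, so limits transfer both ways.\<close>

lemma closed_H2_iff: "closed_H2 K \<longleftrightarrow> closed (coeff_set K)"
proof
  assume cl: "closed_H2 K"
  show "closed (coeff_set K)"
    unfolding closed_sequential_limits
  proof (intro allI impI, elim conjE)
    fix x l assume x: "\<forall>n. x n \<in> coeff_set K" "x \<longlonglongrightarrow> l"
    then obtain F where F: "\<And>n. F n \<in> K" "\<And>n. has_coeffs (F n) (seq (x n))"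
      unfolding coeff_set_def by simp metis
    obtain f where f: "has_coeffs f (seq l)" using has_coeffs_exists by blast
    have "l \<in> ell2_plus"
      using closed_sequentially[OF closed_ell2_plus] x coeff_set_subset by blast
    then have "f \<in> H2" using f H2_iff by blast
    moreover have "(\<lambda>k. norm_bd (\<lambda>q. F k q - f q)) \<longlonglongrightarrow> 0"
      using x(2) by (simp add: norm_bd_diff[OF F(2) f] tendsto_norm_zero_iff LIM_zero_iff)
    ultimately have "f \<in> K" using cl F(1) unfolding closed_H2_def by blast
    then show "l \<in> coeff_set K" using mem_iff_coeff_set[OF f] by simp
  qed
next
  assume cl: "closed (coeff_set K)"
  show "closed_H2 K"
    unfolding closed_H2_def
  proof (intro allI ballI impI, elim conjE)
    fix F f assume F: "\<forall>k. F k \<in> K" "(\<lambda>k. norm_bd (\<lambda>q. F k q - f q)) \<longlonglongrightarrow> 0" and "f \<in> H2"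
    then obtain b where b: "has_coeffs f (seq b)" using H2_iff by blast
    have "\<exists>x\<in>coeff_set K. has_coeffs (F k) (seq x)" for k using F(1) mem_K_coeffs by blast
    then obtain x where x: "\<And>k. x k \<in> coeff_set K" "\<And>k. has_coeffs (F k) (seq (x k))" by metis
    have "x \<longlonglongrightarrow> b"
      using F(2) by (simp add: norm_bd_diff[OF x(2) b] tendsto_norm_zero_iff LIM_zero_iff)
    then have "b \<in> coeff_set K" using closed_sequentially[OF cl] x(1) by blast
    then show "f \<in> K" using mem_iff_coeff_set[OF b] by simp
  qed
qed

lemma Mq_invariant_iff: "Mq ` K \<subseteq> K \<longleftrightarrow> (\<forall>a\<in>coeff_set K. shift 1 a \<in> coeff_set K)"
proof
  assume M: "Mq ` K \<subseteq> K"
  show "\<forall>a\<in>coeff_set K. shift 1 a \<in> coeff_set K"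
    using M has_coeffs_Mq unfolding coeff_set_def by blast
next
  assume M: "\<forall>a\<in>coeff_set K. shift 1 a \<in> coeff_set K"
  show "Mq ` K \<subseteq> K"
    using M mem_K_coeffs has_coeffs_Mq mem_iff_coeff_set by blast
qed

text \<open>The zero subspace is closed and invariant, but the range of an inner function contains
  its generator of norm 1; hence the two cases have to be told apart on coefficients.\<close>

lemma nontrivial_iff: "\<not> (\<forall>f\<in>K. eq_ae f (\<lambda>q. 0)) \<longleftrightarrow> coeff_set K \<noteq> {0}"
proof -
  have zero: "has_coeffs (\<lambda>_. 0) (seq 0)"
    using has_coeffs_const[of 0] by (simp add: seq_eqI[of "single 0 0" 0])
  have "eq_ae f (\<lambda>q. 0) \<longleftrightarrow> a = 0" if f: "has_coeffs f (seq a)" for f a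
  proof
    assume "eq_ae f (\<lambda>q. 0)"
    moreover have "(\<lambda>q. 0) \<in> L2s" using zero unfolding has_coeffs_iff by blast
    ultimately have "has_coeffs (\<lambda>q. 0) (seq a)" using has_coeffs_cong_ae[OF f] by blast
    from has_coeffs_unique[OF this zero] show "a = 0" by (simp add: seq_inject)
  qed (use has_coeffs_imp_eq_ae[OF f] zero in auto)
  then have "(\<forall>f\<in>K. eq_ae f (\<lambda>q. 0)) \<longleftrightarrow> (\<forall>a\<in>coeff_set K. a = 0)"
    using mem_K_coeffs unfolding coeff_set_def by blast
  then show ?thesis using subspace_0[OF subspace_coeff_set] by blast
qed

lemma eq_star_H2_iff:
  assumes "wandering a" "has_coeffs \<phi> (seq a)"
  shows "K = star_H2 \<phi> \<longleftrightarrow> coeff_set K = conv a ` ell2_plus"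
proof
  assume eq: "K = star_H2 \<phi>"
  show "coeff_set K = conv a ` ell2_plus"
  proof (intro equalityI subsetI)
    fix b assume "b \<in> coeff_set K"
    then obtain f where f: "f \<in> star_H2 \<phi>" "has_coeffs f (seq b)" using eq by (auto simp: coeff_set_def)
    then obtain g where g: "g \<in> ell2_plus" "has_coeffs f (seq (conv a g))"
      using star_H2_iff[OF assms] by blast
    then show "b \<in> conv a ` ell2_plus"
      using has_coeffs_unique[OF f(2) g(2)] by (auto simp: seq_inject)
  next
    fix b assume b: "b \<in> conv a ` ell2_plus"
    obtain f where f: "has_coeffs f (seq b)" using has_coeffs_exists by blast
    then have "f \<in> star_H2 \<phi>" using b by (auto simp: star_H2_iff[OF assms])
    then show "b \<in> coeff_set K" using eq f by (auto simp: coeff_set_def)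
  qed
next
  assume eq: "coeff_set K = conv a ` ell2_plus"
  show "K = star_H2 \<phi>"
  proof (intro equalityI subsetI)
    fix f assume "f \<in> K"
    then obtain b where b: "b \<in> coeff_set K" "has_coeffs f (seq b)" using mem_K_coeffs by blast
    then obtain g where "g \<in> ell2_plus" "b = conv a g" unfolding eq by auto
    with b(2) show "f \<in> star_H2 \<phi>" by (auto simp: star_H2_iff[OF assms])
  next
    fix f assume "f \<in> star_H2 \<phi>"
    then obtain g where g: "g \<in> ell2_plus" "has_coeffs f (seq (conv a g))"
      using star_H2_iff[OF assms] by blast
    then show "f \<in> K" using mem_iff_coeff_set[OF g(2)] eq by simp
  qed
qed

end

theorem theorem1p4:
  fixes K :: "(quat \<Rightarrow> quat) set"
  assumes "subspace_H2 K"
  shows "((closed_H2 K \<and> Mq ` K \<subseteq> K \<and> \<not> (\<forall>f\<in>K. eq_ae f (\<lambda>q. 0)))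
            \<longleftrightarrow> (\<exists>\<phi>. inner_function \<phi> \<and> K = star_H2 \<phi>))
       \<and> (\<forall>\<phi>\<^sub>1 \<phi>\<^sub>2. inner_function \<phi>\<^sub>1 \<and> inner_function \<phi>\<^sub>2 \<and> K = star_H2 \<phi>\<^sub>1 \<and> K = star_H2 \<phi>\<^sub>2
            \<longrightarrow> (\<exists>u::quat. norm u = 1 \<and> is_star \<phi>\<^sub>1 (\<lambda>q. u) \<phi>\<^sub>2))"
proof (intro conjI iffI allI impI)
  assume "closed_H2 K \<and> Mq ` K \<subseteq> K \<and> \<not> (\<forall>f\<in>K. eq_ae f (\<lambda>q. 0))"
  then have "closed (coeff_set K) \<and> (\<forall>a\<in>coeff_set K. shift 1 a \<in> coeff_set K) \<and> coeff_set K \<noteq> {0}"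
    unfolding closed_H2_iff[OF assms] Mq_invariant_iff[OF assms] nontrivial_iff[OF assms] .
  then obtain a where a: "a \<in> coeff_set K" "wandering a" "coeff_set K = conv a ` ell2_plus"
    using invariant_subspace_generator[of "coeff_set K"] subspace_coeff_set[OF assms]
      coeff_set_subset[OF assms] coeff_set_rmul[OF assms] by blast
  obtain \<phi> where \<phi>: "has_coeffs \<phi> (seq a)" using has_coeffs_exists by blast
  have "inner_function \<phi>"
    using wandering_imp_inner_function[OF a(2) _ \<phi>] a(1) coeff_set_subset[OF assms] by blast
  moreover have "K = star_H2 \<phi>" using eq_star_H2_iff[OF assms a(2) \<phi>] a(3) by simp
  ultimately show "\<exists>\<phi>. inner_function \<phi> \<and> K = star_H2 \<phi>" by blast
next
  assume "\<exists>\<phi>. inner_function \<phi> \<and> K = star_H2 \<phi>"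
  then obtain \<phi> where \<phi>: "inner_function \<phi>" "K = star_H2 \<phi>" by blast
  obtain a where a: "a \<in> ell2_plus" "wandering a" "has_coeffs \<phi> (seq a)"
    using inner_function_imp_wandering[OF \<phi>(1)] by blast
  have M: "coeff_set K = conv a ` ell2_plus" using eq_star_H2_iff[OF assms a(2,3)] \<phi>(2) by simp
  show "closed_H2 K"
    unfolding closed_H2_iff[OF assms] M by (rule closed_conv_ell2_plus[OF a(2)])
  show "Mq ` K \<subseteq> K"
    unfolding Mq_invariant_iff[OF assms] M
    by (auto simp: conv_shift[OF a(2), symmetric] ell2_plus_def)
  have "conv a (single 0 1) \<in> coeff_set K" unfolding M by (auto simp: ell2_plus_def)
  moreover have "conv a (single 0 1) \<noteq> 0"
    using norm_conv[OF a(2), of "single 0 1"] by auto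
  ultimately show "\<not> (\<forall>f\<in>K. eq_ae f (\<lambda>q. 0))"
    unfolding nontrivial_iff[OF assms] by blast
next
  fix \<phi>\<^sub>1 \<phi>\<^sub>2
  assume *: "inner_function \<phi>\<^sub>1 \<and> inner_function \<phi>\<^sub>2 \<and> K = star_H2 \<phi>\<^sub>1 \<and> K = star_H2 \<phi>\<^sub>2"
  obtain a where a: "wandering a" "has_coeffs \<phi>\<^sub>1 (seq a)"
    using * inner_function_imp_wandering by blast
  obtain b where b: "wandering b" "has_coeffs \<phi>\<^sub>2 (seq b)"
    using * inner_function_imp_wandering by blast
  have "conv a ` ell2_plus = conv b ` ell2_plus"
    using * eq_star_H2_iff[OF assms a, THEN iffD1] eq_star_H2_iff[OF assms b, THEN iffD1] by argo
  then obtain u where u: "norm u = 1" "b = rmul a u"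
    using generator_unique[OF a(1) b(1)] by blast
  \<comment> \<open>Right multiplication by \<open>u\<close> is the star product with the constant
    \<open>u\<close>.\<close>
  have "b = conv a (single 0 u)" by (simp add: conv_single[OF a(1)] u(2))
  then have "is_star \<phi>\<^sub>1 (\<lambda>q. u) \<phi>\<^sub>2"
    unfolding is_star_def using a(2) b(2) has_coeffs_const[of u] conv_eq_infsum[OF a(1)]
    by (intro exI[of _ "seq a"] exI[of _ "seq (single 0 u)"]) simp
  with u(1) show "\<exists>u. norm u = 1 \<and> is_star \<phi>\<^sub>1 (\<lambda>q. u) \<phi>\<^sub>2" by blast
qed

end
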